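(* For every prime $p$ there is a complex hyperbolic surface $X$ with an isometric action of $\mathbb{Z}/p\mathbb{Z}$ that is not free and has only isolated fixed points.
   Context: $\mathbb{H}^2_{\mathbb{C}}$ denotes complex hyperbolic $2$-space, on which $\mathrm{SU}(2,1)$ acts by holomorphic isometries. A complex hyperbolic lattice is a discrete subgroup $\Gamma<\mathrm{SU}(2,1)$ such that $\mathbb{H}^2_{\mathbb{C}}/\Gamma$ has finite volume. A complex hyperbolic surface is a quotient $X=\mathbb{H}^2_{\mathbb{C}}/\Gamma$ with $\Gamma<\mathrm{SU}(2,1)$ a torsion-free lattice, with its induced metric. An action of $\mathbb{Z}/p\mathbb{Z}$ is not free if some nontrivial element has a fixed point; it has only isolated fixed points if the fixed point set of every nontrivial element consists of isolated points. *)

theory Defs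
  imports
    "HOL-Analysis.Analysis"
    "HOL-Algebra.Group_Action"
    "HOL-Algebra.Elementary_Groups"
    "HOL-Computational_Algebra.Primes"
begin

section \<open>The group SU(2,1)\<close>

definition herm :: "complex^3 \<Rightarrow> complex^3 \<Rightarrow> complex" where
  "herm x y = x$1 * cnj (y$1) + x$2 * cnj (y$2) - x$3 * cnj (y$3)"

definition SU21 :: "(complex^3^3) monoid" where
  "SU21 = \<lparr>carrier = {A. (\<forall>x y. herm (A *v x) (A *v y) = herm x y) \<and> det A = 1},
           monoid.mult = (**), one = mat 1\<rparr>"

lemma SU21_simps [simp]:
  "monoid.mult SU21 = (**)" "one SU21 = mat 1"
  by (simp_all add: SU21_def)

lemma SU21_iff:
  "A \<in> carrier SU21 \<longleftrightarrow> (\<forall>x y. herm (A *v x) (A *v y) = herm x y) \<and> det A = 1"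
  by (simp add: SU21_def)

lemma group_SU21: "group SU21"
proof (rule groupI)
  fix A assume A: "A \<in> carrier SU21"
  then have "invertible A"
    by (simp add: SU21_iff invertible_det_nz)
  then obtain B where B: "A ** B = mat 1" "B ** A = mat 1"
    by (auto simp: invertible_def)
  have "det A * det B = 1"
    using B(1) by (metis det_mul det_I)
  moreover have "herm (B *v x) (B *v y) = herm x y" for x y
  proof -
    have "herm (B *v x) (B *v y) = herm (A *v (B *v x)) (A *v (B *v y))"
      using A by (simp add: SU21_iff)
    then show ?thesis by (simp add: matrix_vector_mul_assoc B)
  qed
  ultimately have "B \<in> carrier SU21"
    using A by (simp add: SU21_iff)
  with B show "\<exists>B\<in>carrier SU21. B \<otimes>\<^bsub>SU21\<^esub> A = \<one>\<^bsub>SU21\<^esub>" by auto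
qed (auto simp: SU21_iff det_mul matrix_mul_assoc simp flip: matrix_vector_mul_assoc)


section \<open>Complex hyperbolic 2-space\<close>

text \<open>
  The ball model: a point \<open>z\<close> of the unit ball of \<open>\<complex>\<^sup>2\<close> stands for the
  \<^const>\<open>herm\<close>-negative line spanned by \<open>(z\<^sub>1, z\<^sub>2, 1)\<close>, and SU(2,1) acts
  projectively.
\<close>

definition CH2 :: "(complex^2) set" where
  "CH2 = ball 0 1"

definition CH2_lift :: "complex^2 \<Rightarrow> complex^3" where
  "CH2_lift z = vector [z$1, z$2, 1]"

definition CH2_proj :: "complex^3 \<Rightarrow> complex^2" where
  "CH2_proj v = vector [v$1 / v$3, v$2 / v$3]"

definition CH2_act :: "complex^3^3 \<Rightarrow> complex^2 \<Rightarrow> complex^2" where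
  "CH2_act A = (\<lambda>z\<in>CH2. CH2_proj (A *v CH2_lift z))"

text \<open>
  The distance of the Bergman metric, normalized to holomorphic sectional curvature \<open>-1\<close>:
  \<open>cosh\<^sup>2 (d(z,w)/2) = \<langle>z,w\<rangle>\<langle>w,z\<rangle> / (\<langle>z,z\<rangle>\<langle>w,w\<rangle>)\<close>.
\<close>

definition CH2_dist :: "complex^2 \<Rightarrow> complex^2 \<Rightarrow> real" where
  "CH2_dist z w =
     2 * arcosh (cmod (herm (CH2_lift z) (CH2_lift w)) /
       sqrt (cmod (herm (CH2_lift z) (CH2_lift z)) * cmod (herm (CH2_lift w) (CH2_lift w))))"

text \<open>
  The Riemannian volume of the same metric.  The metric has eigenvalue \<open>4/(1-|z|\<^sup>2)\<^sup>2\<close> on the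
  complex line through \<open>z\<close> and \<open>4/(1-|z|\<^sup>2)\<close> on its orthogonal complement, each of
  real multiplicity two.
\<close>

definition CH2_vol :: "(complex^2) measure" where
  "CH2_vol = density lborel (\<lambda>z. ennreal (16 / (1 - (norm z)\<^sup>2) ^ 3) * indicator CH2 z)"


subsection \<open>SU(2,1) acts on the ball by isometries\<close>

lemma herm_scale: "herm (a *s x) (b *s y) = a * cnj b * herm x y"
  by (simp add: herm_def algebra_simps)

lemma herm_self: "herm v v = of_real ((cmod (v$1))\<^sup>2 + (cmod (v$2))\<^sup>2 - (cmod (v$3))\<^sup>2)"
  by (simp only: herm_def of_real_add of_real_diff complex_norm_square)

lemma CH2_iff: "z \<in> CH2 \<longleftrightarrow> Re (herm (CH2_lift z) (CH2_lift z)) < 0"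
proof -
  have "norm z < 1 \<longleftrightarrow> (norm z)\<^sup>2 < 1"
    by (simp add: abs_square_less_1)
  moreover have "(norm z)\<^sup>2 = (cmod (z$1))\<^sup>2 + (cmod (z$2))\<^sup>2"
    by (simp add: norm_vec_def L2_set_def sum_2)
  ultimately show ?thesis
    by (simp add: CH2_def herm_self CH2_lift_def)
qed

lemma negative_third_nonzero: "Re (herm v v) < 0 \<Longrightarrow> v$3 \<noteq> 0"
  using sum_power2_ge_zero[of "cmod (v$1)" "cmod (v$2)"] by (auto simp: herm_self not_less[symmetric])

lemma CH2_lift_proj: "v$3 \<noteq> 0 \<Longrightarrow> v = v$3 *s CH2_lift (CH2_proj v)"
  by (simp add: vec_eq_iff forall_3 CH2_lift_def CH2_proj_def)

lemma CH2_proj_lift: "CH2_proj (CH2_lift z) = z"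
  by (simp add: vec_eq_iff forall_2 CH2_lift_def CH2_proj_def)

lemma CH2_proj_scale: "c \<noteq> 0 \<Longrightarrow> CH2_proj (c *s v) = CH2_proj v"
  by (simp add: vec_eq_iff forall_2 CH2_proj_def)

lemma CH2_proj_in: assumes "Re (herm v v) < 0" shows "CH2_proj v \<in> CH2"
proof -
  let ?w = "CH2_lift (CH2_proj v)"
  have nz: "v$3 \<noteq> 0" using assms by (rule negative_third_nonzero)
  have "herm v v = v$3 * cnj (v$3) * herm ?w ?w"
    using CH2_lift_proj[OF nz] herm_scale by metis
  then have "Re (herm v v) = (cmod (v$3))\<^sup>2 * Re (herm ?w ?w)"
    by (simp only: flip: complex_norm_square) (simp only: Re_complex_of_real Im_complex_of_real times_complex.sel mult_zero_left diff_zero)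
  with assms nz show ?thesis
    by (simp add: CH2_iff mult_less_0_iff)
qed

lemma CH2_lift_act:
  assumes "A \<in> carrier SU21" "z \<in> CH2"
  obtains c where "c \<noteq> 0" "A *v CH2_lift z = c *s CH2_lift (CH2_act A z)" "CH2_act A z \<in> CH2"
proof -
  let ?v = "A *v CH2_lift z"
  have neg: "Re (herm ?v ?v) < 0"
    using assms by (simp add: SU21_iff CH2_iff)
  show thesis
    using that[of "?v$3"] CH2_lift_proj[of ?v] CH2_proj_in[OF neg]
      negative_third_nonzero[OF neg] assms(2)
    by (simp add: CH2_act_def)
qed

lemma CH2_act_mult:
  assumes "A \<in> carrier SU21" "B \<in> carrier SU21" "z \<in> CH2"
  shows "CH2_act (A ** B) z = CH2_act A (CH2_act B z)"
proof -
  obtain c where c: "c \<noteq> 0" "B *v CH2_lift z = c *s CH2_lift (CH2_act B z)" "CH2_act B z \<in> CH2"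
    using CH2_lift_act[OF assms(2,3)] .
  have "(A ** B) *v CH2_lift z = c *s (A *v CH2_lift (CH2_act B z))"
    by (simp add: c(2) vector_scalar_commute flip: matrix_vector_mul_assoc)
  then have "CH2_proj ((A ** B) *v CH2_lift z) = CH2_proj (A *v CH2_lift (CH2_act B z))"
    using c(1) by (simp only: CH2_proj_scale not_False_eq_True)
  moreover have "CH2_act C y = CH2_proj (C *v CH2_lift y)" if "y \<in> CH2" for C y
    using that by (simp add: CH2_act_def)
  ultimately show ?thesis
    using assms(3) c(3) by simp
qed

lemma CH2_act_one: "CH2_act (mat 1) = (\<lambda>z\<in>CH2. z)"
  by (auto simp: CH2_act_def CH2_proj_lift restrict_def)

lemma group_action_CH2: "group_action SU21 CH2 CH2_act"
proof -
  interpret group SU21 by (rule group_SU21)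
  have closed: "CH2_act A z \<in> CH2" if "A \<in> carrier SU21" "z \<in> CH2" for A z
    using CH2_lift_act[OF that] by blast
  have inv: "CH2_act (inv\<^bsub>SU21\<^esub> A) (CH2_act A z) = z" "CH2_act A (CH2_act (inv\<^bsub>SU21\<^esub> A) z) = z"
    if "A \<in> carrier SU21" "z \<in> CH2" for A z
    using that l_inv[of A] r_inv[of A] CH2_act_mult[of "inv\<^bsub>SU21\<^esub> A" A z]
      CH2_act_mult[of A "inv\<^bsub>SU21\<^esub> A" z]
    by (simp_all add: CH2_act_one)
  have Bij: "CH2_act A \<in> Bij CH2" if "A \<in> carrier SU21" for A
  proof -
    have "bij_betw (CH2_act A) CH2 CH2"
      using that by (intro bij_betw_byWitness[where f' = "CH2_act (inv\<^bsub>SU21\<^esub> A)"])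
        (auto simp: inv closed)
    then show ?thesis by (simp add: Bij_def CH2_act_def)
  qed
  have "CH2_act \<in> hom SU21 (BijGroup CH2)"
  proof (rule homI)
    fix A B assume AB: "A \<in> carrier SU21" "B \<in> carrier SU21"
    have "CH2_act (A ** B) = compose CH2 (CH2_act A) (CH2_act B)"
    proof
      fix z show "CH2_act (A ** B) z = compose CH2 (CH2_act A) (CH2_act B) z"
        using AB by (cases "z \<in> CH2") (simp_all add: CH2_act_mult compose_def, simp add: CH2_act_def)
    qed
    then show "CH2_act (A \<otimes>\<^bsub>SU21\<^esub> B) = CH2_act A \<otimes>\<^bsub>BijGroup CH2\<^esub> CH2_act B"
      using AB by (simp add: BijGroup_def Bij)
  qed (simp add: BijGroup_def Bij)
  then show ?thesis
    by (intro group_action.intro group_hom.intro group_hom_axioms.intro group_SU21 group_BijGroup)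
qed

lemma CH2_dist_act:
  assumes "A \<in> carrier SU21" "z \<in> CH2" "w \<in> CH2"
  shows "CH2_dist (CH2_act A z) (CH2_act A w) = CH2_dist z w"
proof -
  obtain a where a: "a \<noteq> 0" "A *v CH2_lift z = a *s CH2_lift (CH2_act A z)"
    using CH2_lift_act[OF assms(1,2)] .
  obtain b where b: "b \<noteq> 0" "A *v CH2_lift w = b *s CH2_lift (CH2_act A w)"
    using CH2_lift_act[OF assms(1,3)] .
  have h: "herm (CH2_lift x) (CH2_lift y) = herm (A *v CH2_lift x) (A *v CH2_lift y)" for x y
    using assms(1) by (simp add: SU21_iff)
  have zw: "herm (CH2_lift z) (CH2_lift w) = a * cnj b * herm (CH2_lift (CH2_act A z)) (CH2_lift (CH2_act A w))"
    by (subst h, subst a(2), subst b(2), rule herm_scale)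
  have zz: "herm (CH2_lift z) (CH2_lift z) = a * cnj a * herm (CH2_lift (CH2_act A z)) (CH2_lift (CH2_act A z))"
    by (subst h, simp only: a(2) herm_scale)
  have ww: "herm (CH2_lift w) (CH2_lift w) = b * cnj b * herm (CH2_lift (CH2_act A w)) (CH2_lift (CH2_act A w))"
    by (subst h, simp only: b(2) herm_scale)
  show ?thesis
    unfolding CH2_dist_def zw zz ww
    using a(1) b(1) by (simp add: norm_mult real_sqrt_mult)
qed


section \<open>Lattices and complex hyperbolic surfaces\<close>

definition CH2_quotient :: "(complex^3^3) set \<Rightarrow> (complex^2) set set" where
  "CH2_quotient \<Gamma> = orbits (SU21\<lparr>carrier := \<Gamma>\<rparr>) CH2 CH2_act"

text \<open>
  The projection to the quotient maps a Borel set of representatives bijectively, and hence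
  volume-preservingly, so the volume of the set is the volume of the quotient.
\<close>

definition finite_covolume :: "(complex^3^3) set \<Rightarrow> bool" where
  "finite_covolume \<Gamma> \<longleftrightarrow>
     (\<exists>F \<in> sets borel. F \<subseteq> CH2 \<and> (\<forall>P \<in> CH2_quotient \<Gamma>. \<exists>!z. z \<in> P \<inter> F) \<and>
        emeasure CH2_vol F < \<infinity>)"

definition complex_hyperbolic_lattice :: "(complex^3^3) set \<Rightarrow> bool" where
  "complex_hyperbolic_lattice \<Gamma> \<longleftrightarrow> subgroup \<Gamma> SU21 \<and> discrete \<Gamma> \<and> finite_covolume \<Gamma>"

definition torsion_free :: "('a, 'b) monoid_scheme \<Rightarrow> bool" where
  "torsion_free G \<longleftrightarrow>
     (\<forall>g \<in> carrier G. \<forall>n::nat. 0 < n \<and> g [^]\<^bsub>G\<^esub> n = \<one>\<^bsub>G\<^esub> \<longrightarrow> g = \<one>\<^bsub>G\<^esub>)"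

definition complex_hyperbolic_surface :: "(complex^2) set set \<Rightarrow> bool" where
  "complex_hyperbolic_surface X \<longleftrightarrow>
     (\<exists>\<Gamma>. complex_hyperbolic_lattice \<Gamma> \<and> torsion_free (SU21\<lparr>carrier := \<Gamma>\<rparr>) \<and>
        X = CH2_quotient \<Gamma>)"

text \<open>The metric induced on a quotient, whose points are orbits.\<close>

definition surface_dist :: "(complex^2) set \<Rightarrow> (complex^2) set \<Rightarrow> real" where
  "surface_dist P Q = Inf {CH2_dist z w | z w. z \<in> P \<and> w \<in> Q}"


section \<open>Isometric actions\<close>

definition isometric_action ::
    "('g, 'b) monoid_scheme \<Rightarrow> 'x set \<Rightarrow> ('x \<Rightarrow> 'x \<Rightarrow> real) \<Rightarrow> ('g \<Rightarrow> 'x \<Rightarrow> 'x) \<Rightarrow> bool" where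
  "isometric_action G X d \<phi> \<longleftrightarrow>
     group_action G X \<phi> \<and> (\<forall>g \<in> carrier G. \<forall>x \<in> X. \<forall>y \<in> X. d (\<phi> g x) (\<phi> g y) = d x y)"

definition free_action ::
    "('g, 'b) monoid_scheme \<Rightarrow> 'x set \<Rightarrow> ('g \<Rightarrow> 'x \<Rightarrow> 'x) \<Rightarrow> bool" where
  "free_action G X \<phi> \<longleftrightarrow> (\<forall>g \<in> carrier G. g \<noteq> \<one>\<^bsub>G\<^esub> \<longrightarrow> invariants X \<phi> g = {})"

definition only_isolated_fixed_points ::
    "('g, 'b) monoid_scheme \<Rightarrow> 'x set \<Rightarrow> ('x \<Rightarrow> 'x \<Rightarrow> real) \<Rightarrow> ('g \<Rightarrow> 'x \<Rightarrow> 'x) \<Rightarrow> bool" where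
  "only_isolated_fixed_points G X d \<phi> \<longleftrightarrow>
     (\<forall>g \<in> carrier G. g \<noteq> \<one>\<^bsub>G\<^esub> \<longrightarrow>
        (\<forall>x \<in> invariants X \<phi> g. \<exists>e>0. \<forall>y \<in> invariants X \<phi> g. d x y < e \<longrightarrow> y = x))"

end

theory Submission
  imports Defs "HOL-Computational_Algebra.Polynomial"
begin

text \<open>
  Let \<open>E\<close> be a CM field and \<open>a\<close> an element of its real subfield that is positive at exactly one place. The
  hermitian form \<open>|x|^2 + |y|^2 - a |z|^2\<close> is indefinite at that place only, so the isometries congruent to 1 modulo 4 that
  preserve an order of \<open>E\<close> form a torsion-free group \<open>\<Gamma>\<close>, which is discrete because the form is definite at the other
  places. It is cocompact: every point of the ball provides a norm in which the lattice has three
  independent short vectors, and a basis of short vectors has only finitely many types (Gram matrix, determinant, residue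
  modulo four times the determinant), while two bases of the same type differ by an element of \<open>\<Gamma>\<close>.

  A diagonal matrix \<open>g\<close> of order \<open>p\<close> over the order normalizes \<open>\<Gamma>\<close> and fixes the origin. A fixed point of its action on the
  quotient comes from an element of order \<open>p\<close> in \<open>g \<Gamma>\<close>, and fixed points are isolated if such an element has no repeated
  eigenvalue on a negative vector. For odd \<open>p\<close> and \<open>g = diag(\<zeta>, 1/\<zeta>, 1)\<close> this holds since a repeated eigenvalue
  would make a product of two differences of distinct \<open>p\<close>-th roots of unity divisible by 4. For \<open>p = 2\<close> and
  \<open>g = diag(-1, -1, 1)\<close> over the twelfth cyclotomic field, the element would be a reflection in a positive
  vector, which is ruled out modulo 4 by a norm computation (an instance of the product formula for norm residue symbols).
  For \<open>p \<ge> 5\<close> the order is the ring of integers of the \<open>p\<close>-th cyclotomic field.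
\<close>

text \<open>The element \<open>g\<close> itself fixes an isolated point. The obstacle is the rest of
  the coset \<open>\<Gamma> g^k\<close>: one of its elements could be a complex reflection, which
  fixes a complex line of the ball pointwise. The congruence modulo 4 serves two purposes, to kill
  torsion and to exclude such reflections. Modulo 2 would already fail for torsion, since diag(-1,
  -1, 1) is congruent to 1 modulo 2. Cocompactness rests on the hermitian form having no isotropic
  vectors, and this comes from a place where the form is definite. So the field must have at least
  two complex places. The field of third roots of unity has only one; therefore p = 3 is treated,
  like p = 2, over the twelfth cyclotomic field, with \<open>a = 1 + sqrt 3\<close>. For p at least
  5, \<open>a\<close> is an integral multiple of \<open>\<zeta> + 1/\<zeta>\<close> shifted by an
  integer. Instead of norms and ideals, the arguments over a general order use only that boundedly
  many conjugates leave finitely many elements, together with pigeonhole counting. The conjugations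
  of the p-th cyclotomic ring are obtained from total ramification at p.\<close>

interpretation SU21: group SU21
  by (rule group_SU21)

lemma SU21_mult_closed [intro, simp]:
  "A \<in> carrier SU21 \<Longrightarrow> B \<in> carrier SU21 \<Longrightarrow> A ** B \<in> carrier SU21"
  using SU21.m_closed by simp

lemma SU21_inv_mult [simp]:
  assumes "A \<in> carrier SU21"
  shows "inv\<^bsub>SU21\<^esub> A ** A = mat 1" "A ** inv\<^bsub>SU21\<^esub> A = mat 1"
  using SU21.l_inv[OF assms] SU21.r_inv[OF assms] by simp_all

lemma CH2_act_closed [intro, simp]: "A \<in> carrier SU21 \<Longrightarrow> z \<in> CH2 \<Longrightarrow> CH2_act A z \<in> CH2"
  by (rule group_action.element_image[OF group_action_CH2]) auto

lemma CH2_act_one_apply [simp]: "z \<in> CH2 \<Longrightarrow> CH2_act (mat 1) z = z"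
  by (simp add: CH2_act_one)

lemma CH2_act_inv [simp]:
  assumes "A \<in> carrier SU21" "z \<in> CH2"
  shows "CH2_act (inv\<^bsub>SU21\<^esub> A) (CH2_act A z) = z" "CH2_act A (CH2_act (inv\<^bsub>SU21\<^esub> A) z) = z"
  using assms CH2_act_mult[of "inv\<^bsub>SU21\<^esub> A" A z] CH2_act_mult[of A "inv\<^bsub>SU21\<^esub> A" z] by simp_all

lemma CH2_zero [simp]: "0 \<in> CH2"
  by (simp add: CH2_def)

lemma norm_CH2: "(norm (z :: complex^2))\<^sup>2 = (cmod (z$1))\<^sup>2 + (cmod (z$2))\<^sup>2"
  by (simp add: norm_vec_def L2_set_def sum_2)

lemma matrix_vector_axis: "((A :: complex^'n^'m) *v axis j 1)$i = A$i$j"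
  by (simp add: matrix_vector_mult_def axis_def if_distrib cong: if_cong)

section \<open>Boundedness and proper discontinuity\<close>

text \<open>Preserving the form means that the inverse is \<open>U\<close>, the conjugate transpose
  with signs from diag(1, 1, -1). Signs do not change absolute values, so entry bounds pass to
  inverses.\<close>

lemma SU21_inv_entry:
  assumes "A \<in> carrier SU21"
  shows "cmod ((inv\<^bsub>SU21\<^esub> A)$i$j) = cmod (A$j$i)"
proof -
  define s :: "3 \<Rightarrow> complex" where "s i = (if i = 3 then -1 else 1)" for i
  define U :: "complex^3^3" where "U = (\<chi> i j. s i * s j * cnj (A$j$i))"
  have herm_axis: "herm (A *v axis j 1) (A *v axis i 1) = (\<Sum>k\<in>UNIV. s k * A$k$j * cnj (A$k$i))" for i j
    by (simp add: herm_def s_def sum_3 matrix_vector_axis)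
  have "(U ** A)$i$j = (mat 1 :: complex^3^3)$i$j" for i j
  proof -
    have "(U ** A)$i$j = s i * herm (A *v axis j 1) (A *v axis i 1)"
      unfolding herm_axis by (simp add: U_def matrix_matrix_mult_def sum_3 algebra_simps)
    also have "herm (A *v axis j 1) (A *v axis i 1) = herm (axis j 1) (axis i 1)"
      using assms by (simp add: SU21_iff)
    also have "s i * \<dots> = (mat 1 :: complex^3^3)$i$j"
      using exhaust_3[of i] exhaust_3[of j] by (auto simp: herm_def s_def mat_def axis_def)
    finally show ?thesis .
  qed
  then have "U ** A = mat 1"
    by (simp add: vec_eq_iff)
  then have "U = inv\<^bsub>SU21\<^esub> A"
    using assms by (metis SU21_inv_mult(2) matrix_mul_assoc matrix_mul_lid matrix_mul_rid)
  moreover have "cmod (U$i$j) = cmod (A$j$i)"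
    by (simp add: U_def s_def norm_mult)
  ultimately show ?thesis by simp
qed

lemma matrix_mult_entry_bound:
  fixes A B :: "complex^3^3"
  assumes "\<And>i j. cmod (A$i$j) \<le> a" "\<And>i j. cmod (B$i$j) \<le> b"
  shows "cmod ((A ** B)$i$j) \<le> 3 * a * b"
proof -
  have a0: "0 \<le> a"
    using assms(1) norm_ge_zero order_trans by blast
  have "cmod ((A ** B)$i$j) \<le> (\<Sum>k\<in>UNIV. cmod (A$i$k * B$k$j))"
    unfolding matrix_matrix_mult_def by (simp add: norm_sum)
  also have "\<dots> \<le> (\<Sum>k\<in>(UNIV::3 set). a * b)"
    using assms a0 by (intro sum_mono) (auto simp: norm_mult intro!: mult_mono)
  finally show ?thesis by simp
qed

lemma CH2_act_zero: "CH2_act A 0 = vector [A$1$3 / A$3$3, A$2$3 / A$3$3]"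
  by (simp add: CH2_act_def CH2_proj_def CH2_lift_def matrix_vector_mult_def sum_3)

lemma SU21_third_column:
  assumes "A \<in> carrier SU21"
  shows "(cmod (A$1$3))\<^sup>2 + (cmod (A$2$3))\<^sup>2 - (cmod (A$3$3))\<^sup>2 = -1"
proof -
  have "herm (A *v axis 3 1) (A *v axis 3 1) = herm (axis 3 1) (axis 3 1)"
    using assms by (simp add: SU21_iff)
  then have "complex_of_real ((cmod (A$1$3))\<^sup>2 + (cmod (A$2$3))\<^sup>2 - (cmod (A$3$3))\<^sup>2) = of_real (-1)"
    unfolding herm_self matrix_vector_axis by (simp add: axis_def)
  then show ?thesis
    unfolding of_real_eq_iff .
qed

text \<open>The stabilizer of the origin is compact: fixing 0 clears the third column above its last
  entry, orthogonality then clears the third row, and a unitary 2 by 2 block and a unit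
  remain.\<close>

lemma SU21_fix_zero_bound:
  assumes A: "A \<in> carrier SU21" and fix0: "CH2_act A 0 = 0"
  shows "cmod (A$i$j) \<le> 1"
proof -
  have nz: "A$3$3 \<noteq> 0"
    using SU21_third_column[OF A] by (auto simp: power2_eq_square) (smt (verit) zero_le_square)
  have z: "A$1$3 = 0" "A$2$3 = 0"
    using fix0 nz by (auto simp: CH2_act_zero vec_eq_iff forall_2)
  then have one: "(cmod (A$3$3))\<^sup>2 = 1"
    using SU21_third_column[OF A] by simp
  have row: "A$3$j = 0" if "j \<noteq> 3" for j
  proof -
    have "herm (A *v axis j 1) (A *v axis 3 1) = herm (axis j 1) (axis 3 1)"
      using A by (simp add: SU21_iff)
    then have "- (A$3$j * cnj (A$3$3)) = 0"
      using that z by (simp add: herm_def matrix_vector_axis) (simp add: axis_def)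
    then show ?thesis using nz by simp
  qed
  have col: "(cmod (A$1$j))\<^sup>2 + (cmod (A$2$j))\<^sup>2 = 1" if "j \<noteq> 3" for j
  proof -
    have "herm (A *v axis j 1) (A *v axis j 1) = herm (axis j 1) (axis j 1)"
      using A by (simp add: SU21_iff)
    then have "complex_of_real ((cmod (A$1$j))\<^sup>2 + (cmod (A$2$j))\<^sup>2) = of_real 1"
      unfolding herm_self matrix_vector_axis using that row exhaust_3[of j]
      by (auto simp: axis_def)
    then show ?thesis unfolding of_real_eq_iff .
  qed
  have "(cmod (A$i$j))\<^sup>2 \<le> 1"
  proof (cases "j = 3")
    case True then show ?thesis using z one exhaust_3[of i] by auto
  next
    case False
    then show ?thesis
      using col[OF False] row[OF False] exhaust_3[of i]
      by (auto) (smt (verit) zero_le_power2)+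
  qed
  then show ?thesis by (simp add: abs_square_le_1)
qed

text \<open>With \<open>c = cosh t\<close> and \<open>s = sinh t\<close> this is the hyperbolic
  translation along the first coordinate axis.\<close>

definition boost :: "real \<Rightarrow> real \<Rightarrow> complex^3^3" where
  "boost c s = vector [vector [of_real c, 0, of_real s], vector [0, 1, 0], vector [of_real s, 0, of_real c]]"

definition rotation :: "complex \<Rightarrow> complex \<Rightarrow> complex^3^3" where
  "rotation u v = vector [vector [u, - cnj v, 0], vector [v, cnj u, 0], vector [0, 0, 1]]"

lemma boost_SU21:
  assumes "c\<^sup>2 - s\<^sup>2 = 1"
  shows "boost c s \<in> carrier SU21"
proof -
  have *: "complex_of_real c * complex_of_real c = 1 + of_real s * of_real s"
    using assms by (metis add.commute diff_add_cancel of_real_1 of_real_add of_real_mult power2_eq_square)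
  have "herm (boost c s *v x) (boost c s *v y) = herm x y" for x y
  proof -
    have "herm (boost c s *v x) (boost c s *v y) = x$2 * cnj (y$2)
       + (of_real c * of_real c - of_real s * of_real s) * (x$1 * cnj (y$1) - x$3 * cnj (y$3))"
      by (simp add: herm_def boost_def matrix_vector_mult_def sum_3) (simp add: algebra_simps)
    then show ?thesis by (simp add: * herm_def)
  qed
  moreover have "det (boost c s) = 1"
    by (simp add: det_3 boost_def *)
  ultimately show ?thesis by (simp add: SU21_iff)
qed

lemma rotation_SU21:
  assumes "(cmod u)\<^sup>2 + (cmod v)\<^sup>2 = 1"
  shows "rotation u v \<in> carrier SU21"
proof -
  have *: "u * cnj u + v * cnj v = 1"
    using assms by (metis complex_norm_square of_real_1 of_real_add)
  have "herm (rotation u v *v x) (rotation u v *v y) = herm x y" for x y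
  proof -
    have "herm (rotation u v *v x) (rotation u v *v y) =
       (u * cnj u + v * cnj v) * (x$1 * cnj (y$1) + x$2 * cnj (y$2)) - x$3 * cnj (y$3)"
      by (simp add: herm_def rotation_def matrix_vector_mult_def sum_3) (simp add: algebra_simps)
    then show ?thesis by (simp add: * herm_def)
  qed
  moreover have "det (rotation u v) = 1"
    using * by (simp add: det_3 rotation_def mult.commute)
  ultimately show ?thesis by (simp add: SU21_iff)
qed

text \<open>A boost takes the origin to \<open>(r, 0)\<close> with \<open>r = norm z\<close>, and a
  rotation whose first column is the direction of \<open>z\<close> finishes. The parameters are part
  of the conclusion because the count of short vectors treats boost and rotation
  differently.\<close>

lemma CH2_transitive:
  assumes "z \<in> CH2"
  obtains c s u v where "c\<^sup>2 - s\<^sup>2 = 1" "c \<ge> 1" "s \<ge> 0" "c\<^sup>2 * (1 - (norm z)\<^sup>2) = 1"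
    "(cmod u)\<^sup>2 + (cmod v)\<^sup>2 = 1" "CH2_act (rotation u v ** boost c s) 0 = z"
proof -
  define r where "r = norm z"
  have r: "0 \<le> r" "r < 1"
    using assms by (auto simp: r_def CH2_def)
  then have r1: "0 < 1 - r\<^sup>2" "r\<^sup>2 < 1"
    by (simp_all add: abs_square_less_1)
  define c where "c = 1 / sqrt (1 - r\<^sup>2)"
  define s where "s = r * c"
  obtain u v where uv: "(cmod u)\<^sup>2 + (cmod v)\<^sup>2 = 1" "z$1 = of_real r * u" "z$2 = of_real r * v"
  proof (cases "r = 0")
    case True
    then have "z = 0" by (simp add: r_def)
    with True that[of 1 0] show ?thesis by simp
  next
    case False
    have "(cmod (z$1 / of_real r))\<^sup>2 + (cmod (z$2 / of_real r))\<^sup>2 = 1"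
    proof -
      have "(cmod (z$1 / of_real r))\<^sup>2 + (cmod (z$2 / of_real r))\<^sup>2 = ((cmod (z$1))\<^sup>2 + (cmod (z$2))\<^sup>2) / r\<^sup>2"
        using r by (simp add: norm_divide power_divide add_divide_distrib)
      also have "\<dots> = r\<^sup>2 / r\<^sup>2"
        unfolding norm_CH2[symmetric] r_def ..
      finally show ?thesis using False by simp
    qed
    with False that[of "z$1 / of_real r" "z$2 / of_real r"] show ?thesis by simp
  qed
  have c2: "c\<^sup>2 * (1 - r\<^sup>2) = 1"
    using r1 by (simp add: c_def power_divide)
  have c: "c \<ge> 1"
    using r1 by (simp add: c_def)
  show thesis
  proof (rule that[of c s u v])
    show "c\<^sup>2 - s\<^sup>2 = 1"
      using c2 by (simp add: s_def power_mult_distrib algebra_simps)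
    show "CH2_act (rotation u v ** boost c s) 0 = z"
      using c uv by (simp add: CH2_act_zero rotation_def boost_def matrix_matrix_mult_def sum_3
          vec_eq_iff forall_2 s_def)
  qed (use c c2 r uv in \<open>auto simp: s_def r_def\<close>)
qed

text \<open>Properness of the action. If \<open>B\<close> and \<open>E\<close>, with bounded
  entries, take the origin to \<open>z\<close> and to \<open>A z\<close>, then
  \<open>E^-1 A B\<close> fixes the origin and has entries at most 1; so \<open>A\<close> is a
  product of three bounded matrices.\<close>

lemma CH2_act_bounded:
  assumes "r < 1"
  obtains C where "\<And>A z i j. A \<in> carrier SU21 \<Longrightarrow> norm z \<le> r \<Longrightarrow> norm (CH2_act A z) \<le> r \<Longrightarrow> cmod (A$i$j) \<le> C"
proof (cases "r < 0")
  case True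
  then have "\<not> norm z \<le> r" for z :: "complex^2"
    by (meson not_less norm_ge_zero order.trans)
  then show ?thesis using that by blast
next
  case False
  define c where "c = 1 / sqrt (1 - r\<^sup>2)"
  define b where "b = 3 * 1 * c"
  have "0 \<le> r" using False by simp
  then have rr: "0 < 1 - r\<^sup>2" "1 - r\<^sup>2 \<le> 1" using assms by (simp_all add: abs_square_less_1)
  then have c1: "1 \<le> c" by (simp add: c_def)
  have base: "\<exists>B \<in> carrier SU21. CH2_act B 0 = z \<and> (\<forall>i j. cmod (B$i$j) \<le> b)" if z: "norm z \<le> r" for z
  proof -
    have "z \<in> CH2" using z assms by (simp add: CH2_def)
    then obtain c' s u v where *: "c'\<^sup>2 - s\<^sup>2 = 1" "c' \<ge> 1" "s \<ge> 0" "c'\<^sup>2 * (1 - (norm z)\<^sup>2) = 1"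
      "(cmod u)\<^sup>2 + (cmod v)\<^sup>2 = 1" "CH2_act (rotation u v ** boost c' s) 0 = z"
      by (rule CH2_transitive)
    have "c'\<^sup>2 * (1 - r\<^sup>2) \<le> c'\<^sup>2 * (1 - (norm z)\<^sup>2)"
      using z \<open>0 \<le> r\<close> by (intro mult_left_mono) (auto intro: power_mono)
    then have "c'\<^sup>2 \<le> 1 / (1 - r\<^sup>2)"
      using *(4) rr by (simp add: field_simps)
    then have "c'\<^sup>2 \<le> c\<^sup>2"
      using rr by (simp add: c_def power_divide)
    then have cc: "c' \<le> c"
      using c1 *(2) by (simp add: power2_le_iff_abs_le)
    have "s\<^sup>2 \<le> c'\<^sup>2" using *(1) by simp
    then have ss: "s \<le> c'" using *(2,3) by (simp add: power2_le_iff_abs_le)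
    have boost: "cmod (boost c' s $ i $ j) \<le> c" for i j
      using exhaust_3[of i] exhaust_3[of j] cc ss c1 *(2,3) by (auto simp: boost_def)
    have "(cmod u)\<^sup>2 \<le> 1" "(cmod v)\<^sup>2 \<le> 1"
      using *(5) zero_le_power2[of "cmod u"] zero_le_power2[of "cmod v"] by linarith+
    then have "cmod u \<le> 1" "cmod v \<le> 1"
      by (simp_all add: abs_square_le_1)
    then have "cmod (rotation u v $ i $ j) \<le> 1" for i j
      using exhaust_3[of i] exhaust_3[of j] by (auto simp: rotation_def)
    then have "cmod ((rotation u v ** boost c' s)$i$j) \<le> b" for i j
      unfolding b_def using boost by (intro matrix_mult_entry_bound) auto
    then show ?thesis
      using * boost_SU21 rotation_SU21 by (intro bexI[of _ "rotation u v ** boost c' s"]) auto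
  qed
  show thesis
  proof (rule that[of "3 * (3 * b * 1) * b"])
    fix A :: "complex^3^3" and z i j
    assume A: "A \<in> carrier SU21" and z: "norm z \<le> r" and w: "norm (CH2_act A z) \<le> r"
    obtain B where B: "B \<in> carrier SU21" "CH2_act B 0 = z" "\<And>i j. cmod (B$i$j) \<le> b"
      using base[OF z] by blast
    obtain E where E: "E \<in> carrier SU21" "CH2_act E 0 = CH2_act A z" "\<And>i j. cmod (E$i$j) \<le> b"
      using base[OF w] by blast
    define M where "M = inv\<^bsub>SU21\<^esub> E ** (A ** B)"
    have M: "M \<in> carrier SU21" using A B E by (simp add: M_def)
    have "CH2_act M 0 = CH2_act (inv\<^bsub>SU21\<^esub> E) (CH2_act A (CH2_act B 0))"
      using A B E by (simp add: M_def CH2_act_mult)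
    also have "\<dots> = 0"
      using E B by (metis CH2_act_inv(1) CH2_zero)
    finally have bM: "cmod (M$i$j) \<le> 1" for i j
      using SU21_fix_zero_bound[OF M] by blast
    have "A = E ** M ** inv\<^bsub>SU21\<^esub> B"
    proof -
      have "E ** M = A ** B"
        unfolding M_def using E by (simp add: matrix_mul_assoc)
      then show ?thesis using B by (simp flip: matrix_mul_assoc)
    qed
    moreover have "cmod ((E ** M ** inv\<^bsub>SU21\<^esub> B)$i$j) \<le> 3 * (3 * b * 1) * b"
      using bM B E SU21_inv_entry[OF B(1)] by (intro matrix_mult_entry_bound) auto
    ultimately show "cmod (A$i$j) \<le> 3 * (3 * b * 1) * b" by simp
  qed
qed

section \<open>Uniform lattices with a finite group of automorphisms\<close>

text \<open>A total order given by Borel conditions, used to choose one point from the finitely many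
  points of an orbit in a closed ball.\<close>

definition lex_le :: "complex^2 \<Rightarrow> complex^2 \<Rightarrow> bool" where
  "lex_le z w \<longleftrightarrow> Re (z$1) < Re (w$1) \<or> Re (z$1) = Re (w$1) \<and>
     (Im (z$1) < Im (w$1) \<or> Im (z$1) = Im (w$1) \<and>
     (Re (z$2) < Re (w$2) \<or> Re (z$2) = Re (w$2) \<and> Im (z$2) \<le> Im (w$2)))"

lemma lex_le_antisym: "lex_le z w \<Longrightarrow> lex_le w z \<Longrightarrow> z = w"
  by (auto simp: lex_le_def vec_eq_iff forall_2 complex_eq_iff)

lemma finite_lex_least:
  assumes "finite S" "S \<noteq> {}"
  shows "\<exists>z\<in>S. \<forall>w\<in>S. lex_le z w"
  using assms
proof (induction rule: finite_ne_induct)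
  case (singleton x)
  then show ?case by (simp add: lex_le_def)
next
  case (insert x F)
  then obtain z where z: "z \<in> F" "\<forall>w\<in>F. lex_le z w" by blast
  show ?case
  proof (cases "lex_le z x")
    case True
    with z show ?thesis by blast
  next
    case False
    then have "lex_le x w" if "lex_le z w" for w
      using that by (auto simp: lex_le_def)
    with z have "\<forall>w\<in>insert x F. lex_le x w" by (auto simp: lex_le_def[of x x])
    then show ?thesis by blast
  qed
qed

lemma CH2_dist_zero:
  assumes "z \<in> CH2"
  shows "CH2_dist 0 z = 2 * arcosh (1 / sqrt (1 - (norm z)\<^sup>2))"
proof -
  have r: "(norm z)\<^sup>2 < 1" using assms by (simp add: CH2_def abs_square_less_1)
  have "cmod (herm (CH2_lift z) (CH2_lift z)) = \<bar>(cmod (z$1))\<^sup>2 + (cmod (z$2))\<^sup>2 - 1\<bar>"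
    unfolding herm_self norm_of_real by (simp add: CH2_lift_def)
  then have "cmod (herm (CH2_lift z) (CH2_lift z)) = 1 - (norm z)\<^sup>2"
    using r norm_CH2[of z] by simp
  moreover have "cmod (herm (CH2_lift 0) (CH2_lift z)) = 1" "cmod (herm (CH2_lift 0) (CH2_lift 0)) = 1"
    by (simp_all add: herm_def CH2_lift_def)
  ultimately show ?thesis by (simp add: CH2_dist_def)
qed

lemma CH2_dist_zero_pos:
  assumes "z \<in> CH2" "z \<noteq> 0"
  shows "0 < CH2_dist 0 z"
proof -
  have "0 < (norm z)\<^sup>2" "(norm z)\<^sup>2 < 1"
    using assms by (auto simp: CH2_def abs_square_less_1)
  then have "1 < 1 / sqrt (1 - (norm z)\<^sup>2)" by simp
  then show ?thesis
    using arcosh_less_iff_real[of 1 "1 / sqrt (1 - (norm z)\<^sup>2)"] assms by (simp add: CH2_dist_zero)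
qed

text \<open>Translates smallness in the hyperbolic metric into Euclidean smallness;
  \<open>sqrt (3/4)\<close> is \<open>sqrt (1 - r^2)\<close> at \<open>r = 1/2\<close>.\<close>

lemma CH2_dist_zero_small: "\<exists>e>0. \<forall>z\<in>CH2. CH2_dist 0 z < e \<longrightarrow> norm z \<le> 1/2"
proof (intro exI conjI ballI impI)
  have *: "1 < 1 / sqrt (3/4 :: real)" by simp
  then show "0 < 2 * arcosh (1 / sqrt (3/4 :: real))"
    using arcosh_less_iff_real[of 1 "1 / sqrt (3/4)"] by simp
  fix z assume z: "z \<in> CH2" and d: "CH2_dist 0 z < 2 * arcosh (1 / sqrt (3/4))"
  have r: "(norm z)\<^sup>2 < 1" using z by (simp add: CH2_def abs_square_less_1)
  then have "1 / sqrt (1 - (norm z)\<^sup>2) < 1 / sqrt (3/4)"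
    using d * arcosh_less_iff_real[of "1 / sqrt (1 - (norm z)\<^sup>2)" "1 / sqrt (3/4)"]
    by (simp add: CH2_dist_zero z)
  then have "sqrt (3/4) < sqrt (1 - (norm z)\<^sup>2)"
    using r by (simp add: field_simps)
  then have "(norm z)\<^sup>2 < (1/2)\<^sup>2"
    unfolding real_sqrt_less_iff by (simp add: power2_eq_square)
  then show "norm z \<le> 1/2"
    by (meson less_imp_le norm_ge_zero power2_less_imp_less zero_le_divide_1_iff zero_le_numeral)
qed

lemma entry_le_norm: "cmod ((A::complex^3^3)$i$j) \<le> norm A"
  by (meson Finite_Cartesian_Product.norm_nth_le order_trans)

abbreviation (input) isolated_cyclic_action :: "nat \<Rightarrow> bool" where
  "isolated_cyclic_action p \<equiv> \<exists>X \<phi>. complex_hyperbolic_surface X \<and>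
     isometric_action (integer_mod_group p) X surface_dist \<phi> \<and>
     \<not> free_action (integer_mod_group p) X \<phi> \<and>
     only_isolated_fixed_points (integer_mod_group p) X surface_dist \<phi>"

text \<open>\<open>\<Gamma>\<close> plays the deck group and \<open>G\<close> a larger group
  normalizing it, which therefore acts on the quotient. Local finiteness is asked of
  \<open>G\<close>, because the finiteness arguments about fixed points run over elements outside
  \<open>\<Gamma>\<close>.\<close>

locale uniform_lattice =
  fixes G \<Gamma> :: "(complex^3^3) set"
  assumes G: "subgroup G SU21" and \<Gamma>: "subgroup \<Gamma> SU21" and \<Gamma>_sub_G: "\<Gamma> \<subseteq> G"
    and conj: "A \<in> G \<Longrightarrow> B \<in> \<Gamma> \<Longrightarrow> A ** B ** inv\<^bsub>SU21\<^esub> A \<in> \<Gamma>"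
    and locally_finite: "finite {A \<in> G. \<forall>i j. cmod (A$i$j) \<le> C}"
    and cocompact: "\<exists>r<1. \<forall>z\<in>CH2. \<exists>A\<in>\<Gamma>. norm (CH2_act A z) \<le> r"
    and tf: "torsion_free (SU21\<lparr>carrier := \<Gamma>\<rparr>)"
begin

lemma G_SU21 [simp]: "A \<in> G \<Longrightarrow> A \<in> carrier SU21"
  using G subgroup.subset by blast

lemma \<Gamma>_G [simp]: "A \<in> \<Gamma> \<Longrightarrow> A \<in> G"
  using \<Gamma>_sub_G by blast

lemma \<Gamma>_SU21 [simp]: "A \<in> \<Gamma> \<Longrightarrow> A \<in> carrier SU21"
  by simp

lemma G_closed [simp]:
  "mat 1 \<in> G" "A \<in> G \<Longrightarrow> B \<in> G \<Longrightarrow> A ** B \<in> G" "A \<in> G \<Longrightarrow> inv\<^bsub>SU21\<^esub> A \<in> G"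
  "A \<in> G \<Longrightarrow> A [^]\<^bsub>SU21\<^esub> (n::nat) \<in> G"
proof -
  show 1: "mat 1 \<in> G" and 2: "\<And>A B. A \<in> G \<Longrightarrow> B \<in> G \<Longrightarrow> A ** B \<in> G"
    using subgroup.one_closed[OF G] subgroup.m_closed[OF G] by simp_all
  show "A \<in> G \<Longrightarrow> inv\<^bsub>SU21\<^esub> A \<in> G" by (rule subgroup.m_inv_closed[OF G])
  show "A \<in> G \<Longrightarrow> A [^]\<^bsub>SU21\<^esub> (n::nat) \<in> G"
    by (induction n) (simp_all add: 1 2)
qed

lemma \<Gamma>_closed [simp]:
  "mat 1 \<in> \<Gamma>" "A \<in> \<Gamma> \<Longrightarrow> B \<in> \<Gamma> \<Longrightarrow> A ** B \<in> \<Gamma>" "A \<in> \<Gamma> \<Longrightarrow> inv\<^bsub>SU21\<^esub> A \<in> \<Gamma>"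
  using subgroup.one_closed[OF \<Gamma>] subgroup.m_closed[OF \<Gamma>] subgroup.m_inv_closed[OF \<Gamma>] by simp_all

lemma \<Gamma>_torsion_free:
  assumes "A \<in> \<Gamma>" "0 < n" "A [^]\<^bsub>SU21\<^esub> (n::nat) = mat 1"
  shows "A = mat 1"
proof -
  have "A [^]\<^bsub>SU21\<lparr>carrier := \<Gamma>\<rparr>\<^esub> n = A [^]\<^bsub>SU21\<^esub> n"
    by (simp add: nat_pow_def)
  then show ?thesis
    using tf[unfolded torsion_free_def, rule_format, of A n] assms by simp
qed

section \<open>Orbits of \<open>\<Gamma>\<close> and how \<open>G\<close> permutes them\<close>

definition orb :: "complex^2 \<Rightarrow> (complex^2) set" where
  "orb z = (\<lambda>A. CH2_act A z) ` \<Gamma>"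

lemma quotient_eq: "CH2_quotient \<Gamma> = orb ` CH2"
  by (auto simp: CH2_quotient_def orbits_def orbit_def orb_def)

lemma orb_self: "z \<in> CH2 \<Longrightarrow> z \<in> orb z"
  unfolding orb_def by (rule image_eqI[where x = "mat 1"]) auto

lemma orb_CH2: "z \<in> CH2 \<Longrightarrow> w \<in> orb z \<Longrightarrow> w \<in> CH2"
  by (auto simp: orb_def)

lemma orb_subset: "z \<in> CH2 \<Longrightarrow> w \<in> orb z \<Longrightarrow> orb w \<subseteq> orb z"
proof
  fix x assume z: "z \<in> CH2" and "w \<in> orb z" "x \<in> orb w"
  then obtain A B where "A \<in> \<Gamma>" "B \<in> \<Gamma>" "w = CH2_act A z" "x = CH2_act B w" by (auto simp: orb_def)
  with z show "x \<in> orb z"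
    unfolding orb_def by (intro image_eqI[where x = "B ** A"]) (auto simp: CH2_act_mult)
qed

lemma orb_sym: "z \<in> CH2 \<Longrightarrow> w \<in> orb z \<Longrightarrow> z \<in> orb w"
proof -
  assume z: "z \<in> CH2" and "w \<in> orb z"
  then obtain A where "A \<in> \<Gamma>" "w = CH2_act A z" by (auto simp: orb_def)
  with z show "z \<in> orb w"
    unfolding orb_def by (intro image_eqI[where x = "inv\<^bsub>SU21\<^esub> A"]) auto
qed

lemma orb_eq: "z \<in> CH2 \<Longrightarrow> w \<in> orb z \<Longrightarrow> orb w = orb z"
  by (meson orb_CH2 orb_subset orb_sym subset_antisym)

text \<open>Normality: \<open>A (B z) = (A B A^-1) (A z)\<close>. The reverse inclusion is the same
  statement for the inverse of \<open>A\<close>.\<close>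

lemma act_orb:
  assumes A: "A \<in> G" and z: "z \<in> CH2"
  shows "CH2_act A ` orb z = orb (CH2_act A z)"
proof -
  have sub: "CH2_act A ` orb z \<subseteq> orb (CH2_act A z)" if A: "A \<in> G" and z: "z \<in> CH2" for A z
  proof
    fix w assume "w \<in> CH2_act A ` orb z"
    then obtain B where B: "B \<in> \<Gamma>" "w = CH2_act A (CH2_act B z)" by (auto simp: orb_def)
    have "CH2_act (A ** B ** inv\<^bsub>SU21\<^esub> A) (CH2_act A z) = w"
      using A B z by (simp add: CH2_act_mult)
    then show "w \<in> orb (CH2_act A z)"
      unfolding orb_def using conj[OF A B(1)] by (intro image_eqI) auto
  qed
  have "orb (CH2_act A z) \<subseteq> CH2_act A ` orb z"
  proof
    fix w assume w: "w \<in> orb (CH2_act A z)"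
    then have wC: "w \<in> CH2" using A z orb_CH2[of "CH2_act A z" w] by simp
    have "CH2_act (inv\<^bsub>SU21\<^esub> A) ` orb (CH2_act A z) \<subseteq> orb z"
      using sub[of "inv\<^bsub>SU21\<^esub> A" "CH2_act A z"] A z by simp
    then have "CH2_act (inv\<^bsub>SU21\<^esub> A) w \<in> orb z" using w by blast
    then show "w \<in> CH2_act A ` orb z"
      using A wC by (intro image_eqI[where x = "CH2_act (inv\<^bsub>SU21\<^esub> A) w"]) auto
  qed
  with sub[OF A z] show ?thesis by blast
qed

lemma countable_G: "countable G"
proof -
  have "G \<subseteq> (\<Union>n::nat. {A \<in> G. \<forall>i j. cmod (A$i$j) \<le> real n})"
  proof
    fix A assume A: "A \<in> G"
    obtain n :: nat where n: "norm A \<le> real n" using real_arch_simple by blast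
    have "cmod (A$i$j) \<le> real n" for i j
      using entry_le_norm n order_trans by blast
    with A show "A \<in> (\<Union>n::nat. {A \<in> G. \<forall>i j. cmod (A$i$j) \<le> real n})" by blast
  qed
  moreover have "countable (\<Union>n::nat. {A \<in> G. \<forall>i j. cmod (A$i$j) \<le> real n})"
    using locally_finite by (intro countable_UN) (auto intro: countable_finite)
  ultimately show ?thesis using countable_subset by blast
qed

lemma discrete_\<Gamma>: "discrete \<Gamma>"
proof (rule discreteI)
  fix A assume A: "A \<in> \<Gamma>"
  have "ball A 1 \<inter> \<Gamma> \<subseteq> {B \<in> G. \<forall>i j. cmod (B$i$j) \<le> norm A + 1}"
  proof safe
    fix B i j assume "B \<in> ball A 1" "B \<in> \<Gamma>"
    then have "norm B \<le> norm A + 1"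
      by (smt (verit) dist_norm mem_ball norm_minus_commute norm_triangle_ineq2)
    then show "cmod (B$i$j) \<le> norm A + 1"
      using entry_le_norm order_trans by blast
  qed simp
  then have "finite (ball A 1 \<inter> \<Gamma>)"
    using locally_finite finite_subset by blast
  then have "\<not> A islimpt \<Gamma>"
    unfolding islimpt_eq_infinite_ball by (metis Int_commute zero_less_one)
  with A show "A isolated_in \<Gamma>" by (simp add: isolated_in_islimpt_iff)
qed

text \<open>The fundamental set takes from each orbit its \<open>lex_le\<close>-least point in the
  closed ball of radius \<open>r\<close>. Such points exist by cocompactness and are finitely many
  by properness. The set is the ball minus countably many Borel sets, and the volume density is
  bounded on the ball.\<close>

lemma covol: "finite_covolume \<Gamma>"
proof -
  obtain r where r: "r < 1" "\<And>z. z \<in> CH2 \<Longrightarrow> \<exists>A\<in>\<Gamma>. norm (CH2_act A z) \<le> r"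
    using cocompact by blast
  have "0 \<le> r"
    using r(2)[of 0] by (meson CH2_zero norm_ge_zero order_trans)
  then have r2: "r\<^sup>2 < 1" using r(1) by (simp add: abs_square_less_1)
  have inC: "norm z \<le> r \<Longrightarrow> z \<in> CH2" for z using r(1) by (simp add: CH2_def)
  \<comment> \<open>The action without its restriction to the ball: a quotient of affine functions,
    for which measurability on the whole space is immediate.\<close>
  define p where "p A z = CH2_proj (A *v CH2_lift z)" for A z
  have p: "p A z = CH2_act A z" if "z \<in> CH2" for A z using that by (simp add: p_def CH2_act_def)
  define bad where "bad A = {z \<in> space borel. (cmod (p A z $ 1))\<^sup>2 + (cmod (p A z $ 2))\<^sup>2 \<le> r\<^sup>2 \<and> \<not> lex_le z (p A z)}" for A
  have comp [measurable]: "(\<lambda>z::complex^2. z$i) \<in> borel_measurable borel" for i :: 2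
    by (intro borel_measurable_continuous_onI continuous_intros)
  have meas: "bad A \<in> sets borel" for A
  proof -
    have [measurable]: "(\<lambda>z. p A z $ i) \<in> borel_measurable borel" for i
      using exhaust_2[of i]
      by (elim disjE; simp add: p_def CH2_proj_def CH2_lift_def matrix_vector_mult_def sum_3)
    show ?thesis
      unfolding bad_def lex_le_def by measurable
  qed
  have bad: "z \<in> bad A \<longleftrightarrow> norm (CH2_act A z) \<le> r \<and> \<not> lex_le z (CH2_act A z)" if "z \<in> CH2" for A z
    using that \<open>0 \<le> r\<close> by (simp add: bad_def p norm_CH2[symmetric])
  define F where "F = cball 0 r - (\<Union>A\<in>\<Gamma>. bad A)"
  have "countable \<Gamma>" using countable_G \<Gamma>_sub_G countable_subset by blast
  then have "F \<in> sets borel"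
    unfolding F_def using meas by (intro sets.Diff sets.countable_UN') auto
  moreover have "F \<subseteq> CH2" using inC by (auto simp: F_def)
  moreover have "\<exists>!z. z \<in> P \<inter> F" if P: "P \<in> CH2_quotient \<Gamma>" for P
  proof -
    obtain x where x: "x \<in> CH2" "P = orb x" using P by (auto simp: quotient_eq)
    obtain B where B: "B \<in> \<Gamma>" "norm (CH2_act B x) \<le> r" using r(2)[OF x(1)] by blast
    define y where "y = CH2_act B x"
    have y: "y \<in> CH2" "P = orb y" "norm y \<le> r"
      using B x orb_eq[of x y] by (auto simp: y_def orb_def)
    obtain C where C: "\<And>A z i j. A \<in> carrier SU21 \<Longrightarrow> norm z \<le> r \<Longrightarrow> norm (CH2_act A z) \<le> r \<Longrightarrow> cmod (A$i$j) \<le> C"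
      using CH2_act_bounded[OF r(1)] by blast
    have "P \<inter> cball 0 r \<subseteq> (\<lambda>A. CH2_act A y) ` {A \<in> G. \<forall>i j. cmod (A$i$j) \<le> C}"
    proof
      fix w assume "w \<in> P \<inter> cball 0 r"
      then obtain A where "A \<in> \<Gamma>" "w = CH2_act A y" "norm (CH2_act A y) \<le> r"
        by (auto simp: y orb_def)
      with C[of A y] y show "w \<in> (\<lambda>A. CH2_act A y) ` {A \<in> G. \<forall>i j. cmod (A$i$j) \<le> C}"
        by auto
    qed
    then have "finite (P \<inter> cball 0 r)"
      using locally_finite finite_subset by blast
    moreover have "y \<in> P \<inter> cball 0 r" using y orb_self by auto
    ultimately obtain z where z: "z \<in> P \<inter> cball 0 r" "\<And>w. w \<in> P \<inter> cball 0 r \<Longrightarrow> lex_le z w"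
      using finite_lex_least[of "P \<inter> cball 0 r"] by blast
    have zC: "z \<in> CH2" using z inC by auto
    have *: "P = orb w" "w \<in> CH2" if "w \<in> P" for w
      using that orb_eq[of y w] orb_CH2[of y w] y by auto
    have "z \<in> F"
      using z zC *[of z] by (auto simp: F_def bad) (metis imageI orb_def)
    moreover have "w = z" if "w \<in> P \<inter> F" for w
    proof -
      have w: "w \<in> CH2" "norm w \<le> r" "P = orb w" using that * by (auto simp: F_def)
      then have "z \<in> orb w" using z by simp
      then obtain A where A: "A \<in> \<Gamma>" "z = CH2_act A w" by (auto simp: orb_def)
      then have "lex_le w z"
        using that w z by (auto simp: F_def bad)
      moreover have "lex_le z w" using z that by (auto simp: F_def)
      ultimately show ?thesis by (rule lex_le_antisym)
    qed
    ultimately show ?thesis using z by blast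
  qed
  moreover have "emeasure CH2_vol F < \<infinity>"
  proof -
    have F: "F \<in> sets lborel" using \<open>F \<in> sets borel\<close> by simp
    have [measurable]: "(\<lambda>z::complex^2. ennreal (16 / (1 - (norm z)\<^sup>2) ^ 3) * indicator CH2 z) \<in> borel_measurable lborel"
    proof (intro borel_measurable_times_ennreal borel_measurable_indicator)
      show "(\<lambda>z::complex^2. ennreal (16 / (1 - (norm z)\<^sup>2) ^ 3)) \<in> borel_measurable lborel"
        by measurable
    qed (simp add: CH2_def)
    have "emeasure CH2_vol F = (\<integral>\<^sup>+z. ennreal (16 / (1 - (norm z)\<^sup>2) ^ 3) * indicator CH2 z * indicator F z \<partial>lborel)"
      unfolding CH2_vol_def by (rule emeasure_density) (use F in auto)
    also have "\<dots> \<le> (\<integral>\<^sup>+z. ennreal (16 / (1 - r\<^sup>2) ^ 3) * indicator (cball 0 r) (z::complex^2) \<partial>lborel)"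
    proof (rule nn_integral_mono)
      fix z :: "complex^2"
      show "ennreal (16 / (1 - (norm z)\<^sup>2) ^ 3) * indicator CH2 z * indicator F z
        \<le> ennreal (16 / (1 - r\<^sup>2) ^ 3) * indicator (cball 0 r) z"
      proof (cases "z \<in> F")
        case True
        then have z: "norm z \<le> r" by (simp add: F_def)
        then have "1 - r\<^sup>2 \<le> 1 - (norm z)\<^sup>2" by (simp add: power_mono)
        then have "16 / (1 - (norm z)\<^sup>2) ^ 3 \<le> 16 / (1 - r\<^sup>2) ^ 3"
          using r2 by (intro divide_left_mono power_mono) auto
        with z True inC show ?thesis by (simp add: ennreal_leI)
      qed simp
    qed
    also have "\<dots> = ennreal (16 / (1 - r\<^sup>2) ^ 3) * emeasure lborel (cball 0 r :: (complex^2) set)"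
      by (rule nn_integral_cmult_indicator) simp
    also have "\<dots> < \<infinity>"
      using emeasure_lborel_cball_finite[of "0::complex^2" r] by (simp add: ennreal_mult_less_top less_top)
    finally show ?thesis .
  qed
  ultimately show ?thesis
    unfolding finite_covolume_def by (intro bexI[of _ F] conjI ballI) simp_all
qed

lemma surface: "complex_hyperbolic_surface (CH2_quotient \<Gamma>)"
  unfolding complex_hyperbolic_surface_def complex_hyperbolic_lattice_def
  using \<Gamma> discrete_\<Gamma> covol tf by blast

section \<open>Isometries of the quotient induced by \<open>G\<close>\<close>

definition induced :: "complex^3^3 \<Rightarrow> (complex^2) set \<Rightarrow> (complex^2) set" where
  "induced A = (\<lambda>P\<in>CH2_quotient \<Gamma>. CH2_act A ` P)"

lemma induced_orb: "A \<in> G \<Longrightarrow> z \<in> CH2 \<Longrightarrow> induced A (orb z) = orb (CH2_act A z)"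
  by (simp add: induced_def act_orb quotient_eq)

lemma induced_closed: "A \<in> G \<Longrightarrow> P \<in> CH2_quotient \<Gamma> \<Longrightarrow> induced A P \<in> CH2_quotient \<Gamma>"
  using quotient_eq induced_orb by auto

lemma induced_mult:
  assumes "A \<in> G" "B \<in> G"
  shows "induced (A ** B) = compose (CH2_quotient \<Gamma>) (induced A) (induced B)"
proof
  fix P show "induced (A ** B) P = compose (CH2_quotient \<Gamma>) (induced A) (induced B) P"
  proof (cases "P \<in> CH2_quotient \<Gamma>")
    case True
    then obtain z where "z \<in> CH2" "P = orb z" using True by (auto simp: quotient_eq)
    with True assms show ?thesis by (simp add: compose_def induced_orb CH2_act_mult)
  qed (simp add: compose_def, simp add: induced_def)
qed

lemma induced_one: "P \<in> CH2_quotient \<Gamma> \<Longrightarrow> induced (mat 1) P = P"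
  using quotient_eq induced_orb[of "mat 1"] by auto

lemma induced_Bij:
  assumes A: "A \<in> G"
  shows "induced A \<in> Bij (CH2_quotient \<Gamma>)"
proof -
  have *: "induced B (induced E P) = P" if "B \<in> G" "E \<in> G" "B ** E = mat 1" "P \<in> CH2_quotient \<Gamma>" for B E P
    using induced_mult[of B E] that induced_one by (metis compose_eq)
  have "bij_betw (induced A) (CH2_quotient \<Gamma>) (CH2_quotient \<Gamma>)"
    using A by (intro bij_betw_byWitness[where f' = "induced (inv\<^bsub>SU21\<^esub> A)"])
      (auto simp: * induced_closed)
  then show ?thesis by (simp add: Bij_def induced_def)
qed

lemma induced_dist:
  assumes A: "A \<in> G" and "P \<in> CH2_quotient \<Gamma>" "Q \<in> CH2_quotient \<Gamma>"
  shows "surface_dist (induced A P) (induced A Q) = surface_dist P Q"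
proof -
  have PQ: "P \<subseteq> CH2" "Q \<subseteq> CH2" using assms quotient_eq orb_CH2 by auto
  then have "{CH2_dist z w | z w. z \<in> CH2_act A ` P \<and> w \<in> CH2_act A ` Q} =
      {CH2_dist (CH2_act A z) (CH2_act A w) | z w. z \<in> P \<and> w \<in> Q}" by blast
  also have "\<dots> = {CH2_dist z w | z w. z \<in> P \<and> w \<in> Q}"
    using PQ A CH2_dist_act[of A] by (smt (verit, best) Collect_cong G_SU21 subset_iff)
  finally show ?thesis using assms by (simp add: surface_dist_def induced_def)
qed

text \<open>Powers of an element fixing a point form a bounded, hence finite, set.\<close>

lemma fixed_point_torsion:
  assumes h: "h \<in> G" and z: "z \<in> CH2" "CH2_act h z = z"
  obtains n :: nat where "0 < n" "h [^]\<^bsub>SU21\<^esub> n = mat 1"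
proof -
  obtain C where C: "\<And>A w i j. A \<in> carrier SU21 \<Longrightarrow> norm w \<le> norm z \<Longrightarrow> norm (CH2_act A w) \<le> norm z \<Longrightarrow> cmod (A$i$j) \<le> C"
    using CH2_act_bounded[of "norm z"] z(1) by (auto simp: CH2_def)
  have fixz: "CH2_act (h [^]\<^bsub>SU21\<^esub> n) z = z" for n :: nat
    by (induction n) (use h z in \<open>simp_all add: CH2_act_mult\<close>)
  have "range (\<lambda>n::nat. h [^]\<^bsub>SU21\<^esub> n) \<subseteq> {A \<in> G. \<forall>i j. cmod (A$i$j) \<le> C}"
    using h C[where w = z] fixz by auto
  then have "finite (range (\<lambda>n::nat. h [^]\<^bsub>SU21\<^esub> n))"
    using locally_finite finite_subset by blast
  then have "\<not> inj (\<lambda>n::nat. h [^]\<^bsub>SU21\<^esub> n)"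
    using range_inj_infinite by blast
  then obtain m n where "m < n" "h [^]\<^bsub>SU21\<^esub> m = h [^]\<^bsub>SU21\<^esub> (n::nat)"
    by (metis (mono_tags, lifting) injI linorder_neqE_nat)
  then have "h [^]\<^bsub>SU21\<^esub> (n - m) = mat 1"
    using h SU21.pow_eq_div2[of h n m] by simp
  with \<open>m < n\<close> show thesis using that[of "n - m"] by simp
qed

text \<open>Conjugation by \<open>B\<close> turns \<open>h\<close> into a matrix that fixes a point
  of the ball of radius \<open>r\<close> about the origin, so properness bounds it. With
  \<open>B\<close> moving the origin to a given point, this controls all elements with a fixed point
  near that point.\<close>

lemma finite_fixing:
  assumes B: "B \<in> carrier SU21" and "r < 1"
  shows "finite {h \<in> G. \<exists>w. norm w \<le> r \<and> CH2_act h (CH2_act B w) = CH2_act B w}"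
proof -
  obtain C where C: "\<And>A w i j. A \<in> carrier SU21 \<Longrightarrow> norm w \<le> r \<Longrightarrow> norm (CH2_act A w) \<le> r \<Longrightarrow> cmod (A$i$j) \<le> C"
    using CH2_act_bounded[OF \<open>r < 1\<close>] by blast
  obtain b where b: "\<And>i j. cmod (B$i$j) \<le> b"
    using entry_le_norm by blast
  have "{h \<in> G. \<exists>w. norm w \<le> r \<and> CH2_act h (CH2_act B w) = CH2_act B w}
      \<subseteq> {A \<in> G. \<forall>i j. cmod (A$i$j) \<le> 3 * (3 * b * C) * b}"
  proof safe
    fix h w i j assume h: "h \<in> G" and w: "norm w \<le> r" "CH2_act h (CH2_act B w) = CH2_act B w"
    define A where "A = inv\<^bsub>SU21\<^esub> B ** h ** B"
    have wC: "w \<in> CH2" using w \<open>r < 1\<close> by (simp add: CH2_def)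
    have A: "A \<in> carrier SU21" "CH2_act A w = w"
      using B h w wC by (simp_all add: A_def CH2_act_mult)
    have "h = B ** A ** inv\<^bsub>SU21\<^esub> B"
      using B unfolding A_def by (metis SU21_inv_mult(2) matrix_mul_assoc matrix_mul_lid matrix_mul_rid)
    moreover have "cmod ((B ** A ** inv\<^bsub>SU21\<^esub> B)$i$j) \<le> 3 * (3 * b * C) * b"
      using C[of A w] A w b SU21_inv_entry[OF B] by (intro matrix_mult_entry_bound) auto
    ultimately show "cmod (h$i$j) \<le> 3 * (3 * b * C) * b" by simp
  qed
  then show ?thesis using locally_finite finite_subset by blast
qed

text \<open>A fixed orbit of \<open>\<phi> k\<close> contains a point \<open>w\<close> fixed by some
  \<open>h\<close> in \<open>\<Gamma> g^k\<close>. Having a fixed point, \<open>h\<close> has finite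
  order; \<open>h^p\<close> lies in \<open>\<Gamma>\<close>, so it is 1 by torsion-freeness and
  \<open>iso\<close> applies. Only finitely many such \<open>h\<close> fix a point near a given
  \<open>z\<close>, each with finitely many fixed points, and a small ball about \<open>z\<close>
  avoids all of these except \<open>z\<close>.\<close>

theorem cyclic_action:
  assumes p: "prime p" and g: "g \<in> G" "g [^]\<^bsub>SU21\<^esub> p = mat 1" "CH2_act g 0 = 0"
    and iso: "\<And>k A. 0 < k \<Longrightarrow> k < p \<Longrightarrow> A \<in> \<Gamma> \<Longrightarrow> (A ** g [^]\<^bsub>SU21\<^esub> k) [^]\<^bsub>SU21\<^esub> p = mat 1 \<Longrightarrow>
        finite {z \<in> CH2. CH2_act (A ** g [^]\<^bsub>SU21\<^esub> (k::nat)) z = z}"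
  shows "isolated_cyclic_action p"
proof -
  let ?Z = "integer_mod_group p" and ?X = "CH2_quotient \<Gamma>"
  have p1: "1 < p" using p prime_gt_1_nat by blast
  then have Z: "carrier ?Z = {0..<int p}" by (simp add: carrier_integer_mod_group)
  define \<phi> where "\<phi> k = induced (g [^]\<^bsub>SU21\<^esub> nat k)" for k
  have hom: "\<phi> \<in> hom ?Z (BijGroup ?X)"
  proof (rule homI)
    fix k assume "k \<in> carrier ?Z"
    then show "\<phi> k \<in> carrier (BijGroup ?X)"
      using g by (simp add: \<phi>_def BijGroup_def induced_Bij)
  next
    fix k l assume kl: "k \<in> carrier ?Z" "l \<in> carrier ?Z"
    have red: "g [^]\<^bsub>SU21\<^esub> n = g [^]\<^bsub>SU21\<^esub> (n mod p)" for n :: nat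
    proof -
      have "g [^]\<^bsub>SU21\<^esub> (p * (n div p) + n mod p) = (g [^]\<^bsub>SU21\<^esub> p) [^]\<^bsub>SU21\<^esub> (n div p) ** g [^]\<^bsub>SU21\<^esub> (n mod p)"
        using g SU21.nat_pow_mult[of g "p * (n div p)" "n mod p"] SU21.nat_pow_pow[of g p "n div p"] by simp
      then show ?thesis using g SU21.nat_pow_one[of "n div p"] by simp
    qed
    have "nat ((k + l) mod int p) = (nat k + nat l) mod p"
      using kl by (simp add: Z nat_mod_distrib nat_add_distrib)
    then have "g [^]\<^bsub>SU21\<^esub> nat ((k + l) mod int p) = g [^]\<^bsub>SU21\<^esub> (nat k + nat l)"
      using red by simp
    also have "\<dots> = g [^]\<^bsub>SU21\<^esub> nat k ** g [^]\<^bsub>SU21\<^esub> nat l"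
      using g SU21.nat_pow_mult[of g "nat k" "nat l"] by simp
    finally show "\<phi> (k \<otimes>\<^bsub>?Z\<^esub> l) = \<phi> k \<otimes>\<^bsub>BijGroup ?X\<^esub> \<phi> l"
      using g by (simp add: \<phi>_def BijGroup_def induced_Bij induced_mult)
  qed
  then have "group_action ?Z ?X \<phi>"
    by (intro group_action.intro group_hom.intro group_hom_axioms.intro group_integer_mod_group group_BijGroup)
  then have isom: "isometric_action ?Z ?X surface_dist \<phi>"
    unfolding isometric_action_def using g induced_dist by (auto simp: \<phi>_def)
  have not_free: "\<not> free_action ?Z ?X \<phi>"
  proof -
    have "g [^]\<^bsub>SU21\<^esub> (1::nat) = g"
      using g by (simp add: One_nat_def)
    then have "orb 0 \<in> invariants ?X \<phi> 1"
      using g by (simp add: invariants_def \<phi>_def induced_orb quotient_eq)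
    moreover have "1 \<in> carrier ?Z" using p1 by simp
    moreover have "(1::int) \<noteq> \<one>\<^bsub>?Z\<^esub>" by simp
    ultimately show ?thesis unfolding free_action_def by blast
  qed
  have "only_isolated_fixed_points ?Z ?X surface_dist \<phi>"
    unfolding only_isolated_fixed_points_def
  proof (intro ballI impI)
    fix k P assume k: "k \<in> carrier ?Z" "k \<noteq> \<one>\<^bsub>?Z\<^esub>" and P: "P \<in> invariants ?X \<phi> k"
    define m where "m = nat k"
    have m: "0 < m" "m < p" using k by (auto simp: m_def Z)
    define H where "H = {A ** g [^]\<^bsub>SU21\<^esub> m | A. A \<in> \<Gamma>}"
    have HG: "h \<in> G" if "h \<in> H" for h using that g by (auto simp: H_def)
    have fix_finite: "finite {z \<in> CH2. CH2_act h z = z}" if hH: "h \<in> H" for h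
    proof (cases "\<exists>z\<in>CH2. CH2_act h z = z")
      case True
      obtain A where A: "A \<in> \<Gamma>" "h = A ** g [^]\<^bsub>SU21\<^esub> m" using hH by (auto simp: H_def)
      \<comment> \<open>Normality allows the factors from \<open>\<Gamma>\<close> to be collected on
        the left; for \<open>n = p\<close> the power of \<open>g\<close> disappears.\<close>
      have pow: "\<exists>B\<in>\<Gamma>. h [^]\<^bsub>SU21\<^esub> n = B ** g [^]\<^bsub>SU21\<^esub> (m * n)" for n :: nat
      proof (induction n)
        case 0
        show ?case by (rule bexI[of _ "mat 1"]) simp_all
      next
        case (Suc n)
        then obtain B where B: "B \<in> \<Gamma>" "h [^]\<^bsub>SU21\<^esub> n = B ** g [^]\<^bsub>SU21\<^esub> (m * n)" by blast
        let ?c = "g [^]\<^bsub>SU21\<^esub> (m * n)"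
        have c: "?c \<in> carrier SU21" "?c \<in> G" using g by simp_all
        have "h [^]\<^bsub>SU21\<^esub> Suc n = (B ** (?c ** A ** inv\<^bsub>SU21\<^esub> ?c)) ** (?c ** g [^]\<^bsub>SU21\<^esub> m)"
          using c B A by (simp add: matrix_mul_assoc) (simp flip: matrix_mul_assoc)
        also have "?c ** g [^]\<^bsub>SU21\<^esub> m = g [^]\<^bsub>SU21\<^esub> (m * Suc n)"
          using g SU21.nat_pow_mult[of g "m * n" m] by (simp add: add.commute)
        finally show ?case
          using conj[OF c(2) A(1)] B
          by (intro bexI[of _ "B ** (?c ** A ** inv\<^bsub>SU21\<^esub> ?c)"]) simp_all
      qed
      have "g [^]\<^bsub>SU21\<^esub> (m * p) = mat 1"
        using g SU21.nat_pow_pow[of g p m] SU21.nat_pow_one[of m] by (simp add: mult.commute)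
      then have hp: "h [^]\<^bsub>SU21\<^esub> p \<in> \<Gamma>" using pow[of p] by auto
      obtain z where "z \<in> CH2" "CH2_act h z = z" using True by blast
      then obtain n :: nat where n: "0 < n" "h [^]\<^bsub>SU21\<^esub> n = mat 1"
        using fixed_point_torsion HG[OF hH] by blast
      have "(h [^]\<^bsub>SU21\<^esub> p) [^]\<^bsub>SU21\<^esub> n = (h [^]\<^bsub>SU21\<^esub> n) [^]\<^bsub>SU21\<^esub> p"
        using HG[OF hH] SU21.nat_pow_pow[of h] by (simp add: mult.commute)
      also have "\<dots> = mat 1" using n SU21.nat_pow_one[of p] by simp
      finally have "h [^]\<^bsub>SU21\<^esub> p = mat 1"
        using \<Gamma>_torsion_free[OF hp n(1)] by blast
      then show ?thesis using iso[OF m A(1)] A(2) by simp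
    next
      case False
      then have "{z \<in> CH2. CH2_act h z = z} = {}" by blast
      then show ?thesis by (simp only: finite.emptyI)
    qed
    have PX: "P \<in> ?X" "\<phi> k P = P" using P by (auto simp: invariants_def)
    then obtain z where z: "z \<in> CH2" "P = orb z" by (auto simp: quotient_eq)
    obtain B where B: "B \<in> carrier SU21" "CH2_act B 0 = z"
      using CH2_transitive[OF z(1)] boost_SU21 rotation_SU21 by (metis SU21_mult_closed)
    obtain e0 where e0: "e0 > 0" "\<And>w. w \<in> CH2 \<Longrightarrow> CH2_dist 0 w < e0 \<Longrightarrow> norm w \<le> 1/2"
      using CH2_dist_zero_small by blast
    define S where "S = {h \<in> H. \<exists>w. norm w \<le> 1/2 \<and> CH2_act h (CH2_act B w) = CH2_act B w}"
    have "finite S"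
      by (rule finite_subset[OF _ finite_fixing[OF B(1), of "1/2"]]) (auto simp: S_def HG)
    \<comment> \<open>The finitely many points that could spoil isolation: all other fixed points of
      elements that fix some point near \<open>z\<close>.\<close>
    define W where "W = (\<Union>h\<in>S. {w \<in> CH2. CH2_act h w = w}) - {z}"
    have W: "finite W" "W \<subseteq> CH2"
      using \<open>finite S\<close> fix_finite by (auto simp: W_def S_def)
    have Bdist: "CH2_dist z (CH2_act B w) = CH2_dist 0 w" if "w \<in> CH2" for w
      using CH2_dist_act[OF B(1) CH2_zero that] B by simp
    have pos: "CH2_dist z w > 0" if "w \<in> CH2" "w \<noteq> z" for w
      using Bdist[of "CH2_act (inv\<^bsub>SU21\<^esub> B) w"] that B CH2_dist_zero_pos[of "CH2_act (inv\<^bsub>SU21\<^esub> B) w"]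
      by (metis CH2_act_closed CH2_act_inv(2) SU21.inv_closed)
    \<comment> \<open>Including \<open>e0\<close> keeps the minimum meaningful for empty
      \<open>W\<close> and guarantees that points closer than \<open>e\<close> are close enough to
      be governed by \<open>S\<close>.\<close>
    define e where "e = Min (insert e0 (CH2_dist z ` W))"
    have e: "e > 0" "e \<le> e0" "\<And>w. w \<in> W \<Longrightarrow> e \<le> CH2_dist z w"
    proof -
      have fin: "finite (insert e0 (CH2_dist z ` W))" using W by simp
      show "e > 0" unfolding e_def using fin e0 pos W by (subst Min_gr_iff) (auto simp: W_def)
      show "e \<le> e0" "\<And>w. w \<in> W \<Longrightarrow> e \<le> CH2_dist z w" unfolding e_def using fin by auto
    qed
    show "\<exists>e>0. \<forall>Q\<in>invariants ?X \<phi> k. surface_dist P Q < e \<longrightarrow> Q = P"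
    proof (intro exI conjI ballI impI)
      fix Q assume Q: "Q \<in> invariants ?X \<phi> k" and d: "surface_dist P Q < e"
      then obtain y where y: "y \<in> CH2" "Q = orb y" by (auto simp: invariants_def quotient_eq)
      have "{CH2_dist z w | z w. z \<in> P \<and> w \<in> Q} \<noteq> {}" using z y orb_self by blast
      then obtain z' w' where zw: "z' \<in> P" "w' \<in> Q" "CH2_dist z' w' < e"
        using d cInf_lessD[of "{CH2_dist z w | z w. z \<in> P \<and> w \<in> Q}" e] by (auto simp: surface_dist_def)
      have "z \<in> orb z'" "z' \<in> CH2" "w' \<in> CH2"
        using orb_sym[OF z(1)] orb_CH2[OF z(1)] orb_CH2[OF y(1)] zw z(2) y(2) by blast+
      \<comment> \<open>The pair realizing a distance below \<open>e\<close> need not start at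
        \<open>z\<close>; translating by \<open>A\<close> makes it do so without leaving the two
        orbits.\<close>
      then obtain A where A: "A \<in> \<Gamma>" "CH2_act A z' = z" by (auto simp: orb_def)
      define w where "w = CH2_act A w'"
      have w: "w \<in> CH2" "Q = orb w"
        using A \<open>w' \<in> CH2\<close> orb_eq[OF y(1), of w'] orb_eq[of w' w] zw y by (auto simp: w_def orb_def)
      have dw: "CH2_dist z w < e"
        using CH2_dist_act[of A z' w'] A zw \<open>z' \<in> CH2\<close> \<open>w' \<in> CH2\<close> by (simp add: w_def)
      have "orb (CH2_act (g [^]\<^bsub>SU21\<^esub> m) w) = orb w"
        using Q w g induced_orb[of "g [^]\<^bsub>SU21\<^esub> m" w] by (simp add: invariants_def \<phi>_def m_def)
      then have "w \<in> orb (CH2_act (g [^]\<^bsub>SU21\<^esub> m) w)" using orb_self w by simp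
      then obtain E where E: "E \<in> \<Gamma>" "w = CH2_act E (CH2_act (g [^]\<^bsub>SU21\<^esub> m) w)"
        by (auto simp: orb_def)
      define h where "h = E ** g [^]\<^bsub>SU21\<^esub> m"
      have h: "h \<in> H" "CH2_act h w = w"
        using E g w by (auto simp: h_def H_def CH2_act_mult)
      define v where "v = CH2_act (inv\<^bsub>SU21\<^esub> B) w"
      have v: "v \<in> CH2" "CH2_act B v = w" using B w by (auto simp: v_def)
      have "norm v \<le> 1/2"
        using e0(2)[OF v(1)] Bdist[OF v(1)] v dw e(2) by simp
      then have "h \<in> S" using h v by (auto simp: S_def)
      then have "w = z"
        using h w dw e(3)[of w] by (force simp: W_def)
      then show "Q = P" using w z by simp
    qed (use e in auto)
  qed
  with surface isom not_free show ?thesis by blast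
qed

end

section \<open>Arithmetic groups over an order in a CM field\<close>

lemma finite_vec_entries:
  assumes "finite S"
  shows "finite {v :: 'a^'n. \<forall>i. v$i \<in> S}"
proof (rule finite_subset)
  show "{v :: 'a^'n. \<forall>i. v$i \<in> S} \<subseteq> vec_lambda ` (UNIV \<rightarrow>\<^sub>E S)"
  proof
    fix v :: "'a^'n" assume "v \<in> {v. \<forall>i. v$i \<in> S}"
    then have "v = vec_lambda (\<lambda>i. v$i)" "(\<lambda>i. v$i) \<in> UNIV \<rightarrow>\<^sub>E S" by auto
    then show "v \<in> vec_lambda ` (UNIV \<rightarrow>\<^sub>E S)" by blast
  qed
  show "finite (vec_lambda ` ((UNIV :: 'n set) \<rightarrow>\<^sub>E S))"
    using assms by (intro finite_imageI finite_PiE) auto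
qed

lemma finite_matrix_entries:
  assumes "finite S"
  shows "finite {M :: 'a^'n^'m. \<forall>i j. M$i$j \<in> S}"
  using finite_vec_entries[OF finite_vec_entries[OF assms]] by simp

text \<open>The classical adjugate: it expresses inverses of matrices of determinant 1 polynomially,
  so integrality is preserved.\<close>

definition adj3 :: "complex^3^3 \<Rightarrow> complex^3^3" where
  "adj3 M = vector [
     vector [M$2$2*M$3$3 - M$2$3*M$3$2, M$1$3*M$3$2 - M$1$2*M$3$3, M$1$2*M$2$3 - M$1$3*M$2$2],
     vector [M$2$3*M$3$1 - M$2$1*M$3$3, M$1$1*M$3$3 - M$1$3*M$3$1, M$1$3*M$2$1 - M$1$1*M$2$3],
     vector [M$2$1*M$3$2 - M$2$2*M$3$1, M$1$2*M$3$1 - M$1$1*M$3$2, M$1$1*M$2$2 - M$1$2*M$2$1]]"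

lemma mult_adj3: "M ** adj3 M = (\<chi> i j. if i = j then det M else 0)"
  by (simp add: vec_eq_iff forall_3 adj3_def matrix_matrix_mult_def sum_3 det_3 algebra_simps)

lemma adj3_mult: "adj3 M ** M = (\<chi> i j. if i = j then det M else 0)"
  by (simp add: vec_eq_iff forall_3 adj3_def matrix_matrix_mult_def sum_3 det_3 algebra_simps)

lemma mult_adj3_det_1: "det M = 1 \<Longrightarrow> M ** adj3 M = mat 1" "det M = 1 \<Longrightarrow> adj3 M ** M = mat 1"
  by (simp_all add: mult_adj3 adj3_mult mat_def vec_eq_iff)

lemma matrix_scaleR_left: "(k *\<^sub>R A) ** B = k *\<^sub>R (A ** (B :: complex^'n^'m))"
  and matrix_scaleR_right: "A ** (k *\<^sub>R B) = k *\<^sub>R (A ** (B :: complex^'n^'m))"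
  by (simp_all add: vec_eq_iff matrix_matrix_mult_def scaleR_sum_right)

lemma matrix_add_rdistrib: "(A + B) ** C = A ** C + B ** (C :: complex^'n^'m)"
  by (simp add: vec_eq_iff matrix_matrix_mult_def distrib_right sum.distrib)

text \<open>
  \<open>R\<close> is an order in a CM field \<open>E\<close>, the \<open>\<sigma> k\<close> represent the complex places of \<open>E\<close>, and \<open>a\<close>
  is an element of the totally real subfield that is positive at the place \<open>\<sigma> 0 = id\<close> only.
\<close>

locale cm_order =
  fixes R :: "complex set" and n :: nat and \<sigma> :: "nat \<Rightarrow> complex \<Rightarrow> complex"
    and basis :: "nat \<Rightarrow> complex" and a :: real and a' :: "nat \<Rightarrow> real"
  assumes n2: "2 \<le> n"
    and R_one: "1 \<in> R" and R_add: "x \<in> R \<Longrightarrow> y \<in> R \<Longrightarrow> x + y \<in> R"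
    and R_mult: "x \<in> R \<Longrightarrow> y \<in> R \<Longrightarrow> x * y \<in> R"
    and R_minus: "x \<in> R \<Longrightarrow> - x \<in> R" and R_cnj: "x \<in> R \<Longrightarrow> cnj x \<in> R"
    and \<sigma>_add: "k < n \<Longrightarrow> x \<in> R \<Longrightarrow> y \<in> R \<Longrightarrow> \<sigma> k (x + y) = \<sigma> k x + \<sigma> k y"
    and \<sigma>_mult: "k < n \<Longrightarrow> x \<in> R \<Longrightarrow> y \<in> R \<Longrightarrow> \<sigma> k (x * y) = \<sigma> k x * \<sigma> k y"
    and \<sigma>_cnj: "k < n \<Longrightarrow> x \<in> R \<Longrightarrow> \<sigma> k (cnj x) = cnj (\<sigma> k x)"
    and \<sigma>_inj: "k < n \<Longrightarrow> x \<in> R \<Longrightarrow> \<sigma> k x = 0 \<Longrightarrow> x = 0"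
    and \<sigma>_0: "x \<in> R \<Longrightarrow> \<sigma> 0 x = x"
    and R_basis: "R = range (\<lambda>c :: nat \<Rightarrow> int. \<Sum>i<2*n. of_int (c i) * basis i)"
    and independent: "(\<Sum>i<2*n. of_int (c i) * basis i) = 0 \<Longrightarrow> i < 2*n \<Longrightarrow> c i = 0"
    and finite_bounded: "finite {x \<in> R. \<forall>k<n. cmod (\<sigma> k x) \<le> C}"
    and a_R: "complex_of_real a \<in> R" and a_pos: "0 < a"
    and \<sigma>_a: "k < n \<Longrightarrow> \<sigma> k (complex_of_real a) = complex_of_real (a' k)"
    and a'_neg: "0 < k \<Longrightarrow> k < n \<Longrightarrow> a' k < 0"
begin

lemma n0 [simp]: "0 < n" using n2 by simp

lemma \<sigma>_zero: "k < n \<Longrightarrow> \<sigma> k 0 = 0"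
proof -
  assume k: "k < n"
  have "0 \<in> R" using R_add[OF R_one R_minus[OF R_one]] by simp
  then show ?thesis using \<sigma>_add[OF k, of 0 0] by simp
qed

lemma R_zero [simp]: "0 \<in> R" using R_add[OF R_one R_minus[OF R_one]] by simp

lemma R_diff: "x \<in> R \<Longrightarrow> y \<in> R \<Longrightarrow> x - y \<in> R"
  using R_add[OF _ R_minus] by fastforce

lemmas R_intros [intro, simp] = R_one R_add R_mult R_minus R_cnj R_diff a_R

lemma R_of_nat [intro, simp]: "of_nat m \<in> R"
  by (induction m) auto

lemma R_of_int [intro, simp]: "of_int m \<in> R"
  by (cases m rule: int_diff_cases) auto

lemma R_numeral [intro, simp]: "numeral m \<in> R"
  using R_of_nat[of "numeral m"] by simp

lemma R_power [intro, simp]: "x \<in> R \<Longrightarrow> x ^ m \<in> R"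
  by (induction m) auto

lemma R_sum [intro]: "(\<And>i. i \<in> I \<Longrightarrow> f i \<in> R) \<Longrightarrow> sum f I \<in> R"
  by (induction I rule: infinite_finite_induct) auto

lemma \<sigma>_one: "k < n \<Longrightarrow> \<sigma> k 1 = 1"
  using \<sigma>_mult[of k 1 1] \<sigma>_inj[of k 1] by auto

lemma \<sigma>_minus: "k < n \<Longrightarrow> x \<in> R \<Longrightarrow> \<sigma> k (- x) = - \<sigma> k x"
  using \<sigma>_add[of k x "- x"] \<sigma>_zero by (simp add: eq_neg_iff_add_eq_0 add.commute)

lemma \<sigma>_diff: "k < n \<Longrightarrow> x \<in> R \<Longrightarrow> y \<in> R \<Longrightarrow> \<sigma> k (x - y) = \<sigma> k x - \<sigma> k y"
  using \<sigma>_add[of k x "- y"] \<sigma>_minus by simp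

lemma \<sigma>_of_nat: "k < n \<Longrightarrow> \<sigma> k (of_nat m) = of_nat m"
  by (induction m) (auto simp: \<sigma>_zero \<sigma>_one \<sigma>_add)

lemma \<sigma>_of_int: "k < n \<Longrightarrow> \<sigma> k (of_int m) = of_int m"
  by (cases m rule: int_diff_cases) (auto simp: \<sigma>_diff \<sigma>_of_nat)

lemma \<sigma>_sum: "k < n \<Longrightarrow> (\<And>i. i \<in> I \<Longrightarrow> f i \<in> R) \<Longrightarrow> \<sigma> k (sum f I) = (\<Sum>i\<in>I. \<sigma> k (f i))"
  by (induction I rule: infinite_finite_induct) (auto simp: \<sigma>_zero \<sigma>_add R_sum)

lemmas \<sigma>_simps = \<sigma>_add \<sigma>_mult \<sigma>_minus \<sigma>_diff \<sigma>_zero \<sigma>_one \<sigma>_cnj \<sigma>_a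

lemma basis_R: "i < 2*n \<Longrightarrow> basis i \<in> R"
proof -
  assume i: "i < 2*n"
  have "basis i = (\<Sum>j<2*n. of_int (if j = i then 1 else 0) * basis j)"
    using i by (simp add: if_distrib[of of_int] if_distribR sum.delta if_distrib[of "\<lambda>x. x * _"] cong: if_cong)
  then show ?thesis unfolding R_basis by (intro image_eqI) auto
qed

lemma a'_0: "a' 0 = a"
  using \<sigma>_a[of 0] \<sigma>_0[OF a_R] by simp

text \<open>The elements \<open>x / 2^j\<close> would be pairwise distinct with bounded conjugates.\<close>

lemma infinitely_divisible:
  assumes x: "x \<in> R" and div: "\<And>j::nat. \<exists>y\<in>R. x = 2 ^ j * y"
  shows "x = 0"
proof (rule ccontr)
  assume "x \<noteq> 0"
  define C where "C = Max ((\<lambda>k. cmod (\<sigma> k x)) ` {..<n})"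
  have C: "\<And>k. k < n \<Longrightarrow> cmod (\<sigma> k x) \<le> C"
    unfolding C_def by (rule Max_ge) auto
  have "range (\<lambda>j::nat. x / 2 ^ j) \<subseteq> {x \<in> R. \<forall>k<n. cmod (\<sigma> k x) \<le> C}"
  proof safe
    fix j :: nat
    obtain y where y: "y \<in> R" "x = 2 ^ j * y" using div by blast
    then show "x / 2 ^ j \<in> R" by simp
    fix k assume k: "k < n"
    have "\<sigma> k x = 2 ^ j * \<sigma> k y"
      using y k \<sigma>_of_int[OF k, of "2 ^ j"] \<sigma>_mult[OF k, of "2 ^ j" y] by simp
    then have "cmod (\<sigma> k x) = 2 ^ j * cmod (\<sigma> k y)"
      by (simp add: norm_mult norm_power)
    moreover have "1 * cmod (\<sigma> k y) \<le> 2 ^ j * cmod (\<sigma> k y)"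
      by (intro mult_right_mono) auto
    ultimately show "cmod (\<sigma> k (x / 2 ^ j)) \<le> C" using C[OF k] y by simp
  qed
  then have "finite (range (\<lambda>j::nat. x / 2 ^ j))"
    using finite_bounded finite_subset by blast
  moreover have "inj (\<lambda>j::nat. x / 2 ^ j)"
  proof (rule injI)
    fix i j :: nat assume "x / 2 ^ i = x / 2 ^ j"
    then have "(2::complex) ^ i = 2 ^ j" using \<open>x \<noteq> 0\<close> by (simp add: field_simps)
    then have "complex_of_nat (2 ^ i) = of_nat (2 ^ j)" by simp
    then show "i = j" unfolding of_nat_eq_iff by simp
  qed
  ultimately show False using range_inj_infinite by blast
qed

section \<open>Integral matrices, the group \<open>G\<close> and its congruence subgroup
  \<open>\<Gamma>\<close>\<close>

definition Rmat :: "complex^3^3 \<Rightarrow> bool" where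
  "Rmat M \<longleftrightarrow> (\<forall>i j. M$i$j \<in> R)"

lemma Rmat_closed [intro, simp]:
  "Rmat M \<Longrightarrow> Rmat N \<Longrightarrow> Rmat (M ** N)" "Rmat M \<Longrightarrow> Rmat N \<Longrightarrow> Rmat (M + N)"
  "Rmat M \<Longrightarrow> Rmat N \<Longrightarrow> Rmat (M - N)" "Rmat M \<Longrightarrow> Rmat (- M)" "Rmat (mat 1)"
  "Rmat M \<Longrightarrow> Rmat (adj3 M)" "Rmat M \<Longrightarrow> Rmat (real_of_int m *\<^sub>R M)" "Rmat 0"
proof -
  show "Rmat (real_of_int m *\<^sub>R M)" if "Rmat M"
  proof -
    have "(real_of_int m *\<^sub>R M)$i$j = of_int m * M$i$j" for i j
      unfolding vector_scaleR_component by (simp add: scaleR_conv_of_real)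
    then show ?thesis using that by (simp add: Rmat_def)
  qed
  show "Rmat (M ** N)" if "Rmat M" "Rmat N"
    using that by (auto simp: Rmat_def matrix_matrix_mult_def intro!: R_sum)
  show "Rmat (adj3 M)" if "Rmat M"
    using that by (auto simp: Rmat_def forall_3 adj3_def)
qed (auto simp: Rmat_def mat_def)

lemma Rmat_scale_nat [intro, simp]: "Rmat M \<Longrightarrow> Rmat (real m *\<^sub>R M)"
  using Rmat_closed(7)[of M "int m"] by simp

lemma Rmat_scale_numeral [intro, simp]: "Rmat M \<Longrightarrow> Rmat (numeral m *\<^sub>R M)"
  using Rmat_scale_nat[of M "numeral m"] by simp

lemma Rmat_det [intro, simp]: "Rmat M \<Longrightarrow> det M \<in> R"
  by (simp add: Rmat_def det_3)

definition d :: "3 \<Rightarrow> complex" where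
  "d i = (if i = 3 then complex_of_real (sqrt a) else 1)"

definition D :: "complex^3^3" where "D = (\<chi> i j. if i = j then d i else 0)"
definition D' :: "complex^3^3" where "D' = (\<chi> i j. if i = j then 1 / d i else 0)"

lemma d_nz [simp]: "d i \<noteq> 0"
  using a_pos by (simp add: d_def)

lemma DD' [simp]: "D ** D' = mat 1" "D' ** D = mat 1"
  using a_pos by (simp_all add: D_def D'_def vec_eq_iff forall_3 matrix_matrix_mult_def sum_3 mat_def)

text \<open>\<open>D\<close> carries the form with coefficients 1, 1, -a to \<open>herm\<close>, so
  \<open>cj A\<close> is \<open>A\<close> seen as an isometry of the former. Integrality is imposed
  on \<open>cj A\<close>, since \<open>sqrt a\<close> need not lie in \<open>R\<close>.\<close>

definition cj :: "complex^3^3 \<Rightarrow> complex^3^3" where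
  "cj A = D' ** A ** D"

lemma cj_entry: "(cj A)$i$j = A$i$j * d j / d i"
  using exhaust_3[of i] exhaust_3[of j]
  by (auto simp: cj_def D_def D'_def matrix_matrix_mult_def sum_3)

lemma cj_mult: "cj (A ** B) = cj A ** cj B"
proof -
  have "cj A ** cj B = D' ** A ** (D ** D') ** B ** D"
    by (simp only: cj_def matrix_mul_assoc)
  then show ?thesis by (simp add: cj_def matrix_mul_assoc)
qed

lemma cj_one [simp]: "cj (mat 1) = mat 1"
  by (simp add: cj_def)

lemma cj_inj: "cj A = cj B \<Longrightarrow> A = B"
  by (simp add: vec_eq_iff cj_entry)

lemma det_cj: "det (cj A) = det A"
proof -
  have "det D' * det D = 1" by (metis DD'(2) det_I det_mul)
  then show ?thesis by (simp add: cj_def det_mul mult.commute mult.left_commute)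
qed

definition G :: "(complex^3^3) set" where
  "G = {A \<in> carrier SU21. Rmat (cj A)}"

definition cong4 :: "complex^3^3 \<Rightarrow> bool" where
  "cong4 M \<longleftrightarrow> (\<exists>N. Rmat N \<and> M = mat 1 + 4 *\<^sub>R N)"

definition \<Gamma> :: "(complex^3^3) set" where
  "\<Gamma> = {A \<in> carrier SU21. cong4 (cj A)}"

lemma cong4_Rmat: "cong4 M \<Longrightarrow> Rmat M"
  by (auto simp: cong4_def)

lemma \<Gamma>_sub_G: "\<Gamma> \<subseteq> G"
  by (auto simp: \<Gamma>_def G_def cong4_Rmat)

lemma cj_inv: "A \<in> carrier SU21 \<Longrightarrow> cj (inv\<^bsub>SU21\<^esub> A) = adj3 (cj A)"
proof -
  assume A: "A \<in> carrier SU21"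
  have "det (cj A) = 1" using A by (simp add: det_cj SU21_iff)
  moreover have "cj A ** cj (inv\<^bsub>SU21\<^esub> A) = mat 1" using A by (simp flip: cj_mult)
  ultimately show ?thesis
    by (metis matrix_mul_assoc matrix_mul_lid matrix_mul_rid mult_adj3_det_1(2))
qed

lemma G_subgroup: "subgroup G SU21"
proof (rule SU21.subgroupI)
  show "G \<noteq> {}" using SU21.one_closed by (auto simp: G_def intro!: exI[of _ "mat 1"])
qed (auto simp: G_def cj_inv cj_mult)

lemma cong4_conj:
  assumes "cong4 N" "Rmat M" "Rmat M'" "M ** M' = mat 1"
  shows "cong4 (M ** N ** M')"
proof -
  obtain X where X: "Rmat X" "N = mat 1 + 4 *\<^sub>R X" using assms(1) by (auto simp: cong4_def)
  have "M ** N ** M' = mat 1 + 4 *\<^sub>R (M ** X ** M')"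
    by (simp add: X matrix_add_ldistrib matrix_add_rdistrib matrix_scaleR_left matrix_scaleR_right assms)
  then show ?thesis using X assms by (auto simp: cong4_def)
qed

lemma \<Gamma>_subgroup: "subgroup \<Gamma> SU21"
proof (rule SU21.subgroupI)
  show "\<Gamma> \<subseteq> carrier SU21" by (auto simp: \<Gamma>_def)
  have "mat 1 \<in> \<Gamma>" using SU21.one_closed by (auto simp: \<Gamma>_def cong4_def intro!: exI[of _ 0])
  then show "\<Gamma> \<noteq> {}" by blast
next
  fix A assume A: "A \<in> \<Gamma>"
  then have A': "A \<in> carrier SU21" "cong4 (cj A)" by (auto simp: \<Gamma>_def)
  obtain X where X: "Rmat X" "cj A = mat 1 + 4 *\<^sub>R X" using A' by (auto simp: cong4_def)
  let ?B = "adj3 (cj A)"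
  have "?B ** cj A = mat 1" using A' by (simp add: mult_adj3_det_1 det_cj SU21_iff)
  then have "?B = mat 1 + 4 *\<^sub>R (- (?B ** X))"
    by (subst (asm) X(2)) (simp add: matrix_add_ldistrib matrix_scaleR_right eq_diff_eq)
  moreover have "Rmat (- (?B ** X))" using X A' cong4_Rmat by auto
  ultimately have "cong4 ?B" unfolding cong4_def by blast
  then show "inv\<^bsub>SU21\<^esub> A \<in> \<Gamma>" using A' by (simp add: \<Gamma>_def cj_inv)
next
  fix A B assume "A \<in> \<Gamma>" "B \<in> \<Gamma>"
  then have AB: "A \<in> carrier SU21" "B \<in> carrier SU21" "cong4 (cj A)" "cong4 (cj B)" by (auto simp: \<Gamma>_def)
  then obtain X Y where XY: "Rmat X" "cj A = mat 1 + 4 *\<^sub>R X" "Rmat Y" "cj B = mat 1 + 4 *\<^sub>R Y"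
    by (auto simp: cong4_def)
  then have "cj A ** cj B = mat 1 + 4 *\<^sub>R (X + Y + 4 *\<^sub>R (X ** Y))"
    by (simp add: matrix_add_ldistrib matrix_add_rdistrib matrix_scaleR_left matrix_scaleR_right scaleR_add_right)
  then have "cong4 (cj (A ** B))"
    unfolding cong4_def cj_mult using XY by (intro exI[of _ "X + Y + 4 *\<^sub>R (X ** Y)"]) simp
  then show "A \<otimes>\<^bsub>SU21\<^esub> B \<in> \<Gamma>" using AB by (simp add: \<Gamma>_def)
qed

lemma \<Gamma>_normal:
  assumes "A \<in> G" "B \<in> \<Gamma>"
  shows "A ** B ** inv\<^bsub>SU21\<^esub> A \<in> \<Gamma>"
proof -
  have A: "A \<in> carrier SU21" "Rmat (cj A)" and B: "B \<in> carrier SU21" "cong4 (cj B)"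
    using assms by (auto simp: G_def \<Gamma>_def)
  have "cong4 (cj A ** cj B ** adj3 (cj A))"
    using A B by (intro cong4_conj) (auto simp: mult_adj3_det_1 det_cj SU21_iff)
  with A B show ?thesis by (simp add: \<Gamma>_def cj_mult cj_inv)
qed

text \<open>The binomial theorem to first order; of the remainder only the factor
  \<open>C ** C\<close> matters.\<close>

lemma power_expansion:
  assumes "Rmat C" "cj A = mat 1 + C"
  shows "\<exists>X. Rmat X \<and> cj (A [^]\<^bsub>SU21\<^esub> (m::nat)) = mat 1 + real m *\<^sub>R C + C ** C ** X"
proof (induction m)
  case 0
  show ?case by (intro exI[of _ 0]) (simp add: matrix_matrix_mult_def vec_eq_iff)
next
  case (Suc m)
  then obtain X where X: "Rmat X" "cj (A [^]\<^bsub>SU21\<^esub> m) = mat 1 + real m *\<^sub>R C + C ** C ** X" by blast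
  have "cj (A [^]\<^bsub>SU21\<^esub> Suc m) = (mat 1 + real m *\<^sub>R C + C ** C ** X) ** (mat 1 + C)"
    using X assms by (simp add: cj_mult)
  also have "\<dots> = mat 1 + real (Suc m) *\<^sub>R C + C ** C ** (X + X ** C + real m *\<^sub>R mat 1)"
    by (simp only: matrix_add_ldistrib matrix_add_rdistrib matrix_scaleR_left matrix_scaleR_right
        scaleR_add_left scaleR_one matrix_mul_assoc matrix_mul_lid matrix_mul_rid of_nat_Suc ac_simps)
  finally show ?case using X assms by (intro exI[of _ "X + X ** C + real m *\<^sub>R mat 1"]) auto
qed

text \<open>With \<open>cj A = 1 + C\<close>, the relation \<open>A^q = 1\<close> becomes
  \<open>q C = - C^2 X\<close>. If \<open>2^j\<close> divides \<open>C\<close>, the right side is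
  divisible by \<open>2^(2 j)\<close>, and removing \<open>q\<close> costs at most one factor 2. So
  for \<open>j \<ge> 2\<close> also \<open>2^(j+1)\<close> divides \<open>C\<close>, and
  \<open>C\<close> is infinitely divisible by 2, hence zero.\<close>

lemma \<Gamma>_no_prime_torsion:
  assumes A: "A \<in> \<Gamma>" and q: "prime q" and pow: "A [^]\<^bsub>SU21\<^esub> (q::nat) = mat 1"
  shows "A = mat 1"
proof -
  obtain N where N: "Rmat N" "cj A = mat 1 + 4 *\<^sub>R N" using A by (auto simp: \<Gamma>_def cong4_def)
  define C where "C = 4 *\<^sub>R N"
  have C: "Rmat C" "cj A = mat 1 + C" using N by (simp_all add: C_def)
  obtain X where X: "Rmat X" "mat 1 = mat 1 + real q *\<^sub>R C + C ** C ** X"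
    using power_expansion[OF C, of q] pow by auto
  then have eq: "real q *\<^sub>R C = - (C ** C ** X)" by (simp add: add_eq_0_iff2 add.assoc)
  have step: "\<exists>E. Rmat E \<and> C = 2 ^ Suc j *\<^sub>R E" if j: "2 \<le> j" and E: "Rmat E" "C = 2 ^ j *\<^sub>R E" for j :: nat and E
  proof -
    have "2 ^ j *\<^sub>R (real q *\<^sub>R E) = 2 ^ j *\<^sub>R (- (2 ^ j *\<^sub>R (E ** E ** X)))"
      using eq unfolding E by (simp add: matrix_scaleR_left matrix_scaleR_right mult.commute)
    then have qE: "real q *\<^sub>R E = - (2 ^ j *\<^sub>R (E ** E ** X))"
      unfolding scaleR_cancel_left by simp
    obtain i where i: "j = Suc (Suc i)" using j by (metis add_2_eq_Suc le_Suc_ex)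
    have "\<exists>F. Rmat F \<and> E = 2 *\<^sub>R F"
    \<comment> \<open>For \<open>q = 2\<close> one factor 2 is lost, which is affordable because
      \<open>j \<ge> 2\<close>; here the level 4 is used. For odd \<open>q = 2 h + 1\<close>,
      \<open>E\<close> has the same parity as \<open>q E\<close>, which is even.\<close>
    proof (cases "q = 2")
      case True
      then have "2 *\<^sub>R E = 2 *\<^sub>R (2 *\<^sub>R (- (real (2 ^ i) *\<^sub>R (E ** E ** X))))"
        using qE by (simp add: i)
      then have "E = 2 *\<^sub>R (- (real (2 ^ i) *\<^sub>R (E ** E ** X)))"
        unfolding scaleR_cancel_left by simp
      then show ?thesis
        using E X by (intro exI[of _ "- (real (2 ^ i) *\<^sub>R (E ** E ** X))"] conjI) (rule Rmat_closed Rmat_scale_nat | assumption)+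
    next
      case False
      then have "odd q" using q prime_odd_nat prime_ge_2_nat[OF q] by auto
      then obtain h where h: "q = 2 * h + 1" by (blast elim: oddE)
      have "E = real q *\<^sub>R E - 2 *\<^sub>R (real h *\<^sub>R E)" by (simp add: h algebra_simps)
      also have "\<dots> = 2 *\<^sub>R (- (real (2 ^ Suc i) *\<^sub>R (E ** E ** X)) - real h *\<^sub>R E)"
        by (simp add: qE i algebra_simps)
      finally show ?thesis
        using E X by (intro exI[of _ "- (real (2 ^ Suc i) *\<^sub>R (E ** E ** X)) - real h *\<^sub>R E"] conjI)
          (rule Rmat_closed Rmat_scale_nat | assumption)+
    qed
    then show ?thesis using E by (auto simp: mult.commute)
  qed
  have all: "\<exists>E. Rmat E \<and> C = 2 ^ (j + 2) *\<^sub>R E" for j :: nat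
  proof (induction j)
    case 0
    show ?case using N by (auto simp: C_def)
  next
    case (Suc j)
    then show ?case using step[of "j + 2"] by auto
  qed
  have "C$i$l = 0" for i l
  proof (rule infinitely_divisible)
    show "C$i$l \<in> R" using C by (simp add: Rmat_def)
    fix j :: nat
    obtain E where E: "Rmat E" "C = 2 ^ (j + 2) *\<^sub>R E" using all by blast
    have "C$i$l = 2 ^ j * (4 * E$i$l)"
      unfolding E(2) vector_scaleR_component by (simp add: scaleR_conv_of_real)
    moreover have "4 * E$i$l \<in> R" using E by (auto simp: Rmat_def)
    ultimately show "\<exists>y\<in>R. C$i$l = 2 ^ j * y" by blast
  qed
  then have "cj A = cj (mat 1)" using C by (simp add: vec_eq_iff)
  then show ?thesis by (rule cj_inj)
qed

text \<open>If \<open>m = q l\<close> with \<open>q\<close> prime, then \<open>A^l\<close> is killed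
  by \<open>q\<close>, so \<open>A^l = 1\<close> with a smaller exponent.\<close>

lemma \<Gamma>_torsion_free: "torsion_free (SU21\<lparr>carrier := \<Gamma>\<rparr>)"
proof -
  have pow_eq: "A [^]\<^bsub>SU21\<lparr>carrier := \<Gamma>\<rparr>\<^esub> m = A [^]\<^bsub>SU21\<^esub> m" for A and m :: nat
    by (simp add: nat_pow_def)
  have pow_\<Gamma>: "A [^]\<^bsub>SU21\<^esub> m \<in> \<Gamma>" if "A \<in> \<Gamma>" for A and m :: nat
    using that subgroup.one_closed[OF \<Gamma>_subgroup] subgroup.m_closed[OF \<Gamma>_subgroup]
    by (induction m) auto
  have "A = mat 1" if "A \<in> \<Gamma>" "0 < m" "A [^]\<^bsub>SU21\<^esub> m = mat 1" for A and m :: nat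
    using that
  proof (induction m arbitrary: A rule: less_induct)
    case (less m)
    have A: "A \<in> carrier SU21" using less.prems by (simp add: \<Gamma>_def)
    show ?case
    proof (cases "m = 1")
      case True
      then show ?thesis using less.prems A by simp
    next
      case False
      then obtain q l where q: "prime q" "m = q * l"
        using prime_factor_nat by (metis dvdE)
      then have l: "0 < l" "l < m" using less.prems prime_gt_1_nat[of q] by auto
      have "(A [^]\<^bsub>SU21\<^esub> l) [^]\<^bsub>SU21\<^esub> q = mat 1"
        using SU21.nat_pow_pow[OF A, of l q] q less.prems by (simp add: mult.commute)
      then have "A [^]\<^bsub>SU21\<^esub> l = mat 1"
        using \<Gamma>_no_prime_torsion q pow_\<Gamma> less.prems by blast
      then show ?thesis using less l by blast
    qed
  qed
  then show ?thesis
    unfolding torsion_free_def by (intro ballI allI impI) (use pow_eq in auto)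
qed

section \<open>The form at all places, and local finiteness of \<open>G\<close>\<close>

definition h' :: "nat \<Rightarrow> 3 \<Rightarrow> real" where
  "h' k i = (if i = 3 then - a' k else 1)"

lemma h'_pos: "0 < k \<Longrightarrow> k < n \<Longrightarrow> 0 < h' k i"
  using a'_neg by (simp add: h'_def)

lemma gram_eq:
  assumes "A \<in> carrier SU21"
  shows "(\<Sum>i\<in>UNIV. complex_of_real (h' 0 i) * (cj A)$i$j * cnj ((cj A)$i$j)) = complex_of_real (h' 0 j)"
proof -
  have "herm (A *v axis j 1) (A *v axis j 1) = herm (axis j 1) (axis j 1)"
    using assms by (simp add: SU21_iff)
  then have e: "A$1$j * cnj (A$1$j) + A$2$j * cnj (A$2$j) - A$3$j * cnj (A$3$j) = (if j = 3 then -1 else 1)"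
    unfolding herm_def matrix_vector_axis using exhaust_3[of j] by (auto simp: axis_def)
  have sq: "complex_of_real (sqrt a) * complex_of_real (sqrt a) = complex_of_real a"
    using a_pos by (simp flip: of_real_mult)
  have "(\<Sum>i\<in>UNIV. complex_of_real (h' 0 i) * (cj A)$i$j * cnj ((cj A)$i$j))
    = (A$1$j * cnj (A$1$j) + A$2$j * cnj (A$2$j) - A$3$j * cnj (A$3$j)) * (d j * d j)"
    using a_pos sq exhaust_3[of j]
    by (auto simp: sum_3 cj_entry h'_def a'_0 d_def field_simps)
  also have "\<dots> = complex_of_real (h' 0 j)"
    unfolding e using sq by (simp add: h'_def a'_0 d_def)
  finally show ?thesis .
qed

text \<open>Conjugating the column identity \<open>gram_eq\<close> by \<open>\<sigma> k\<close>
  gives a sum of nonnegative terms equal to \<open>h' k j\<close>, because \<open>\<sigma> k\<close>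
  commutes with complex conjugation and all weights are positive there. Each term is bounded by the
  sum.\<close>

lemma definite_places_bounded:
  assumes A: "A \<in> G" and k: "0 < k" "k < n"
  shows "h' k i * (cmod (\<sigma> k ((cj A)$i$j)))\<^sup>2 \<le> h' k j"
proof -
  let ?M = "cj A"
  have R: "?M$i$j \<in> R" for i j using A by (simp add: G_def Rmat_def)
  have "?M$1$j * cnj (?M$1$j) + ?M$2$j * cnj (?M$2$j) + (- of_real a) * ?M$3$j * cnj (?M$3$j)
     = (if j = 3 then - of_real a else 1)"
    using gram_eq[of A j] A by (simp add: G_def sum_3 h'_def a'_0 split: if_splits)
  then have "\<sigma> k (?M$1$j * cnj (?M$1$j) + ?M$2$j * cnj (?M$2$j) + (- of_real a) * ?M$3$j * cnj (?M$3$j))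
     = \<sigma> k (if j = 3 then - of_real a else 1)" by simp
  then have "(\<Sum>i\<in>UNIV. complex_of_real (h' k i) * (\<sigma> k (?M$i$j) * cnj (\<sigma> k (?M$i$j)))) = complex_of_real (h' k j)"
    using k R by (simp add: \<sigma>_simps sum_3 h'_def split: if_splits) (simp_all add: algebra_simps)
  then have "complex_of_real (\<Sum>i\<in>UNIV. h' k i * (cmod (\<sigma> k (?M$i$j)))\<^sup>2) = complex_of_real (h' k j)"
    by (simp only: of_real_sum of_real_mult complex_norm_square)
  then have "(\<Sum>i\<in>UNIV. h' k i * (cmod (\<sigma> k (?M$i$j)))\<^sup>2) = h' k j"
    unfolding of_real_eq_iff .
  moreover have "h' k i * (cmod (\<sigma> k (?M$i$j)))\<^sup>2 \<le> (\<Sum>i\<in>UNIV. h' k i * (cmod (\<sigma> k (?M$i$j)))\<^sup>2)"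
    using h'_pos[OF k] by (intro member_le_sum) (auto simp: less_imp_le)
  ultimately show ?thesis by simp
qed

text \<open>\<open>C1\<close> bounds the entries of \<open>cj A\<close> at the identity place,
  \<open>C2\<close> at the definite places; finitely many elements of \<open>R\<close> satisfy
  both.\<close>

lemma G_locally_finite: "finite {A \<in> G. \<forall>i j. cmod (A$i$j) \<le> C}"
proof -
  define C1 where "C1 = C * Max (range (\<lambda>(i, j). cmod (d j / d i)))"
  define C2 where "C2 = Max ((\<lambda>(k, i, j). sqrt (h' k j / h' k i)) ` ({..<n} \<times> UNIV \<times> UNIV))"
  have "cj ` {A \<in> G. \<forall>i j. cmod (A$i$j) \<le> C} \<subseteq>
      {M. \<forall>i j. M$i$j \<in> {x \<in> R. \<forall>k<n. cmod (\<sigma> k x) \<le> max C1 C2}}"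
  proof safe
    fix A i j assume A: "A \<in> G" and bound: "\<forall>i j. cmod (A$i$j) \<le> C"
    show R: "(cj A)$i$j \<in> R" using A by (simp add: G_def Rmat_def)
    fix k assume k: "k < n"
    show "cmod (\<sigma> k ((cj A)$i$j)) \<le> max C1 C2"
    proof (cases "k = 0")
      case True
      have "cmod (d j / d i) \<le> Max (range (\<lambda>(i, j). cmod (d j / d i)))"
        by (rule Max_ge) auto
      then have "cmod (A$i$j) * cmod (d j / d i) \<le> C1"
        unfolding C1_def using bound norm_ge_zero order_trans by (intro mult_mono) blast+
      then have "cmod ((cj A)$i$j) \<le> C1"
        by (simp add: cj_entry norm_mult norm_divide)
      then show ?thesis using True \<sigma>_0[OF R] by simp
    next
      case False
      then have k: "0 < k" "k < n" using k by auto
      have "(cmod (\<sigma> k ((cj A)$i$j)))\<^sup>2 \<le> h' k j / h' k i"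
        using definite_places_bounded[OF A k, of i j] h'_pos[OF k, of i] by (simp add: field_simps)
      then have "cmod (\<sigma> k ((cj A)$i$j)) \<le> sqrt (h' k j / h' k i)"
        by (rule real_le_rsqrt)
      also have "\<dots> \<le> C2"
        unfolding C2_def using k by (intro Max_ge image_eqI[where x = "(k, i, j)"]) auto
      finally show ?thesis by simp
    qed
  qed
  moreover have "finite {M :: complex^3^3. \<forall>i j. M$i$j \<in> {x \<in> R. \<forall>k<n. cmod (\<sigma> k x) \<le> max C1 C2}}"
    by (rule finite_matrix_entries[OF finite_bounded])
  ultimately have "finite (cj ` {A \<in> G. \<forall>i j. cmod (A$i$j) \<le> C})"
    using finite_subset by blast
  then show ?thesis by (rule finite_imageD) (auto intro!: inj_onI dest: cj_inj)
qed

end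

section \<open>Short vectors and cocompactness\<close>

text \<open>Pigeonhole over square cells of side \<open>\<rho> j\<close>. With
  \<open>m = \<lceil>B/\<rho>\<rceil>\<close> there are at most
  \<open>2 m + 1 \<le> 2 (B/\<rho> + 1) + 1 \<le> 5 B/\<rho>\<close> cells in each real direction,
  as \<open>\<rho> \<le> B\<close>. Within a cell real and imaginary parts each differ by at most
  \<open>\<rho>\<close>, whence \<open>2 * \<rho> j\<close>.\<close>

lemma complex_cells:
  fixes F :: "'j \<Rightarrow> 'a \<Rightarrow> complex"
  assumes A: "finite A" and J: "finite J"
    and bound: "\<And>j x. j \<in> J \<Longrightarrow> x \<in> A \<Longrightarrow> cmod (F j x) \<le> B j"
    and \<rho>: "\<And>j. j \<in> J \<Longrightarrow> 0 < \<rho> j" "\<And>j. j \<in> J \<Longrightarrow> \<rho> j \<le> B j"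
  obtains P where "P \<subseteq> A" "real (card A) \<le> real (card P) * (\<Prod>j\<in>J. (5 * B j / \<rho> j)\<^sup>2)"
    "\<And>x y j. x \<in> P \<Longrightarrow> y \<in> P \<Longrightarrow> j \<in> J \<Longrightarrow> cmod (F j x - F j y) \<le> 2 * \<rho> j"
proof -
  define cell where "cell x = (\<lambda>j\<in>J. (\<lfloor>Re (F j x) / \<rho> j\<rfloor>, \<lfloor>Im (F j x) / \<rho> j\<rfloor>))" for x
  define m where "m j = \<lceil>B j / \<rho> j\<rceil>" for j
  define T where "T = (\<Pi>\<^sub>E j\<in>J. {- m j..m j} \<times> {- m j..m j})"
  have m1: "1 \<le> B j / \<rho> j" if "j \<in> J" for j
    using \<rho>[OF that] by simp
  have m0: "0 \<le> m j" if "j \<in> J" for j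
    using m1[OF that] unfolding m_def by linarith
  have range: "\<lfloor>t / \<rho> j\<rfloor> \<in> {- m j..m j}" if j: "j \<in> J" and t: "\<bar>t\<bar> \<le> B j" for t j
  proof -
    have "- (B j / \<rho> j) \<le> t / \<rho> j" "t / \<rho> j \<le> B j / \<rho> j"
      using \<rho>(1)[OF j] t by (simp_all add: field_simps abs_le_iff)
    then show ?thesis unfolding m_def by (simp add: le_floor_iff floor_le_iff) linarith
  qed
  have "cell \<in> A \<rightarrow> T"
  proof
    fix x assume x: "x \<in> A"
    have "\<bar>Re (F j x)\<bar> \<le> B j" "\<bar>Im (F j x)\<bar> \<le> B j" if "j \<in> J" for j
      using bound[OF that x] abs_Re_le_cmod abs_Im_le_cmod order_trans by blast+
    then show "cell x \<in> T" unfolding cell_def T_def using range by auto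
  qed
  moreover have "finite T" unfolding T_def using J by (intro finite_PiE) auto
  moreover have "T \<noteq> {}" unfolding T_def using m0 by (force simp: PiE_eq_empty_iff)
  ultimately obtain y where y: "card (cell -` {y} \<inter> A) * card T \<ge> card A"
    using pigeonhole_card[of cell A T] A by blast
  have "real (card T) \<le> (\<Prod>j\<in>J. (5 * B j / \<rho> j)\<^sup>2)"
  proof -
    have "real (card T) = (\<Prod>j\<in>J. (real_of_int (2 * m j + 1))\<^sup>2)"
      unfolding T_def card_PiE[OF J] of_nat_prod
      using m0 by (intro prod.cong) (auto simp: card_cartesian_product power2_eq_square)
    also have "\<dots> \<le> (\<Prod>j\<in>J. (5 * B j / \<rho> j)\<^sup>2)"
    proof (intro prod_mono conjI power_mono)
      fix j assume j: "j \<in> J"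
      show "real_of_int (2 * m j + 1) \<le> 5 * B j / \<rho> j"
        using m1[OF j] unfolding m_def by simp linarith
    qed (use m0 in auto)
    finally show ?thesis .
  qed
  then have "real (card (cell -` {y} \<inter> A)) * real (card T)
      \<le> real (card (cell -` {y} \<inter> A)) * (\<Prod>j\<in>J. (5 * B j / \<rho> j)\<^sup>2)"
    by (intro mult_left_mono) auto
  moreover have "real (card A) \<le> real (card (cell -` {y} \<inter> A)) * real (card T)"
    using y by (metis of_nat_le_iff of_nat_mult)
  moreover have "cmod (F j x - F j x') \<le> 2 * \<rho> j"
    if "x \<in> cell -` {y} \<inter> A" "x' \<in> cell -` {y} \<inter> A" and j: "j \<in> J" for x x' j
  proof -
    have "cell x j = cell x' j" using that by simp
    then have eq: "\<lfloor>Re (F j x) / \<rho> j\<rfloor> = \<lfloor>Re (F j x') / \<rho> j\<rfloor>" "\<lfloor>Im (F j x) / \<rho> j\<rfloor> = \<lfloor>Im (F j x') / \<rho> j\<rfloor>"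
      using j by (simp_all add: cell_def)
    have *: "\<bar>s - t\<bar> \<le> \<rho> j" if "\<lfloor>s / \<rho> j\<rfloor> = \<lfloor>t / \<rho> j\<rfloor>" for s t
    proof -
      have "\<bar>s / \<rho> j - t / \<rho> j\<bar> \<le> 1" using that by linarith
      then show ?thesis using \<rho>(1)[OF j] by (simp add: abs_le_iff field_simps)
    qed
    show ?thesis
      using cmod_le[of "F j x - F j x'"] *[OF eq(1)] *[OF eq(2)] by simp
  qed
  ultimately show thesis using that[of "cell -` {y} \<inter> A"] by auto
qed

text \<open>Bilinear rather than hermitian, so that \<open>dot (cross x y) z\<close> is a
  determinant and commutes with every \<open>\<sigma> k\<close>.\<close>

definition dot :: "complex^3 \<Rightarrow> complex^3 \<Rightarrow> complex" where
  "dot x y = x$1 * y$1 + x$2 * y$2 + x$3 * y$3"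

definition cross :: "complex^3 \<Rightarrow> complex^3 \<Rightarrow> complex^3" where
  "cross x y = vector [x$2*y$3 - x$3*y$2, x$3*y$1 - x$1*y$3, x$1*y$2 - x$2*y$1]"

definition cols :: "complex^3 \<Rightarrow> complex^3 \<Rightarrow> complex^3 \<Rightarrow> complex^3^3" where
  "cols x y z = (\<chi> i j. if j = 1 then x$i else if j = 2 then y$i else z$i)"

lemma det_cols: "det (cols x y z) = dot (cross x y) z"
  by (simp add: det_3 cols_def dot_def cross_def algebra_simps)

lemma dot_cross_swap: "dot (cross x e) w = - dot (cross x w) e"
  by (simp add: dot_def cross_def algebra_simps)

lemma dot_diff: "dot a (x - y) = dot a x - dot a y"
  by (simp add: dot_def algebra_simps)

lemma dot_axis: "dot a (axis i 1) = a$i"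
  using exhaust_3[of i] by (auto simp: dot_def axis_def)

text \<open>In the coordinates \<open>T x\<close> the plane is the kernel of a functional
  \<open>b\<close>; solving for a coordinate where \<open>b\<close> is largest bounds it by the
  other two. This is what lowers the exponent in the count of lattice vectors in a plane.\<close>

lemma plane_dominated_coordinate:
  fixes S T :: "complex^3^3"
  assumes ST: "S ** T = mat 1" and a: "a \<noteq> 0"
  shows "\<exists>i. \<forall>x. dot a x = 0 \<longrightarrow> cmod ((T *v x)$i) \<le> (\<Sum>j\<in>UNIV-{i}. cmod ((T *v x)$j))"
proof -
  define b where "b = transpose S *v a"
  have dot_b: "(\<Sum>j\<in>UNIV. b$j * (T *v x)$j) = dot a x" for x
  proof -
    have "(\<Sum>j\<in>UNIV. b$j * y$j) = dot a (S *v y)" for y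
      by (simp add: b_def dot_def transpose_def matrix_vector_mult_def sum_3 algebra_simps)
    then show ?thesis by (simp add: matrix_vector_mul_assoc ST)
  qed
  have "b \<noteq> 0"
  proof
    assume "b = 0"
    then have "a$i = 0" for i using dot_b[of "axis i 1"] by (simp add: dot_axis)
    with a show False by (simp add: vec_eq_iff)
  qed
  obtain i where i: "\<And>j. cmod (b$j) \<le> cmod (b$i)"
  proof -
    have "Max (range (\<lambda>j. cmod (b$j))) \<in> range (\<lambda>j. cmod (b$j))" by (rule Max_in) auto
    then obtain i where "Max (range (\<lambda>j. cmod (b$j))) = cmod (b$i)" by (rule rangeE)
    moreover have "cmod (b$j) \<le> Max (range (\<lambda>j. cmod (b$j)))" for j by (rule Max_ge) auto
    ultimately show thesis using that[of i] by simp
  qed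
  have bi: "0 < cmod (b$i)"
  proof (rule ccontr)
    assume "\<not> 0 < cmod (b$i)"
    then have "b$j = 0" for j using i[of j] by simp
    with \<open>b \<noteq> 0\<close> show False by (simp add: vec_eq_iff)
  qed
  show ?thesis
  proof (intro exI allI impI)
    fix x assume "dot a x = 0"
    then have "b$i * (T *v x)$i + (\<Sum>j\<in>UNIV-{i}. b$j * (T *v x)$j) = 0"
      using dot_b[of x] by (simp add: sum.remove[of UNIV i])
    then have "b$i * (T *v x)$i = - (\<Sum>j\<in>UNIV-{i}. b$j * (T *v x)$j)"
      by (simp add: eq_neg_iff_add_eq_0)
    then have "cmod (b$i) * cmod ((T *v x)$i) = cmod (\<Sum>j\<in>UNIV-{i}. b$j * (T *v x)$j)"
      by (metis norm_minus_cancel norm_mult)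
    also have "\<dots> \<le> (\<Sum>j\<in>UNIV-{i}. cmod (b$i) * cmod ((T *v x)$j))"
      by (rule sum_norm_le) (auto simp: norm_mult intro!: mult_right_mono i)
    also have "\<dots> = cmod (b$i) * (\<Sum>j\<in>UNIV-{i}. cmod ((T *v x)$j))"
      by (simp add: sum_distrib_left)
    finally show "cmod ((T *v x)$i) \<le> (\<Sum>j\<in>UNIV-{i}. cmod ((T *v x)$j))"
      using bi by simp
  qed
qed

lemma card_vec_entries: "card {v :: 'a^'n. \<forall>i. v$i \<in> S} = card S ^ CARD('n)"
proof -
  have "{v :: 'a^'n. \<forall>i. v$i \<in> S} = vec_lambda ` (UNIV \<rightarrow>\<^sub>E S)"
  proof (intro equalityI subsetI)
    fix v :: "'a^'n" assume "v \<in> {v. \<forall>i. v$i \<in> S}"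
    then have "v = vec_lambda (\<lambda>i. v$i)" "(\<lambda>i. v$i) \<in> UNIV \<rightarrow>\<^sub>E S" by auto
    then show "v \<in> vec_lambda ` (UNIV \<rightarrow>\<^sub>E S)" by blast
  qed auto
  moreover have "inj_on vec_lambda ((UNIV :: 'n set) \<rightarrow>\<^sub>E S)"
    by (auto intro!: inj_onI simp: vec_lambda_inject)
  ultimately show ?thesis
    by (simp add: card_image card_PiE)
qed

lemma boost_inv:
  assumes "c\<^sup>2 - s\<^sup>2 = 1"
  shows "inv\<^bsub>SU21\<^esub> (boost c s) = boost c (- s)"
proof -
  have "complex_of_real c * complex_of_real c - of_real s * of_real s = 1"
    using assms by (metis of_real_1 of_real_diff of_real_mult power2_eq_square)
  then have "boost c (- s) ** boost c s = mat 1"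
    by (simp add: vec_eq_iff forall_3 boost_def matrix_matrix_mult_def sum_3 mat_def algebra_simps)
  then show ?thesis
    using boost_SU21[of c s] boost_SU21[of c "- s"] assms
    by (metis SU21_simps SU21.inv_equality power2_minus)
qed

section \<open>Integral vectors, their conjugates, and the anisotropic form\<close>

context cm_order
begin

definition Rvec :: "complex^3 \<Rightarrow> bool" where
  "Rvec v \<longleftrightarrow> (\<forall>i. v$i \<in> R)"

definition sv :: "nat \<Rightarrow> complex^3 \<Rightarrow> complex^3" where
  "sv k v = (\<chi> i. \<sigma> k (v$i))"

lemma Rvec_diff [simp]: "Rvec x \<Longrightarrow> Rvec y \<Longrightarrow> Rvec (x - y)"
  by (simp add: Rvec_def)

lemma sv_diff: "k < n \<Longrightarrow> Rvec x \<Longrightarrow> Rvec y \<Longrightarrow> sv k (x - y) = sv k x - sv k y"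
  by (simp add: Rvec_def sv_def vec_eq_iff \<sigma>_diff)

lemma sv_inj: "k < n \<Longrightarrow> Rvec x \<Longrightarrow> sv k x = 0 \<Longrightarrow> x = 0"
  by (auto simp: Rvec_def sv_def vec_eq_iff dest: \<sigma>_inj)

lemma dot_sv: "k < n \<Longrightarrow> Rvec x \<Longrightarrow> Rvec y \<Longrightarrow> dot (sv k x) (sv k y) = \<sigma> k (dot x y)"
  by (simp add: Rvec_def sv_def dot_def \<sigma>_simps)

text \<open>A cross product of integral vectors is an integral normal. According to the rank of
  \<open>X\<close> it is formed from two elements, from one element and a coordinate vector, or any
  nonzero vector serves.\<close>

lemma coplanar_normal:
  assumes X: "\<And>x. x \<in> X \<Longrightarrow> Rvec x"
    and det: "\<And>x y z. x \<in> X \<Longrightarrow> y \<in> X \<Longrightarrow> z \<in> X \<Longrightarrow> det (cols x y z) = 0"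
  obtains w where "Rvec w" "w \<noteq> 0" "\<And>x. x \<in> X \<Longrightarrow> dot w x = 0"
proof -
  have Rcross: "Rvec (cross x y)" if "Rvec x" "Rvec y" for x y
    using that by (simp add: Rvec_def forall_3 cross_def)
  have Raxis: "Rvec (axis i 1)" for i
    by (simp add: Rvec_def axis_def)
  consider x y where "x \<in> X" "y \<in> X" "cross x y \<noteq> 0"
    | x where "x \<in> X" "x \<noteq> 0" "\<And>y. y \<in> X \<Longrightarrow> cross x y = 0"
    | "X \<subseteq> {0}" by blast
  then show thesis
  proof cases
    case 1
    then show ?thesis using that[of "cross x y"] Rcross X det det_cols by metis
  next
    case 2
    have "\<exists>i. cross x (axis i 1) \<noteq> 0"
    proof (rule ccontr)
      assume "\<not> (\<exists>i. cross x (axis i 1) \<noteq> 0)"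
      then have "cross x (axis 1 1) = 0" "cross x (axis 2 1) = 0" by blast+
      then have "x = 0" by (simp add: cross_def axis_def vec_eq_iff forall_3)
      with 2 show False by blast
    qed
    then obtain i where "cross x (axis i 1) \<noteq> 0" by blast
    moreover have "dot (cross x (axis i 1)) w = 0" if "w \<in> X" for w
      using 2(3)[OF that] dot_cross_swap[of x "axis i 1" w] by (simp add: dot_def)
    ultimately show ?thesis using that Rcross Raxis X 2(1) by metis
  next
    case 3
    then show ?thesis using that[of "axis 1 1"] Raxis by (force simp: dot_def axis_eq_0_iff)
  qed
qed

text \<open>Take all combinations of the basis with coefficients in \<open>{0..<N}\<close>;
  \<open>\<kappa>\<close> absorbs the sizes of the conjugates of the basis.\<close>

lemma many_elements:
  obtains \<kappa> :: real where "1 \<le> \<kappa>"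
    "\<And>N::nat. \<exists>S\<subseteq>R. finite S \<and> card S = N ^ (2*n) \<and> (\<forall>x\<in>S. \<forall>k<n. cmod (\<sigma> k x) \<le> \<kappa> * N)"
proof -
  define \<kappa> where "\<kappa> = 1 + (\<Sum>k<n. \<Sum>i<2*n. cmod (\<sigma> k (basis i)))"
  have \<kappa>1: "1 \<le> \<kappa>" unfolding \<kappa>_def by (simp add: sum_nonneg)
  have "\<exists>S\<subseteq>R. finite S \<and> card S = N ^ (2*n) \<and> (\<forall>x\<in>S. \<forall>k<n. cmod (\<sigma> k x) \<le> \<kappa> * N)" for N :: nat
  proof -
    define f where "f c = (\<Sum>i<2*n. of_int (c i) * basis i)" for c :: "nat \<Rightarrow> int"
    define A where "A = ({..<2*n} \<rightarrow>\<^sub>E {0..<int N})"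
    have finA: "finite A" unfolding A_def by (intro finite_PiE) auto
    have cardA: "card A = N ^ (2*n)" by (simp add: A_def card_PiE)
    have inj: "inj_on f A"
    proof (rule inj_onI)
      fix c c' assume c: "c \<in> A" "c' \<in> A" and "f c = f c'"
      then have "(\<Sum>i<2*n. of_int (c i - c' i) * basis i) = 0"
        by (simp add: f_def sum_subtractf left_diff_distrib)
      then have "c i - c' i = 0" if "i < 2*n" for i
        using independent[of "\<lambda>i. c i - c' i"] that by simp
      then show "c = c'" using c unfolding A_def by (intro PiE_ext) auto
    qed
    have sub: "f ` A \<subseteq> R" by (auto simp: f_def R_basis)
    have bd: "cmod (\<sigma> k (f c)) \<le> \<kappa> * N" if c: "c \<in> A" and k: "k < n" for c k
    proof -
      have "\<sigma> k (f c) = (\<Sum>i<2*n. of_int (c i) * \<sigma> k (basis i))"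
        unfolding f_def using k basis_R by (subst \<sigma>_sum) (auto simp: \<sigma>_mult \<sigma>_of_int)
      then have "cmod (\<sigma> k (f c)) \<le> (\<Sum>i<2*n. cmod (of_int (c i) * \<sigma> k (basis i)))"
        by (simp add: norm_sum)
      also have "\<dots> \<le> (\<Sum>i<2*n. real N * cmod (\<sigma> k (basis i)))"
      proof (rule sum_mono)
        fix i assume "i \<in> {..<2*n}"
        then have "c i \<in> {0..<int N}" using c unfolding A_def by (rule PiE_mem[rotated])
        then have "cmod (of_int (c i)) \<le> real N" unfolding norm_of_int by auto
        then show "cmod (of_int (c i) * \<sigma> k (basis i)) \<le> real N * cmod (\<sigma> k (basis i))"
          by (simp add: norm_mult mult_right_mono)
      qed
      also have "\<dots> = (\<Sum>i<2*n. cmod (\<sigma> k (basis i))) * N"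
        by (simp add: sum_distrib_left mult.commute)
      also have "\<dots> \<le> \<kappa> * N"
      proof (rule mult_right_mono)
        have "(\<Sum>i<2*n. cmod (\<sigma> k (basis i))) \<le> (\<Sum>k<n. \<Sum>i<2*n. cmod (\<sigma> k (basis i)))"
          using k by (intro member_le_sum[where f = "\<lambda>k. \<Sum>i<2*n. cmod (\<sigma> k (basis i))"]) (auto intro: sum_nonneg)
        then show "(\<Sum>i<2*n. cmod (\<sigma> k (basis i))) \<le> \<kappa>" by (simp add: \<kappa>_def)
      qed simp
      finally show ?thesis .
    qed
    show ?thesis
    proof (intro exI[of _ "f ` A"] conjI ballI allI impI)
      show "finite (f ` A)" using finA by (rule finite_imageI)
      show "card (f ` A) = N ^ (2*n)" by (simp only: card_image[OF inj] cardA)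
      fix x k assume "x \<in> f ` A" "k < n"
      then show "cmod (\<sigma> k x) \<le> \<kappa> * N" using bd by (elim imageE) simp
    qed (rule sub)
  qed
  then show thesis by (rule that[OF \<kappa>1])
qed

text \<open>Plays the role of the bound 1 on the absolute norm. Nonzero elements with all conjugates
  at most 1 are finitely many, and \<open>\<eta>\<close> is at most the least of their absolute
  values at the identity place.\<close>

lemma conjugates_away_from_zero:
  obtains \<eta> where "0 < \<eta>" "\<And>x. x \<in> R \<Longrightarrow> (\<And>k. k < n \<Longrightarrow> cmod (\<sigma> k x) < \<eta>) \<Longrightarrow> x = 0"
proof -
  define E where "E = {x \<in> R. \<forall>k<n. cmod (\<sigma> k x) \<le> 1} - {0}"
  have E: "finite E" using finite_bounded by (simp add: E_def)
  define \<eta> where "\<eta> = Min (insert 1 (cmod ` E))"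
  have "0 < \<eta>" unfolding \<eta>_def using E by (subst Min_gr_iff) (auto simp: E_def)
  moreover have "x = 0" if x: "x \<in> R" "\<And>k. k < n \<Longrightarrow> cmod (\<sigma> k x) < \<eta>" for x
  proof (rule ccontr)
    assume "x \<noteq> 0"
    have "\<eta> \<le> 1" unfolding \<eta>_def using E by (intro Min_le) auto
    then have "x \<in> E" using x \<open>x \<noteq> 0\<close> by (force simp: E_def)
    then have "\<eta> \<le> cmod x" unfolding \<eta>_def using E by (intro Min_le) auto
    then show False using x(2)[of 0] \<sigma>_0[OF x(1)] by simp
  qed
  ultimately show thesis using that by blast
qed

text \<open>Coordinates at the identity place centred at the point \<open>B 0\<close>: the form
  becomes \<open>herm\<close>, and the size of the coordinates of a vector is its size in the norm
  attached to that point.\<close>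

definition frame :: "complex^3^3 \<Rightarrow> complex^3^3" where
  "frame B = inv\<^bsub>SU21\<^esub> B ** D"

definition coord :: "complex^3^3 \<Rightarrow> nat \<Rightarrow> complex^3 \<Rightarrow> complex^3" where
  "coord B k x = (if k = 0 then frame B *v x else sv k x)"

definition hform :: "complex^3 \<Rightarrow> complex" where
  "hform x = x$1 * cnj (x$1) + x$2 * cnj (x$2) - of_real a * (x$3 * cnj (x$3))"

lemma coord_diff: "k < n \<Longrightarrow> Rvec x \<Longrightarrow> Rvec y \<Longrightarrow> coord B k (x - y) = coord B k x - coord B k y"
  by (simp add: coord_def sv_diff matrix_vector_mult_diff_distrib)

lemma herm_D: "herm (D *v x) (D *v x) = hform x"
proof -
  have "complex_of_real (sqrt a) * complex_of_real (sqrt a) = complex_of_real a"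
    using a_pos by (simp flip: of_real_mult)
  then show ?thesis
    by (simp add: herm_def hform_def D_def d_def matrix_vector_mult_def sum_3 algebra_simps)
qed

lemma hform_frame:
  assumes "B \<in> carrier SU21"
  shows "herm (frame B *v x) (frame B *v x) = hform x"
  using SU21.inv_closed[OF assms] herm_D[of x]
  by (simp add: frame_def SU21_iff flip: matrix_vector_mul_assoc)

lemma hform_small:
  assumes B: "B \<in> carrier SU21" and x: "Rvec x" and k: "k < n"
    and small: "\<And>i. cmod (coord B k x $ i) \<le> e" and e: "0 \<le> e"
  shows "cmod (\<sigma> k (hform x)) \<le> (3 + \<bar>a' k\<bar>) * e\<^sup>2"
proof -
  have sq: "cmod (coord B k x $ i * cnj (coord B k x $ i)) \<le> e\<^sup>2" for i
    using small[of i] e by (simp add: norm_mult power2_eq_square mult_mono)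
  have R: "hform x \<in> R" using x by (simp add: hform_def Rvec_def)
  show ?thesis
  proof (cases "k = 0")
    case True
    let ?y = "coord B 0 x"
    have "\<sigma> k (hform x) = ?y$1 * cnj (?y$1) + ?y$2 * cnj (?y$2) - ?y$3 * cnj (?y$3)"
      using True \<sigma>_0[OF R] hform_frame[OF B, of x] by (simp add: herm_def coord_def)
    also have "cmod \<dots> \<le> cmod (?y$1 * cnj (?y$1)) + cmod (?y$2 * cnj (?y$2)) + cmod (?y$3 * cnj (?y$3))"
      by (smt (verit) norm_triangle_ineq norm_triangle_ineq4)
    also have "\<dots> \<le> 3 * e\<^sup>2"
      using sq[of 1] sq[of 2] sq[of 3] True by simp
    also have "\<dots> \<le> (3 + \<bar>a' k\<bar>) * e\<^sup>2" by (intro mult_right_mono) auto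
    finally show ?thesis .
  next
    case False
    let ?y = "coord B k x"
    have "\<sigma> k (hform x) = ?y$1 * cnj (?y$1) + ?y$2 * cnj (?y$2) - of_real (a' k) * (?y$3 * cnj (?y$3))"
      using False k x by (simp add: hform_def coord_def sv_def \<sigma>_simps Rvec_def)
    also have "cmod \<dots> \<le> cmod (?y$1 * cnj (?y$1)) + cmod (?y$2 * cnj (?y$2)) + \<bar>a' k\<bar> * cmod (?y$3 * cnj (?y$3))"
      by (smt (verit) norm_triangle_ineq norm_triangle_ineq4 norm_mult norm_of_real)
    also have "\<dots> \<le> e\<^sup>2 + e\<^sup>2 + \<bar>a' k\<bar> * e\<^sup>2"
      using sq by (intro add_mono mult_left_mono) auto
    also have "\<dots> \<le> (3 + \<bar>a' k\<bar>) * e\<^sup>2" by (simp add: algebra_simps)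
    finally show ?thesis .
  qed
qed

text \<open>Already the conjugate at place 1 is positive definite. The existence of this place, from
  \<open>n2\<close>, is the source of cocompactness.\<close>

lemma hform_anisotropic:
  assumes x: "Rvec x" and "hform x = 0"
  shows "x = 0"
proof -
  have k: "0 < (1::nat)" "1 < n" using n2 by auto
  have "\<sigma> 1 (hform x) = 0" using assms \<sigma>_zero[OF k(2)] by simp
  then have "complex_of_real ((cmod (\<sigma> 1 (x$1)))\<^sup>2 + (cmod (\<sigma> 1 (x$2)))\<^sup>2 + (- a' 1) * (cmod (\<sigma> 1 (x$3)))\<^sup>2) = 0"
    unfolding of_real_add of_real_mult complex_norm_square
    using k x by (simp add: hform_def \<sigma>_simps Rvec_def)
  then have eq: "(cmod (\<sigma> 1 (x$1)))\<^sup>2 + (cmod (\<sigma> 1 (x$2)))\<^sup>2 + (- a' 1) * (cmod (\<sigma> 1 (x$3)))\<^sup>2 = 0"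
    unfolding of_real_eq_0_iff .
  have "0 \<le> (- a' 1) * (cmod (\<sigma> 1 (x$3)))\<^sup>2" using a'_neg[OF k] by (intro mult_nonneg_nonneg) auto
  with eq have "(cmod (\<sigma> 1 (x$1)))\<^sup>2 = 0" "(cmod (\<sigma> 1 (x$2)))\<^sup>2 = 0" "(- a' 1) * (cmod (\<sigma> 1 (x$3)))\<^sup>2 = 0"
    using zero_le_power2[of "cmod (\<sigma> 1 (x$1))"] zero_le_power2[of "cmod (\<sigma> 1 (x$2))"] by linarith+
  then have "\<sigma> 1 (x$i) = 0" for i using a'_neg[OF k] exhaust_3[of i] by auto
  then show ?thesis using sv_inj[OF k(2) x] by (simp add: sv_def vec_eq_iff)
qed

end

lemma matrix_vector_entry_bound:
  fixes A :: "complex^3^3"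
  assumes "\<And>i j. cmod (A$i$j) \<le> a" "\<And>i. cmod (x$i) \<le> b"
  shows "cmod ((A *v x)$i) \<le> 3 * a * b"
proof -
  have a0: "0 \<le> a"
    using assms(1) norm_ge_zero order_trans by blast
  have "cmod ((A *v x)$i) \<le> (\<Sum>k\<in>UNIV. cmod (A$i$k * x$k))"
    unfolding matrix_vector_mult_def by (simp add: norm_sum)
  also have "\<dots> \<le> (\<Sum>k\<in>(UNIV::3 set). a * b)"
    using assms a0 by (intro sum_mono) (auto simp: norm_mult intro!: mult_mono)
  finally show ?thesis by simp
qed

text \<open>The outer two entries are coordinates in which boosts act diagonally;
  \<open>|x1|^2 - |x3|^2\<close> is the real part of the first times the conjugate of the
  third.\<close>

definition light_cone :: "complex^3 \<Rightarrow> complex^3" where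
  "light_cone x = vector [x$1 + x$3, x$2, x$1 - x$3]"

lemma light_cone_diff: "light_cone (x - y) = light_cone x - light_cone y"
  by (simp add: light_cone_def vec_eq_iff forall_3)

lemma light_cone_bound:
  assumes "\<And>i. cmod (x$i) \<le> b"
  shows "cmod (light_cone x $ i) \<le> 2 * b"
proof -
  have "cmod (x$1 + x$3) \<le> 2 * b" "cmod (x$1 - x$3) \<le> 2 * b"
    using norm_triangle_ineq[of "x$1" "x$3"] norm_triangle_ineq4[of "x$1" "x$3"] assms[of 1] assms[of 3]
    by linarith+
  moreover have "cmod (x$2) \<le> 2 * b"
    using assms[of 2] norm_ge_zero[of "x$2"] by linarith
  ultimately show ?thesis
    using exhaust_3[of i] by (auto simp: light_cone_def)
qed

text \<open>A boost stretches one light cone direction by \<open>c + s\<close> and contracts the other by \<open>c - s\<close>.\<close>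

definition stretch :: "real \<Rightarrow> real \<Rightarrow> 3 \<Rightarrow> real" where
  "stretch c s i = (if i = 1 then c + s else if i = 2 then 1 else c - s)"

text \<open>The boxes adapted to the boost have sides proportional to \<open>stretch\<close>. Since
  \<open>(c + s) (c - s) = 1\<close>, their volume does not depend on the boost, which is why the
  constants of the counting are uniform over the ball.\<close>

lemma boost_light_cone:
  assumes cs: "c\<^sup>2 - s\<^sup>2 = 1" "c \<ge> 1" "s \<ge> 0"
    and w: "\<And>i. cmod (light_cone x $ i) \<le> r * stretch c s i"
  shows "cmod ((boost c (- s) *v x)$i) \<le> r"
proof -
  have prod: "(c - s) * (c + s) = 1" using cs by (simp add: power2_eq_square algebra_simps)
  have pos: "0 < c + s" "0 < c - s"
    using prod cs by (simp, metis add_pos_nonneg less_le_trans zero_less_mult_pos2 zero_less_one)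
  let ?w1 = "x$1 + x$3" and ?w3 = "x$1 - x$3"
  have w1: "cmod (of_real (c - s) * ?w1) \<le> r"
  proof -
    have "cmod (of_real (c - s) * ?w1) = (c - s) * cmod ?w1"
      unfolding norm_mult norm_of_real using pos by simp
    also have "\<dots> \<le> (c - s) * (r * (c + s))"
      using w[of 1] pos by (intro mult_left_mono) (auto simp: light_cone_def stretch_def)
    also have "\<dots> = r" using prod by (simp add: mult.left_commute)
    finally show ?thesis .
  qed
  have w3: "cmod (of_real (c + s) * ?w3) \<le> r"
  proof -
    have "cmod (of_real (c + s) * ?w3) = (c + s) * cmod ?w3"
      unfolding norm_mult norm_of_real using pos by simp
    also have "\<dots> \<le> (c + s) * (r * (c - s))"
      using w[of 3] pos by (intro mult_left_mono) (auto simp: light_cone_def stretch_def)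
    also have "\<dots> = r" using prod by (simp add: mult.commute mult.left_commute)
    finally show ?thesis .
  qed
  have e: "(boost c (- s) *v x)$1 = (of_real (c - s) * ?w1 + of_real (c + s) * ?w3) / 2"
    "(boost c (- s) *v x)$3 = (of_real (c - s) * ?w1 - of_real (c + s) * ?w3) / 2"
    "(boost c (- s) *v x)$2 = x$2"
    by (simp_all add: boost_def matrix_vector_mult_def sum_3 algebra_simps)
  have e2: "cmod (x$2) \<le> r" using w[of 2] by (simp add: light_cone_def stretch_def)
  have half: "cmod ((p + q) / 2) \<le> r" "cmod ((p - q) / 2) \<le> r" if "cmod p \<le> r" "cmod q \<le> r" for p q
    using norm_triangle_ineq[of p q] norm_triangle_ineq4[of p q] that by (simp_all add: norm_divide)
  have "cmod ((boost c (- s) *v x)$1) \<le> r" "cmod ((boost c (- s) *v x)$3) \<le> r"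
    unfolding e(1,2) by (rule half[OF w1 w3])+
  then show ?thesis
    using exhaust_3[of i] e(3) e2 by auto
qed

section \<open>Counting lattice vectors in space and in planes\<close>

context cm_order
begin

lemma frame_inverse:
  assumes "B \<in> carrier SU21"
  shows "D' ** B ** frame B = mat 1"
proof -
  have "D' ** B ** frame B = D' ** (B ** inv\<^bsub>SU21\<^esub> B) ** D"
    by (simp only: frame_def matrix_mul_assoc)
  then show ?thesis using assms by simp
qed

text \<open>
  Pigeonhole in boxes adapted to the light cone produces about \<open>r^(6n)\<close> lattice vectors of
  size \<open>r\<close>.  The hermitian form is bounded away from zero on nonzero vectors, so a plane contains at most
  about \<open>r^(4n)\<close> of them.
\<close>

lemma many_short_vectors:
  obtains \<kappa> :: real where "0 < \<kappa>"
    "\<And>r c s u v. 0 < r \<Longrightarrow> c\<^sup>2 - s\<^sup>2 = 1 \<Longrightarrow> c \<ge> 1 \<Longrightarrow> s \<ge> 0 \<Longrightarrow> (cmod u)\<^sup>2 + (cmod v)\<^sup>2 = 1 \<Longrightarrow>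
      \<exists>P. finite P \<and> (\<forall>x\<in>P. Rvec x) \<and> (r / \<kappa>) ^ (6*n) \<le> card P \<and>
        (\<forall>x\<in>P. \<forall>y\<in>P. \<forall>k<n. \<forall>i. cmod (coord (rotation u v ** boost c s) k (x - y) $ i) \<le> 2 * r)"
proof -
  obtain \<kappa>0 :: real where \<kappa>0: "1 \<le> \<kappa>0"
    "\<And>N::nat. \<exists>S\<subseteq>R. finite S \<and> card S = N ^ (2*n) \<and> (\<forall>x\<in>S. \<forall>k<n. cmod (\<sigma> k x) \<le> \<kappa>0 * N)"
    using many_elements by blast
  define e where "e = max 1 (sqrt a)"
  have e1: "1 \<le> e" by (simp add: e_def)
  \<comment> \<open>The entries of the inverse rotation are at most 1 and those of \<open>D\<close>
    at most \<open>e\<close>; each matrix product contributes a factor 3 and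
    \<open>light_cone\<close> a factor 2.\<close>
  define \<kappa>1 where "\<kappa>1 = 2 * (3 * (3 * 1 * e) * \<kappa>0)"
  have "\<kappa>0 * 1 \<le> \<kappa>0 * (18 * e)" using \<kappa>0(1) e1 by (intro mult_left_mono) auto
  then have \<kappa>10: "\<kappa>0 \<le> \<kappa>1" by (simp add: \<kappa>1_def algebra_simps)
  then have \<kappa>1: "1 \<le> \<kappa>1" using \<kappa>0(1) by linarith
  show thesis
  proof (rule that[of "5 * \<kappa>1"])
    show "0 < 5 * \<kappa>1" using \<kappa>1 by simp
    fix r c s :: real and u v :: complex
    assume r: "0 < r" and cs: "c\<^sup>2 - s\<^sup>2 = 1" "c \<ge> 1" "s \<ge> 0" and uv: "(cmod u)\<^sup>2 + (cmod v)\<^sup>2 = 1"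
    have prod: "(c - s) * (c + s) = 1" using cs by (simp add: power2_eq_square algebra_simps)
    have pos: "0 < c + s" "0 < c - s"
      using prod cs by (simp, metis add_pos_nonneg less_le_trans zero_less_mult_pos2 zero_less_one)
    define Q where "Q = rotation u v"
    have Q: "Q \<in> carrier SU21" using uv by (simp add: Q_def rotation_SU21)
    \<comment> \<open>The part of the frame whose entries are bounded independently of the point;
      the unbounded boost is met by the shape of the boxes.\<close>
    define X where "X = inv\<^bsub>SU21\<^esub> Q ** D"
    define B where "B = Q ** boost c s"
    have frameB: "frame B = boost c (- s) ** X"
      using Q boost_SU21[OF cs(1)] SU21.inv_mult_group[of Q "boost c s"] boost_inv[OF cs(1)]
      by (simp add: frame_def X_def B_def matrix_mul_assoc)
    have "(cmod u)\<^sup>2 \<le> 1" "(cmod v)\<^sup>2 \<le> 1"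
      using uv zero_le_power2[of "cmod u"] zero_le_power2[of "cmod v"] by linarith+
    then have "cmod u \<le> 1" "cmod v \<le> 1"
      by (simp_all add: abs_square_le_1)
    then have "cmod (Q$i$j) \<le> 1" for i j
      using exhaust_3[of i] exhaust_3[of j] by (auto simp: Q_def rotation_def)
    moreover have "cmod (D$i$j) \<le> e" for i j
      using a_pos by (auto simp: D_def d_def e_def)
    ultimately have X: "cmod (X$i$j) \<le> 3 * 1 * e" for i j
      unfolding X_def using SU21_inv_entry[OF Q] by (intro matrix_mult_entry_bound) auto
    define \<rho> where "\<rho> j = (if fst j = 0 then r * stretch c s (snd j) else r)" for j :: "nat \<times> 3"
    have \<rho>0: "0 < \<rho> j" for j
      using r pos by (simp add: \<rho>_def stretch_def)
    define J where "J = {..<n} \<times> (UNIV :: 3 set)"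
    have J: "finite J" by (simp add: J_def)
    \<comment> \<open>\<open>N\<close> depends on the point, as the boxes must not exceed the range
      that is divided up. It cancels at the end, since
      \<open>N / q = r / (5 * \<kappa>1)\<close>.\<close>
    obtain N :: nat where N: "Max (insert 1 (\<rho> ` J)) \<le> real N" using real_arch_simple by blast
    have N1: "1 \<le> real N" "\<And>j. j \<in> J \<Longrightarrow> \<rho> j \<le> real N"
      using N J by auto
    obtain S where S: "S \<subseteq> R" "finite S" "card S = N ^ (2*n)" "\<And>x k. x \<in> S \<Longrightarrow> k < n \<Longrightarrow> cmod (\<sigma> k x) \<le> \<kappa>0 * N"
      using \<kappa>0(2)[of N] by blast
    define A where "A = {x :: complex^3. \<forall>i. x$i \<in> S}"
    have A: "finite A" "card A = (N ^ (2*n)) ^ 3" "\<And>x. x \<in> A \<Longrightarrow> Rvec x"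
      using S finite_vec_entries[OF S(2)] card_vec_entries[of S, where 'n = 3] by (auto simp: A_def Rvec_def)
    define F where "F j x = (if fst j = 0 then light_cone (X *v x) $ snd j else \<sigma> (fst j) (x $ snd j))" for j :: "nat \<times> 3" and x
    have F_bound: "cmod (F j x) \<le> \<kappa>1 * N" if j: "j \<in> J" and x: "x \<in> A" for j x
    proof (cases "fst j = 0")
      case True
      have "cmod (x$i) \<le> \<kappa>0 * N" for i
      proof -
        have "x$i \<in> S" "x$i \<in> R" using x S(1) by (auto simp: A_def)
        then show ?thesis using S(4)[of "x$i" 0] \<sigma>_0[of "x$i"] by simp
      qed
      then have "cmod (light_cone (X *v x) $ snd j) \<le> 2 * (3 * (3 * 1 * e) * (\<kappa>0 * N))"
        by (intro light_cone_bound matrix_vector_entry_bound X)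
      then show ?thesis using True by (simp add: F_def \<kappa>1_def mult.assoc)
    next
      case False
      have "cmod (\<sigma> (fst j) (x $ snd j)) \<le> \<kappa>0 * N"
        using j x S(4) by (auto simp: A_def J_def)
      also have "\<dots> \<le> \<kappa>1 * N" using \<kappa>10 by (intro mult_right_mono) auto
      finally show ?thesis using False by (simp add: F_def)
    qed
    obtain P where P: "P \<subseteq> A" "real (card A) \<le> real (card P) * (\<Prod>j\<in>J. (5 * (\<kappa>1 * N) / \<rho> j)\<^sup>2)"
      "\<And>x y j. x \<in> P \<Longrightarrow> y \<in> P \<Longrightarrow> j \<in> J \<Longrightarrow> cmod (F j x - F j y) \<le> 2 * \<rho> j"
    proof (rule complex_cells[of A J F "\<lambda>_. \<kappa>1 * N" \<rho>])
      fix j assume "j \<in> J"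
      have "\<rho> j \<le> 1 * real N" using N1 \<open>j \<in> J\<close> by simp
      also have "\<dots> \<le> \<kappa>1 * N" using \<kappa>1 by (intro mult_right_mono) auto
      finally show "\<rho> j \<le> \<kappa>1 * N" .
    qed (use A J F_bound \<rho>0 in auto)
    define q where "q = 5 * \<kappa>1 * N / r"
    have q0: "0 < q" using \<kappa>1 N1 r by (simp add: q_def)
    have "(\<Prod>j\<in>J. (5 * (\<kappa>1 * N) / \<rho> j)\<^sup>2) = (\<Prod>k<n. \<Prod>i\<in>UNIV. (5 * (\<kappa>1 * N) / \<rho> (k, i))\<^sup>2)"
      unfolding J_def by (simp add: prod.cartesian_product)
    also have "\<dots> = (\<Prod>k<n. q ^ 6)"
    proof (rule prod.cong)
      fix k assume "k \<in> {..<n}"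
      show "(\<Prod>i\<in>UNIV. (5 * (\<kappa>1 * N) / \<rho> (k, i))\<^sup>2) = q ^ 6"
      proof (cases "k = 0")
        case True
        have UNIV3: "prod f (UNIV :: 3 set) = f 1 * f 2 * f 3" for f :: "3 \<Rightarrow> real"
          unfolding UNIV_3 by simp
        have "(\<Prod>i\<in>UNIV. (5 * (\<kappa>1 * N) / \<rho> (k, i))\<^sup>2) = (q / (c + s))\<^sup>2 * q\<^sup>2 * (q / (c - s))\<^sup>2"
          using True by (simp add: UNIV3 \<rho>_def stretch_def q_def mult.assoc)
        also have "\<dots> = q ^ 6 / (((c - s) * (c + s)) ^ 2)"
          using pos by (simp add: field_simps eval_nat_numeral)
        finally show ?thesis by (simp add: prod)
      next
        case False
        then have "(\<Prod>i\<in>UNIV. (5 * (\<kappa>1 * N) / \<rho> (k, i))\<^sup>2) = (\<Prod>i\<in>(UNIV::3 set). q\<^sup>2)"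
          by (simp add: \<rho>_def q_def mult.assoc)
        then show ?thesis by (simp flip: power_mult)
      qed
    qed simp
    also have "\<dots> = q ^ (6 * n)" by (simp add: power_mult)
    finally have "real N ^ (6 * n) \<le> real (card P) * q ^ (6 * n)"
      using P(2) A(2) by (simp flip: power_mult add: mult.commute)
    then have "(real N / q) ^ (6 * n) \<le> real (card P)"
      using q0 by (simp add: power_divide field_simps)
    moreover have "real N / q = r / (5 * \<kappa>1)"
      using N1 r \<kappa>1 by (simp add: q_def)
    ultimately have "(r / (5 * \<kappa>1)) ^ (6 * n) \<le> real (card P)" by simp
    moreover have "cmod (coord B k (x - y) $ i) \<le> 2 * r" if "x \<in> P" "y \<in> P" "k < n" for x y k i
    proof (cases "k = 0")
      case True
      have "cmod (light_cone (X *v (x - y)) $ i) \<le> (2 * r) * stretch c s i" for i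
        using P(3)[of x y "(0, i)"] that by (simp add: J_def F_def \<rho>_def matrix_vector_mult_diff_distrib light_cone_diff)
      then have "cmod ((boost c (- s) *v (X *v (x - y)))$i) \<le> 2 * r"
        by (rule boost_light_cone[OF cs])
      then show ?thesis using True by (simp add: coord_def frameB matrix_vector_mul_assoc)
    next
      case False
      have "Rvec x" "Rvec y" using that P(1) A(3) by auto
      then show ?thesis
        using False P(3)[of x y "(k, i)"] that
        by (simp add: J_def F_def \<rho>_def coord_def sv_def Rvec_def \<sigma>_diff)
    qed
    ultimately show "\<exists>P. finite P \<and> (\<forall>x\<in>P. Rvec x) \<and> (r / (5 * \<kappa>1)) ^ (6*n) \<le> card P \<and>
        (\<forall>x\<in>P. \<forall>y\<in>P. \<forall>k<n. \<forall>i. cmod (coord (rotation u v ** boost c s) k (x - y) $ i) \<le> 2 * r)"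
      using P(1) A finite_subset[OF P(1) A(1)] unfolding B_def Q_def by (intro exI[of _ P]) auto
  qed
qed

text \<open>At each place two coordinates dominate the third. Two vectors of the plane in a common
  cell of side \<open>\<delta>\<close> in these \<open>2 * n\<close> complex coordinates have a
  difference with all coordinates at most \<open>4 * \<delta>\<close>; its form value has all
  conjugates below \<open>\<eta>\<close>, so vanishes, and anisotropy makes the vectors equal. Hence
  there are at most as many vectors as cells.\<close>

lemma plane_sparse:
  obtains \<delta> where "0 < \<delta>" "\<delta> \<le> 1"
    "\<And>B P r w. 1 \<le> r \<Longrightarrow> B \<in> carrier SU21 \<Longrightarrow> finite P \<Longrightarrow> (\<And>x. x \<in> P \<Longrightarrow> Rvec x) \<Longrightarrow> Rvec w \<Longrightarrow> w \<noteq> 0 \<Longrightarrow>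
       (\<And>x. x \<in> P \<Longrightarrow> dot w x = 0) \<Longrightarrow> (\<And>x k i. x \<in> P \<Longrightarrow> k < n \<Longrightarrow> cmod (coord B k x $ i) \<le> 2 * r) \<Longrightarrow>
       real (card P) \<le> (10 * r / \<delta>) ^ (4 * n)"
proof -
  obtain \<eta> where \<eta>: "0 < \<eta>" "\<And>x. x \<in> R \<Longrightarrow> (\<And>k. k < n \<Longrightarrow> cmod (\<sigma> k x) < \<eta>) \<Longrightarrow> x = 0"
    using conjugates_away_from_zero by blast
  define m where "m = 3 + (\<Sum>k<n. \<bar>a' k\<bar>)"
  have "0 \<le> (\<Sum>k<n. \<bar>a' k\<bar>)" by (simp add: sum_nonneg)
  then have m0: "0 < m" unfolding m_def by linarith
  have m: "3 + \<bar>a' k\<bar> \<le> m" if "k < n" for k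
    unfolding m_def using that by (intro add_left_mono member_le_sum) auto
  \<comment> \<open>Chosen for \<open>m * (4 * \<delta>)^2 < \<eta>\<close>; 17 in place of 16 makes
    the inequality strict.\<close>
  define \<delta> where "\<delta> = min 1 (sqrt (\<eta> / (17 * m)))"
  have \<delta>: "0 < \<delta>" "\<delta> \<le> 1" using \<eta> m0 by (simp_all add: \<delta>_def)
  have "\<delta>\<^sup>2 \<le> (sqrt (\<eta> / (17 * m)))\<^sup>2"
    using \<delta> by (intro power_mono) (auto simp: \<delta>_def)
  then have "\<delta>\<^sup>2 \<le> \<eta> / (17 * m)" using \<eta> m0 by simp
  then have "17 * m * \<delta>\<^sup>2 \<le> \<eta>" using m0 by (simp add: field_simps)
  moreover have "0 < m * \<delta>\<^sup>2" using m0 \<delta> by simp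
  ultimately have small: "m * (4 * \<delta>)\<^sup>2 < \<eta>" by (simp add: power2_eq_square)
  show thesis
  proof (rule that[OF \<delta>])
    fix B P r w
    assume r: "(1::real) \<le> r" and B: "B \<in> carrier SU21" and P: "finite P" "\<And>x. x \<in> P \<Longrightarrow> Rvec x"
      and w: "Rvec w" "w \<noteq> 0" "\<And>x. x \<in> P \<Longrightarrow> dot w x = 0"
      and bound: "\<And>x k i. x \<in> P \<Longrightarrow> k < n \<Longrightarrow> cmod (coord B k x $ i) \<le> 2 * r"
    have "\<exists>i. \<forall>x. Rvec x \<longrightarrow> dot w x = 0 \<longrightarrow> cmod (coord B k x $ i) \<le> (\<Sum>j\<in>UNIV-{i}. cmod (coord B k x $ j))"
      if k: "k < n" for k
    proof (cases "k = 0")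
      case True
      show ?thesis
        using plane_dominated_coordinate[OF frame_inverse[OF B] w(2)] True by (auto simp: coord_def)
    next
      case False
      have "sv k w \<noteq> 0" using sv_inj[OF k w(1)] w(2) by blast
      then obtain i where i: "\<And>x. dot (sv k w) x = 0 \<Longrightarrow> cmod (x$i) \<le> (\<Sum>j\<in>UNIV-{i}. cmod (x$j))"
        using plane_dominated_coordinate[of "mat 1" "mat 1" "sv k w"] by auto
      show ?thesis
      proof (intro exI allI impI)
        fix x assume "Rvec x" "dot w x = 0"
        then have "dot (sv k w) (sv k x) = 0" using dot_sv[OF k w(1)] \<sigma>_zero[OF k] by simp
        then show "cmod (coord B k x $ i) \<le> (\<Sum>j\<in>UNIV-{i}. cmod (coord B k x $ j))"
          using i False by (simp add: coord_def)
      qed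
    qed
    then obtain \<iota> where \<iota>: "\<And>k x. k < n \<Longrightarrow> Rvec x \<Longrightarrow> dot w x = 0 \<Longrightarrow>
        cmod (coord B k x $ \<iota> k) \<le> (\<Sum>j\<in>UNIV-{\<iota> k}. cmod (coord B k x $ j))" by metis
    define J where "J = (SIGMA k:{..<n}. UNIV - {\<iota> k})"
    have J: "finite J" by (simp add: J_def)
    have cardJ: "card J = 2 * n" by (simp add: J_def card_Diff_singleton_if)
    obtain P' where P': "P' \<subseteq> P" "real (card P) \<le> real (card P') * (\<Prod>j\<in>J. (5 * (2 * r) / \<delta>)\<^sup>2)"
      "\<And>x y j. x \<in> P' \<Longrightarrow> y \<in> P' \<Longrightarrow> j \<in> J \<Longrightarrow> cmod (coord B (fst j) x $ snd j - coord B (fst j) y $ snd j) \<le> 2 * \<delta>"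
    proof (rule complex_cells[of P J "\<lambda>j x. coord B (fst j) x $ snd j" "\<lambda>_. 2 * r" "\<lambda>_. \<delta>"])
      show "\<And>j x. j \<in> J \<Longrightarrow> x \<in> P \<Longrightarrow> cmod (coord B (fst j) x $ snd j) \<le> 2 * r"
        using bound by (auto simp: J_def)
    qed (use P J \<delta> r in auto)
    have eq: "x = y" if xy: "x \<in> P'" "y \<in> P'" for x y
    proof -
      have R: "Rvec x" "Rvec y" and xyP: "x \<in> P" "y \<in> P" using that P' P by auto
      have near: "cmod (coord B k (x - y) $ i) \<le> 4 * \<delta>" if k: "k < n" for k i
      proof -
        have other: "cmod (coord B k (x - y) $ j) \<le> 2 * \<delta>" if "j \<noteq> \<iota> k" for j
          using P'(3)[OF xy, of "(k, j)"] that k by (simp add: J_def coord_diff R)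
        show ?thesis
        proof (cases "i = \<iota> k")
          case True
          have "cmod (coord B k (x - y) $ \<iota> k) \<le> (\<Sum>j\<in>UNIV-{\<iota> k}. cmod (coord B k (x - y) $ j))"
            using \<iota>[OF k, of "x - y"] R w(3) xyP by (simp add: dot_diff)
          also have "\<dots> \<le> (\<Sum>j\<in>UNIV-{\<iota> k}. 2 * \<delta>)"
            using other by (intro sum_mono) auto
          also have "\<dots> = 4 * \<delta>" by (simp add: card_Diff_singleton_if)
          finally show ?thesis using True by simp
        next
          case False
          then show ?thesis using other[of i] \<delta> by simp
        qed
      qed
      have "hform (x - y) = 0"
      proof (rule \<eta>(2))
        show "hform (x - y) \<in> R" using R by (simp add: hform_def Rvec_def)
        fix k assume k: "k < n"
        have "cmod (\<sigma> k (hform (x - y))) \<le> (3 + \<bar>a' k\<bar>) * (4 * \<delta>)\<^sup>2"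
          using hform_small[OF B _ k near] R k \<delta> by simp
        also have "\<dots> \<le> m * (4 * \<delta>)\<^sup>2" using m[OF k] by (intro mult_right_mono) auto
        finally show "cmod (\<sigma> k (hform (x - y))) < \<eta>" using small by simp
      qed
      then have "x - y = 0" using hform_anisotropic[of "x - y"] R by simp
      then show ?thesis by simp
    qed
    have "card P' \<le> 1"
      using eq by (metis card_le_Suc0_iff_eq One_nat_def finite_subset[OF P'(1) P(1)])
    have "real (card P) \<le> real (card P') * (10 * r / \<delta>) ^ (4 * n)"
      using P'(2) cardJ by (simp flip: power_mult add: mult.commute)
    also have "\<dots> \<le> 1 * (10 * r / \<delta>) ^ (4 * n)"
      using \<open>card P' \<le> 1\<close> r \<delta> by (intro mult_right_mono) auto
    finally show "real (card P) \<le> (10 * r / \<delta>) ^ (4 * n)" by simp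
  qed
qed

text \<open>For large \<open>r\<close>, uniformly in the point, space provides more vectors than any
  plane can hold, so the differences from one fixed vector are not coplanar and contain three
  independent ones.\<close>

lemma short_basis:
  obtains C :: real where "1 \<le> C"
    "\<And>c s u v. c\<^sup>2 - s\<^sup>2 = 1 \<Longrightarrow> c \<ge> 1 \<Longrightarrow> s \<ge> 0 \<Longrightarrow> (cmod u)\<^sup>2 + (cmod v)\<^sup>2 = 1 \<Longrightarrow>
      \<exists>M. Rmat M \<and> det M \<noteq> 0 \<and> (\<forall>i j. cmod ((frame (rotation u v ** boost c s) ** M)$i$j) \<le> C) \<and>
        (\<forall>k i j. 0 < k \<longrightarrow> k < n \<longrightarrow> cmod (\<sigma> k (M$i$j)) \<le> C)"
proof -
  obtain \<kappa> :: real where \<kappa>: "0 < \<kappa>"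
    and many: "\<And>r c s u v. 0 < r \<Longrightarrow> c\<^sup>2 - s\<^sup>2 = 1 \<Longrightarrow> c \<ge> 1 \<Longrightarrow> s \<ge> 0 \<Longrightarrow> (cmod u)\<^sup>2 + (cmod v)\<^sup>2 = 1 \<Longrightarrow>
      \<exists>P. finite P \<and> (\<forall>x\<in>P. Rvec x) \<and> (r / \<kappa>) ^ (6*n) \<le> card P \<and>
        (\<forall>x\<in>P. \<forall>y\<in>P. \<forall>k<n. \<forall>i. cmod (coord (rotation u v ** boost c s) k (x - y) $ i) \<le> 2 * r)"
    by (rule many_short_vectors) blast
  obtain \<delta> where \<delta>: "0 < \<delta>" "\<delta> \<le> 1"
    and sparse: "\<And>B P r w. 1 \<le> r \<Longrightarrow> B \<in> carrier SU21 \<Longrightarrow> finite P \<Longrightarrow> (\<And>x. x \<in> P \<Longrightarrow> Rvec x) \<Longrightarrow> Rvec w \<Longrightarrow> w \<noteq> 0 \<Longrightarrow>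
       (\<And>x. x \<in> P \<Longrightarrow> dot w x = 0) \<Longrightarrow> (\<And>x k i. x \<in> P \<Longrightarrow> k < n \<Longrightarrow> cmod (coord B k x $ i) \<le> 2 * r) \<Longrightarrow>
       real (card P) \<le> (10 * r / \<delta>) ^ (4 * n)"
    by (rule plane_sparse) blast
  \<comment> \<open>The comparison of \<open>(10 r / \<delta>)^(4 n)\<close> with
    \<open>(r / \<kappa>)^(6 n)\<close> is the \<open>2 n\<close>-th power of
    \<open>(10 r / \<delta>)^2 < (r / \<kappa>)^3\<close>, that is, of
    \<open>r > \<kappa>^3 (10 / \<delta>)^2\<close>.\<close>
  define r where "r = 1 + \<kappa> ^ 3 * (10 / \<delta>)\<^sup>2"
  have "0 < \<kappa> ^ 3 * (10 / \<delta>)\<^sup>2" using \<kappa> \<delta> by simp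
  then have r1: "1 \<le> r" by (simp add: r_def)
  have big: "(10 * r / \<delta>) ^ (4 * n) < (r / \<kappa>) ^ (6 * n)"
  proof -
    have "\<kappa> ^ 3 * (10 / \<delta>)\<^sup>2 * r\<^sup>2 < r * r\<^sup>2"
      using r1 by (intro mult_strict_right_mono) (auto simp: r_def)
    then have "(10 * r / \<delta>)\<^sup>2 < (r / \<kappa>) ^ 3"
      using \<kappa> by (simp add: power_divide power_mult_distrib field_simps eval_nat_numeral)
    then have "((10 * r / \<delta>)\<^sup>2) ^ (2 * n) < ((r / \<kappa>) ^ 3) ^ (2 * n)"
      by (intro power_strict_mono) auto
    then show ?thesis by (simp flip: power_mult)
  qed
  show thesis
  proof (rule that[of "2 * r"])
    show "1 \<le> 2 * r" using r1 by simp
    fix c s :: real and u v :: complex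
    assume cs: "c\<^sup>2 - s\<^sup>2 = 1" "c \<ge> 1" "s \<ge> 0" and uv: "(cmod u)\<^sup>2 + (cmod v)\<^sup>2 = 1"
    define B where "B = rotation u v ** boost c s"
    have B: "B \<in> carrier SU21" using boost_SU21[OF cs(1)] rotation_SU21[OF uv] by (simp add: B_def)
    obtain P where P: "finite P" "\<And>x. x \<in> P \<Longrightarrow> Rvec x" "(r / \<kappa>) ^ (6*n) \<le> card P"
      "\<And>x y k i. x \<in> P \<Longrightarrow> y \<in> P \<Longrightarrow> k < n \<Longrightarrow> cmod (coord B k (x - y) $ i) \<le> 2 * r"
      using many[of r, OF _ cs uv] r1 unfolding B_def by auto
    have "0 < (r / \<kappa>) ^ (6*n)" using r1 \<kappa> by simp
    then have "P \<noteq> {}" using P(3) by auto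
    then obtain x0 where x0: "x0 \<in> P" by blast
    define X where "X = (\<lambda>x. x - x0) ` P"
    have X: "finite X" "\<And>x. x \<in> X \<Longrightarrow> Rvec x" "\<And>x k i. x \<in> X \<Longrightarrow> k < n \<Longrightarrow> cmod (coord B k x $ i) \<le> 2 * r"
      using P x0 by (auto simp: X_def)
    have "card X = card P" unfolding X_def by (rule card_image) (auto intro: inj_onI)
    have "\<exists>x\<in>X. \<exists>y\<in>X. \<exists>z\<in>X. det (cols x y z) \<noteq> 0"
    proof (rule ccontr)
      assume "\<not> ?thesis"
      then have "\<And>x y z. x \<in> X \<Longrightarrow> y \<in> X \<Longrightarrow> z \<in> X \<Longrightarrow> det (cols x y z) = 0" by blast
      from coplanar_normal[OF X(2) this] obtain w where w: "Rvec w" "w \<noteq> 0" "\<And>x. x \<in> X \<Longrightarrow> dot w x = 0"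
        by blast
      have "real (card X) \<le> (10 * r / \<delta>) ^ (4 * n)"
        using sparse[OF r1 B X(1) X(2) w X(3)] by blast
      with big P(3) \<open>card X = card P\<close> show False by simp
    qed
    then obtain x y z where xyz: "x \<in> X" "y \<in> X" "z \<in> X" "det (cols x y z) \<noteq> 0" by blast
    let ?M = "cols x y z"
    have col: "\<exists>t\<in>X. \<forall>i. ?M$i$j = t$i" for j
      using xyz(1-3) by (auto simp: cols_def)
    show "\<exists>M. Rmat M \<and> det M \<noteq> 0 \<and> (\<forall>i j. cmod ((frame (rotation u v ** boost c s) ** M)$i$j) \<le> 2 * r) \<and>
        (\<forall>k i j. 0 < k \<longrightarrow> k < n \<longrightarrow> cmod (\<sigma> k (M$i$j)) \<le> 2 * r)"
    proof (intro exI[of _ ?M] conjI allI impI)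
      show "Rmat ?M" using xyz X(2) by (simp add: Rmat_def cols_def Rvec_def)
      fix i j
      obtain t where t: "t \<in> X" "\<And>i. ?M$i$j = t$i" using col by blast
      show "cmod ((frame (rotation u v ** boost c s) ** ?M)$i$j) \<le> 2 * r"
        using X(3)[OF t(1), of 0 i] t(2) by (simp add: coord_def B_def matrix_matrix_mult_def matrix_vector_mult_def)
      fix k assume "0 < k" "k < n"
      then show "cmod (\<sigma> k (?M$i$j)) \<le> 2 * r"
        using X(3)[OF t(1), of k i] t(2) by (simp add: coord_def sv_def)
    qed (rule xyz(4))
  qed
qed

end

text \<open>The third column gives \<open>|A 0|^2 = 1 - 1 / |A$3$3|^2\<close>, so bounded entries
  keep \<open>A 0\<close> away from the boundary.\<close>

lemma third_row_bound:
  assumes A: "A \<in> carrier SU21" and C: "\<And>i j. cmod (A$i$j) \<le> C" "1 \<le> C"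
  shows "norm (CH2_act A 0) \<le> sqrt (1 - 1 / C\<^sup>2)"
proof -
  let ?t = "(cmod (A$3$3))\<^sup>2"
  have col: "(cmod (A$1$3))\<^sup>2 + (cmod (A$2$3))\<^sup>2 = ?t - 1"
    using SU21_third_column[OF A] by simp
  then have t: "1 \<le> ?t"
    using zero_le_power2[of "cmod (A$1$3)"] zero_le_power2[of "cmod (A$2$3)"] by linarith
  then have "A$3$3 \<noteq> 0" by auto
  have tC: "?t \<le> C\<^sup>2" using C by (intro power_mono) auto
  have "(norm (CH2_act A 0))\<^sup>2 = ((cmod (A$1$3))\<^sup>2 + (cmod (A$2$3))\<^sup>2) / ?t"
    unfolding norm_CH2 by (simp add: CH2_act_zero norm_divide power_divide add_divide_distrib)
  also have "\<dots> = 1 - 1 / ?t" unfolding col using \<open>A$3$3 \<noteq> 0\<close> by (simp add: diff_divide_distrib)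
  also have "\<dots> \<le> 1 - 1 / C\<^sup>2"
    using tC \<open>A$3$3 \<noteq> 0\<close> C(2) by (intro diff_left_mono divide_left_mono mult_pos_pos) auto
  finally show ?thesis by (rule real_le_rsqrt)
qed

section \<open>Finitely many types of short bases, and cocompactness\<close>

context cm_order
begin

text \<open>Takes the place of the norm of \<open>t\<close>. The \<open>K + 1\<close> powers of
  \<open>t\<close> lie in a group of rank \<open>K\<close>, so pigeonhole yields an integral
  relation between them; cancelling the lowest power that occurs exhibits its nonzero coefficient as
  a multiple of \<open>t\<close>.\<close>

lemma integer_multiple:
  assumes t: "t \<in> R" "t \<noteq> 0"
  obtains m :: int and r where "0 < m" "r \<in> R" "of_int m = t * r"
proof -
  define K where "K = 2 * n"
  have "\<forall>i. \<exists>c :: nat \<Rightarrow> int. t ^ i = (\<Sum>j<K. of_int (c j) * basis j)"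
    using R_power[OF t(1)] unfolding R_basis K_def by auto
  then obtain co :: "nat \<Rightarrow> nat \<Rightarrow> int" where co: "\<And>i. t ^ i = (\<Sum>j<K. of_int (co i j) * basis j)" by metis
  define Q where "Q = nat (\<Sum>i\<le>K. \<Sum>j<K. \<bar>co i j\<bar>)"
  \<comment> \<open>As \<open>N\<close> exceeds \<open>(2 Q + 1)^K\<close>, the
    \<open>N^(K+1)\<close> coefficient vectors outnumber the at most \<open>((2 Q + 1) N)^K\<close>
    values of \<open>f\<close>.\<close>
  define N where "N = (2 * Q + 1) ^ K + 1"
  define A where "A = ({..K} \<rightarrow>\<^sub>E {0..<int N})"
  define f where "f c = (\<lambda>j\<in>{..<K}. \<Sum>i\<le>K. c i * co i j)" for c :: "nat \<Rightarrow> int"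
  define T where "T = ({..<K} \<rightarrow>\<^sub>E {- int (Q * N)..int (Q * N)})"
  have "f ` A \<subseteq> T"
  proof safe
    fix c assume c: "c \<in> A"
    have "\<bar>\<Sum>i\<le>K. c i * co i j\<bar> \<le> int (Q * N)" if j: "j < K" for j
    proof -
      have "\<bar>\<Sum>i\<le>K. c i * co i j\<bar> \<le> (\<Sum>i\<le>K. \<bar>c i * co i j\<bar>)" by (rule sum_abs)
      also have "\<dots> \<le> (\<Sum>i\<le>K. int N * \<bar>co i j\<bar>)"
      proof (rule sum_mono)
        fix i assume "i \<in> {..K}"
        then have "c i \<in> {0..<int N}" using c unfolding A_def by (rule PiE_mem[rotated])
        then show "\<bar>c i * co i j\<bar> \<le> int N * \<bar>co i j\<bar>" by (auto simp: abs_mult intro!: mult_right_mono)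
      qed
      also have "\<dots> \<le> (\<Sum>i\<le>K. int N * (\<Sum>j<K. \<bar>co i j\<bar>))"
        using j by (intro sum_mono mult_left_mono member_le_sum) auto
      also have "\<dots> = int (Q * N)"
        by (simp add: Q_def sum_distrib_left[symmetric] sum_nonneg mult.commute)
      finally show ?thesis .
    qed
    then have "(\<Sum>i\<le>K. c i * co i j) \<in> {- int (Q * N)..int (Q * N)}" if "j < K" for j
      using that by (simp only: abs_le_iff atLeastAtMost_iff minus_le_iff)
    then show "f c \<in> T" unfolding f_def T_def by (intro restrict_PiE_iff[THEN iffD2] ballI) simp
  qed
  moreover have "finite T" unfolding T_def by (intro finite_PiE) auto
  ultimately have "card (f ` A) \<le> card T" by (rule card_mono[rotated])
  also have "card T = (2 * (Q * N) + 1) ^ K"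
  proof -
    have "card {- int (Q * N)..int (Q * N)} = 2 * (Q * N) + 1"
      unfolding card_atLeastAtMost_int by linarith
    then show ?thesis by (simp only: T_def card_PiE finite_lessThan prod_constant card_lessThan)
  qed
  also have "\<dots> \<le> ((2 * Q + 1) * N) ^ K"
    by (intro power_mono) (auto simp: N_def algebra_simps)
  also have "\<dots> = (2 * Q + 1) ^ K * N ^ K" by (rule power_mult_distrib)
  also have "\<dots> < N * N ^ K" by (rule mult_strict_right_mono) (simp_all add: N_def)
  also have "\<dots> = card A" by (simp add: A_def card_PiE)
  finally have "\<not> inj_on f A" by (metis card_image less_irrefl)
  then obtain c c' where c: "c \<in> A" "c' \<in> A" "c \<noteq> c'" "f c = f c'" unfolding inj_on_def by blast
  define e where "e i = c i - c' i" for i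
  have e_ex: "\<exists>i\<le>K. e i \<noteq> 0"
  proof (rule ccontr)
    assume "\<not> ?thesis"
    then have "c i = c' i" if "i \<in> {..K}" for i using that by (simp add: e_def)
    then have "c = c'" using c(1,2) unfolding A_def by (intro PiE_ext) auto
    with c(3) show False by blast
  qed
  have rel: "(\<Sum>i\<le>K. of_int (e i) * t ^ i) = 0"
  proof -
    have "(\<Sum>i\<le>K. e i * co i j) = 0" if "j < K" for j
    proof -
      have "f c j = f c' j" using c by simp
      then show ?thesis using that by (simp add: f_def e_def left_diff_distrib sum_subtractf)
    qed
    then have "(\<Sum>j<K. of_int (\<Sum>i\<le>K. e i * co i j) * basis j) = 0" by simp
    also have "(\<Sum>j<K. of_int (\<Sum>i\<le>K. e i * co i j) * basis j) = (\<Sum>j<K. \<Sum>i\<le>K. of_int (e i) * (of_int (co i j) * basis j))"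
      by (simp add: sum_distrib_right mult.assoc)
    also have "\<dots> = (\<Sum>i\<le>K. \<Sum>j<K. of_int (e i) * (of_int (co i j) * basis j))" by (rule sum.swap)
    also have "\<dots> = (\<Sum>i\<le>K. of_int (e i) * t ^ i)" by (simp add: co sum_distrib_left)
    finally show ?thesis .
  qed
  define l where "l = (LEAST i. i \<le> K \<and> e i \<noteq> 0)"
  have l: "l \<le> K" "e l \<noteq> 0"
    using LeastI_ex[OF e_ex] by (simp_all add: l_def)
  have less_l: "e i = 0" if "i < l" for i
    using not_less_Least[of i "\<lambda>i. i \<le> K \<and> e i \<noteq> 0"] that l by (auto simp: l_def)
  define r where "r = (\<Sum>i\<in>{l<..K}. of_int (e i) * t ^ (i - l - 1))"
  have r: "r \<in> R" unfolding r_def using t by (intro R_sum) auto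
  have "{..K} = {..<l} \<union> insert l {l<..K}" using l by auto
  then have "0 = (\<Sum>i\<in>{..<l} \<union> insert l {l<..K}. of_int (e i) * t ^ i)" using rel by simp
  also have "\<dots> = (\<Sum>i\<in>{..<l}. of_int (e i) * t ^ i) + (of_int (e l) * t ^ l + (\<Sum>i\<in>{l<..K}. of_int (e i) * t ^ i))"
    by (subst sum.union_disjoint) auto
  also have "(\<Sum>i\<in>{..<l}. of_int (e i) * t ^ i) = 0" using less_l by simp
  also have "(\<Sum>i\<in>{l<..K}. of_int (e i) * t ^ i) = t ^ l * (t * r)"
    unfolding r_def sum_distrib_left
  proof (rule sum.cong)
    fix i assume "i \<in> {l<..K}"
    then have "t ^ i = t ^ (l + 1 + (i - l - 1))" by simp
    then have "t ^ i = t ^ l * t * t ^ (i - l - 1)" by (simp only: power_add power_one_right)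
    then show "of_int (e i) * t ^ i = t ^ l * (t * (of_int (e i) * t ^ (i - l - 1)))" by simp
  qed simp
  finally have "t ^ l * (of_int (e l) + t * r) = 0" by (simp add: algebra_simps)
  then have eq: "of_int (e l) + t * r = 0" using t by simp
  show thesis
  proof (cases "0 < e l")
    case True
    then show ?thesis using that[of "e l" "- r"] r eq by (simp add: eq_neg_iff_add_eq_0)
  next
    case False
    have "of_int (- e l) = t * r" using eq by (simp add: minus_equation_iff add_eq_0_iff)
    with False l(2) r show ?thesis using that[of "- e l" r] by auto
  qed
qed

text \<open>A positive integer \<open>m\<close> is a multiple of \<open>t\<close>, so it suffices to
  reduce basis coefficients modulo \<open>m\<close>. \<open>q\<close> selects representatives, and
  equal values of \<open>q\<close> mean congruence modulo \<open>t\<close>.\<close>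

lemma finite_quotient:
  assumes t: "t \<in> R" "t \<noteq> 0"
  obtains q where "finite (q ` R)" "\<And>x. x \<in> R \<Longrightarrow> \<exists>r\<in>R. x = q x + t * r"
proof -
  obtain m :: int and s where m: "0 < m" "s \<in> R" "of_int m = t * s"
    using integer_multiple[OF t] by blast
  define val where "val c = (\<Sum>i<2*n. of_int (c i) * basis i)" for c :: "nat \<Rightarrow> int"
  define F where "F = val ` ({..<2*n} \<rightarrow>\<^sub>E {0..<m})"
  have F: "finite F" unfolding F_def by (intro finite_imageI finite_PiE) auto
  have "\<exists>y\<in>F. \<exists>r\<in>R. x = y + t * r" if x: "x \<in> R" for x
  proof -
    obtain c where c: "x = val c" using x unfolding R_basis val_def by auto
    define c1 where "c1 = (\<lambda>i\<in>{..<2*n}. c i mod m)"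
    define c2 where "c2 i = c i div m" for i
    have "val c = val c1 + of_int m * val c2"
    proof -
      have "of_int (c i) * basis i = of_int (c1 i) * basis i + of_int m * (of_int (c2 i) * basis i)"
        if "i < 2*n" for i
      proof -
        have "c i = c1 i + m * c2 i" using that by (simp add: c1_def c2_def)
        then show ?thesis by (simp add: algebra_simps)
      qed
      then show ?thesis by (simp add: val_def sum_distrib_left flip: sum.distrib)
    qed
    then have "x = val c1 + t * (s * val c2)" using c m by (simp add: mult.assoc)
    moreover have "val c1 \<in> F"
      unfolding F_def c1_def using m by (intro imageI restrict_PiE_iff[THEN iffD2] ballI) auto
    moreover have "s * val c2 \<in> R" using m by (intro R_mult) (auto simp: R_basis val_def)
    ultimately show ?thesis by blast
  qed
  then obtain q where q: "\<And>x. x \<in> R \<Longrightarrow> q x \<in> F \<and> (\<exists>r\<in>R. x = q x + t * r)" by metis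
  then have "finite (q ` R)" using F by (meson finite_subset image_subsetI)
  with q show thesis using that by blast
qed

definition gram :: "complex^3^3 \<Rightarrow> complex^3^3" where
  "gram M = (\<chi> i j. M$1$i * cnj (M$1$j) + M$2$i * cnj (M$2$j) - of_real a * (M$3$i * cnj (M$3$j)))"

lemma gram_herm: "gram M $ i $ j = herm (D *v (M *v axis i 1)) (D *v (M *v axis j 1))"
proof -
  have "complex_of_real (sqrt a) * complex_of_real (sqrt a) = complex_of_real a"
    using a_pos by (simp flip: of_real_mult)
  moreover have "(D *v x)$1 = x$1" "(D *v x)$2 = x$2" "(D *v x)$3 = of_real (sqrt a) * x$3" for x
    by (simp_all add: D_def d_def matrix_vector_mult_def sum_3)
  ultimately show ?thesis
    unfolding herm_def by (simp add: gram_def matrix_vector_axis algebra_simps)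
qed

lemma herm_expand:
  fixes A :: "complex^3^3"
  shows "herm (A *v x) (A *v y) = (\<Sum>i\<in>UNIV. \<Sum>j\<in>UNIV. x$i * cnj (y$j) * herm (A *v axis i 1) (A *v axis j 1))"
proof -
  have "(A *v x)$i = (\<Sum>j\<in>UNIV. A$i$j * x$j)" for x i
    by (simp add: matrix_vector_mult_def)
  then show ?thesis
    unfolding herm_def matrix_vector_axis by (simp add: sum_3 algebra_simps)
qed

lemma gram_isometry:
  assumes "gram M = gram M'"
  shows "herm (D *v (M *v x)) (D *v (M *v y)) = herm (D *v (M' *v x)) (D *v (M' *v y))"
  using herm_expand[of "D ** M" x y] herm_expand[of "D ** M'" x y] assms
    gram_herm[of M] gram_herm[of M']
  by (simp add: matrix_vector_mul_assoc)

text \<open>Take \<open>A = D M M'^-1 D^-1\<close>. Equal Gram matrices make it an isometry and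
  equal determinants give determinant 1. The congruence modulo \<open>4 * det M\<close> cancels the
  denominator of \<open>M'^-1 = adj3 M' / det M\<close>, leaving
  \<open>cj A = 1 + 4 N adj3 M'\<close> with integral \<open>N\<close>.\<close>

lemma same_type_equivalent:
  assumes gram: "gram M = gram M'" and det: "det M = det M'" "det M \<noteq> 0"
    and R: "Rmat M" "Rmat M'" and cong: "\<And>i j. \<exists>r\<in>R. M$i$j = M'$i$j + 4 * det M * r"
  obtains A where "A \<in> \<Gamma>" "A ** (D ** M') = D ** M"
proof -
  let ?d = "det M"
  define I where "I = (\<chi> i j. adj3 M' $ i $ j / ?d)"
  have I: "M' ** I = mat 1" "I ** M' = mat 1"
  proof -
    have "(M' ** I)$i$j = (M' ** adj3 M')$i$j / ?d" "(I ** M')$i$j = (adj3 M' ** M')$i$j / ?d" for i j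
      by (simp_all add: I_def matrix_matrix_mult_def sum_divide_distrib)
    then show "M' ** I = mat 1" "I ** M' = mat 1"
      using det by (simp_all add: vec_eq_iff mult_adj3 adj3_mult mat_def)
  qed
  define A where "A = D ** M ** (I ** D')"
  have AM: "A ** (D ** M') = D ** M"
  proof -
    have "A ** (D ** M') = D ** M ** (I ** (D' ** D) ** M')"
      by (simp only: A_def matrix_mul_assoc)
    then show ?thesis by (simp add: I)
  qed
  have "herm (A *v x) (A *v y) = herm x y" for x y
  proof -
    let ?x = "(I ** D') *v x" and ?y = "(I ** D') *v y"
    have inv: "D *v (M' *v ((I ** D') *v x)) = x" for x
    proof -
      have "D ** M' ** (I ** D') = D ** (M' ** I) ** D'" by (simp only: matrix_mul_assoc)
      then have "D ** M' ** (I ** D') = mat 1" by (simp add: I)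
      then show ?thesis by (simp only: matrix_vector_mul_assoc matrix_mul_assoc matrix_vector_mul_lid)
    qed
    have "herm (A *v x) (A *v y) = herm (D *v (M *v ?x)) (D *v (M *v ?y))"
      by (simp add: A_def matrix_vector_mul_assoc matrix_mul_assoc)
    also have "\<dots> = herm (D *v (M' *v ?x)) (D *v (M' *v ?y))" by (rule gram_isometry[OF gram])
    finally show ?thesis by (simp only: inv)
  qed
  moreover have "det A = 1"
  proof -
    have "det A * (det D * det M') = det D * det M" using AM by (metis det_mul)
    moreover have "det D \<noteq> 0" by (metis DD'(1) det_I det_mul mult_zero_left zero_neq_one)
    ultimately show ?thesis using det by simp
  qed
  ultimately have A: "A \<in> carrier SU21" by (simp add: SU21_iff)
  obtain N0 where N0: "\<And>i j. N0 i j \<in> R \<and> M$i$j = M'$i$j + 4 * ?d * N0 i j" using cong by metis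
  define N :: "complex^3^3" where "N = (\<chi> i j. N0 i j)"
  have N: "Rmat N" "M = M' + (\<chi> i j. 4 * ?d * N$i$j)"
    using N0 by (simp_all add: N_def Rmat_def vec_eq_iff)
  have "cj A = M ** I"
  proof -
    have "cj A = (D' ** D) ** (M ** I) ** (D' ** D)" by (simp only: cj_def A_def matrix_mul_assoc)
    then show ?thesis by simp
  qed
  also have "\<dots> = M' ** I + (\<chi> i j. 4 * ?d * N$i$j) ** I"
    by (subst N(2)) (rule matrix_add_rdistrib)
  also have "(\<chi> i j. 4 * ?d * N$i$j) ** I = 4 *\<^sub>R (N ** adj3 M')"
  proof -
    have "((\<chi> i j. 4 * ?d * N$i$j) ** I)$i$j = (4 *\<^sub>R (N ** adj3 M'))$i$j" for i j
      unfolding vector_scaleR_component using det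
      by (simp add: matrix_matrix_mult_def I_def sum_3 scaleR_conv_of_real field_simps)
    then show ?thesis by (simp add: vec_eq_iff)
  qed
  finally have "cong4 (cj A)" unfolding cong4_def I using N R by (intro exI[of _ "N ** adj3 M'"]) simp
  then have "A \<in> \<Gamma>" using A by (simp add: \<Gamma>_def)
  with AM show thesis using that by blast
qed

lemma \<sigma>_det: "k < n \<Longrightarrow> Rmat M \<Longrightarrow> \<sigma> k (det M) = det (\<chi> i j. \<sigma> k (M$i$j))"
  by (simp add: det_3 Rmat_def \<sigma>_simps)

lemma det_bound:
  fixes M :: "complex^3^3"
  assumes "\<And>i j. cmod (M$i$j) \<le> C"
  shows "cmod (det M) \<le> 6 * C ^ 3"
proof -
  have C: "0 \<le> C" using assms norm_ge_zero order_trans by blast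
  have *: "cmod (M$i$j * M$k$l * M$p$q) \<le> C ^ 3" for i j k l p q
    using assms C by (simp add: norm_mult power3_eq_cube mult_mono)
  have six: "cmod (x1 + x2 + x3 - x4 - x5 - x6) \<le> cmod x1 + cmod x2 + cmod x3 + cmod x4 + cmod x5 + cmod x6" for x1 x2 x3 x4 x5 x6
    by (smt (verit) norm_triangle_ineq norm_triangle_ineq4)
  show ?thesis
    unfolding det_3 by (rule order_trans[OF six]) (use * in \<open>smt (verit)\<close>)
qed

text \<open>At the identity place both quantities are computed in the frame, which respects the form
  and has determinant \<open>sqrt a\<close>; hence the factor \<open>1 / sqrt a\<close>.\<close>

lemma type_bounded:
  assumes B: "B \<in> carrier SU21" and M: "Rmat M" and C: "0 \<le> C"
    and M0: "\<And>i j. cmod ((frame B ** M)$i$j) \<le> C" and Mk: "\<And>k i j. 0 < k \<Longrightarrow> k < n \<Longrightarrow> cmod (\<sigma> k (M$i$j)) \<le> C"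
    and k: "k < n"
  shows "cmod (\<sigma> k (gram M $ i $ j)) \<le> (3 + \<bar>a' k\<bar>) * C\<^sup>2"
    "cmod (\<sigma> k (det M)) \<le> 6 * C ^ 3 * (1 + 1 / sqrt a)"
proof -
  have R: "gram M $ i $ j \<in> R" "det M \<in> R" using M by (auto simp: gram_def Rmat_def)
  show "cmod (\<sigma> k (gram M $ i $ j)) \<le> (3 + \<bar>a' k\<bar>) * C\<^sup>2"
  proof (cases "k = 0")
    case True
    let ?Y = "frame B ** M"
    have "gram M $ i $ j = herm (?Y *v axis i 1) (?Y *v axis j 1)"
      using SU21.inv_closed[OF B] by (simp add: gram_herm frame_def SU21_iff flip: matrix_vector_mul_assoc)
    also have "\<dots> = ?Y$1$i * cnj (?Y$1$j) + ?Y$2$i * cnj (?Y$2$j) - ?Y$3$i * cnj (?Y$3$j)"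
      unfolding herm_def matrix_vector_axis ..
    also have "cmod \<dots> \<le> cmod (?Y$1$i * cnj (?Y$1$j)) + cmod (?Y$2$i * cnj (?Y$2$j)) + cmod (?Y$3$i * cnj (?Y$3$j))"
      by (smt (verit) norm_triangle_ineq norm_triangle_ineq4)
    also have "\<dots> \<le> C * C + C * C + C * C"
      unfolding norm_mult complex_mod_cnj using M0 C by (intro add_mono mult_mono) auto
    also have "\<dots> \<le> (3 + \<bar>a' k\<bar>) * C\<^sup>2"
      using C by (simp add: power2_eq_square algebra_simps)
    finally show ?thesis using True \<sigma>_0[OF R(1)] by simp
  next
    case False
    let ?Y = "\<lambda>i j. \<sigma> k (M$i$j)"
    have "\<sigma> k (gram M $ i $ j) = ?Y 1 i * cnj (?Y 1 j) + ?Y 2 i * cnj (?Y 2 j) - of_real (a' k) * (?Y 3 i * cnj (?Y 3 j))"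
      using M k by (simp add: gram_def Rmat_def \<sigma>_simps)
    also have "cmod \<dots> \<le> cmod (?Y 1 i * cnj (?Y 1 j)) + cmod (?Y 2 i * cnj (?Y 2 j)) + \<bar>a' k\<bar> * cmod (?Y 3 i * cnj (?Y 3 j))"
      by (smt (verit) norm_triangle_ineq norm_triangle_ineq4 norm_mult norm_of_real)
    also have "\<dots> \<le> C * C + C * C + \<bar>a' k\<bar> * (C * C)"
      unfolding norm_mult complex_mod_cnj using Mk k False C by (intro add_mono mult_mono mult_left_mono) auto
    also have "\<dots> \<le> (3 + \<bar>a' k\<bar>) * C\<^sup>2"
      using C by (simp add: power2_eq_square algebra_simps)
    finally show ?thesis .
  qed
  have bound: "6 * C ^ 3 * 1 \<le> 6 * C ^ 3 * (1 + 1 / sqrt a)" "6 * C ^ 3 * (1 / sqrt a) \<le> 6 * C ^ 3 * (1 + 1 / sqrt a)"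
    using C a_pos by (intro mult_left_mono; simp)+
  show "cmod (\<sigma> k (det M)) \<le> 6 * C ^ 3 * (1 + 1 / sqrt a)"
  proof (cases "k = 0")
    case True
    have "det (inv\<^bsub>SU21\<^esub> B) = 1" using SU21.inv_closed[OF B] by (simp add: SU21_iff)
    moreover have "det D = of_real (sqrt a)" by (simp add: det_3 D_def d_def)
    ultimately have "det (frame B ** M) = of_real (sqrt a) * det M" by (simp add: frame_def det_mul)
    then have "cmod (det (frame B ** M)) = sqrt a * cmod (det M)" using a_pos by (simp add: norm_mult)
    then have "cmod (det M) = cmod (det (frame B ** M)) / sqrt a" using a_pos by simp
    also have "\<dots> \<le> 6 * C ^ 3 / sqrt a" using det_bound[OF M0] a_pos by (intro divide_right_mono) auto
    finally show ?thesis using True \<sigma>_0[OF R(2)] bound(2) by simp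
  next
    case False
    have "cmod (det (\<chi> i j. \<sigma> k (M$i$j))) \<le> 6 * C ^ 3"
      using Mk k False by (intro det_bound) auto
    then show ?thesis using bound(1) \<sigma>_det[OF k M] by simp
  qed
qed

text \<open>Let \<open>M\<close> be a short basis at \<open>z = B 0\<close> and \<open>M'\<close>
  the chosen basis of the same type, with \<open>A D M' = D M\<close>. Then \<open>B^-1 A\<close>
  equals \<open>frame B M\<close> times the inverse of \<open>D M'\<close>. The first factor is
  bounded by shortness and the second because only finitely many \<open>M'\<close> are chosen, so
  \<open>A^-1 z\<close>, the image of 0 under the inverse of \<open>B^-1 A\<close>, stays in a fixed
  smaller ball.\<close>

lemma \<Gamma>_cocompact: "\<exists>r<1. \<forall>z\<in>CH2. \<exists>A\<in>\<Gamma>. norm (CH2_act A z) \<le> r"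
proof -
  obtain C :: real where C: "1 \<le> C"
    and short: "\<And>c s u v. c\<^sup>2 - s\<^sup>2 = 1 \<Longrightarrow> c \<ge> 1 \<Longrightarrow> s \<ge> 0 \<Longrightarrow> (cmod u)\<^sup>2 + (cmod v)\<^sup>2 = 1 \<Longrightarrow>
      \<exists>M. Rmat M \<and> det M \<noteq> 0 \<and> (\<forall>i j. cmod ((frame (rotation u v ** boost c s) ** M)$i$j) \<le> C) \<and>
        (\<forall>k i j. 0 < k \<longrightarrow> k < n \<longrightarrow> cmod (\<sigma> k (M$i$j)) \<le> C)"
    by (rule short_basis) blast
  define good where "good B M \<longleftrightarrow> Rmat M \<and> det M \<noteq> 0 \<and> (\<forall>i j. cmod ((frame B ** M)$i$j) \<le> C) \<and>
        (\<forall>k i j. 0 < k \<longrightarrow> k < n \<longrightarrow> cmod (\<sigma> k (M$i$j)) \<le> C)" for B M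
  have ex: "\<exists>B\<in>carrier SU21. \<exists>M. CH2_act B 0 = z \<and> good B M" if z: "z \<in> CH2" for z
  proof -
    obtain c s u v where *: "c\<^sup>2 - s\<^sup>2 = 1" "c \<ge> 1" "s \<ge> 0" "c\<^sup>2 * (1 - (norm z)\<^sup>2) = 1"
      "(cmod u)\<^sup>2 + (cmod v)\<^sup>2 = 1" "CH2_act (rotation u v ** boost c s) 0 = z"
      using CH2_transitive[OF z] .
    show ?thesis
      using short[OF *(1,2,3,5)] boost_SU21[OF *(1)] rotation_SU21[OF *(5)] *(6)
      by (intro bexI[of _ "rotation u v ** boost c s"]) (auto simp: good_def)
  qed
  define \<M> where "\<M> = {M. \<exists>B\<in>carrier SU21. good B M}"
  define S where "S = {x \<in> R. \<forall>k<n. cmod (\<sigma> k x) \<le> max ((3 + (\<Sum>k<n. \<bar>a' k\<bar>)) * C\<^sup>2) (6 * C ^ 3 * (1 + 1 / sqrt a))}"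
  have S: "finite S" unfolding S_def by (rule finite_bounded)
  have inS: "gram M $ i $ j \<in> S" "det M \<in> S" if M\<M>: "M \<in> \<M>" for M i j
  proof -
    obtain B where B: "B \<in> carrier SU21" "good B M" using M\<M> by (auto simp: \<M>_def)
    have tb: "cmod (\<sigma> k (gram M $ i $ j)) \<le> (3 + \<bar>a' k\<bar>) * C\<^sup>2"
      "cmod (\<sigma> k (det M)) \<le> 6 * C ^ 3 * (1 + 1 / sqrt a)" if "k < n" for k i j
      using type_bounded(1)[OF B(1), of M C k i j] type_bounded(2)[OF B(1), of M C k] B(2) C that
      by (auto simp: good_def)
    have M: "Rmat M" using B(2) by (simp add: good_def)
    then have R: "gram M $ i $ j \<in> R" "det M \<in> R" by (auto simp: gram_def Rmat_def)
    have "(3 + \<bar>a' k\<bar>) * C\<^sup>2 \<le> (3 + (\<Sum>k<n. \<bar>a' k\<bar>)) * C\<^sup>2" if "k < n" for k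
      using that by (intro mult_right_mono add_left_mono member_le_sum) auto
    then have "cmod (\<sigma> k (gram M $ i $ j)) \<le> (3 + (\<Sum>k<n. \<bar>a' k\<bar>)) * C\<^sup>2" if "k < n" for k
      using tb(1)[OF that] that order_trans by blast
    with R tb(2) show "gram M $ i $ j \<in> S" "det M \<in> S"
      unfolding S_def by (simp_all add: le_max_iff_disj)
  qed
  have "\<exists>q. finite (q ` R) \<and> (\<forall>x\<in>R. \<exists>r\<in>R. x = q x + 4 * e * r)" if "e \<in> R" "e \<noteq> 0" for e
    using finite_quotient[of "4 * e"] that by (metis R_mult R_numeral mult_eq_0_iff zero_neq_numeral)
  then obtain q where q: "\<And>e. e \<in> R \<Longrightarrow> e \<noteq> 0 \<Longrightarrow> finite (q e ` R)"
    "\<And>e x. e \<in> R \<Longrightarrow> e \<noteq> 0 \<Longrightarrow> x \<in> R \<Longrightarrow> \<exists>r\<in>R. x = q e x + 4 * e * r" by metis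
  define \<tau> where "\<tau> M = (gram M, det M, (\<chi> i j. q (det M) (M$i$j)) :: complex^3^3)" for M
  define U where "U = (\<Union>e\<in>S - {0}. q e ` R)"
  have U: "finite U" unfolding U_def using S q(1) by (auto simp: S_def)
  have "\<tau> ` \<M> \<subseteq> {G. \<forall>i j. G$i$j \<in> S} \<times> S \<times> {Q. \<forall>i j. Q$i$j \<in> U}"
  proof (rule image_subsetI)
    fix M assume M: "M \<in> \<M>"
    have MR: "Rmat M" "det M \<noteq> 0" using M by (auto simp: \<M>_def good_def)
    show "\<tau> M \<in> {G. \<forall>i j. G$i$j \<in> S} \<times> S \<times> {Q. \<forall>i j. Q$i$j \<in> U}"
    proof -
      have "q (det M) (M$i$j) \<in> U" for i j
        unfolding U_def using inS(2)[OF M] MR by (intro UN_I[of "det M"] imageI) (auto simp: Rmat_def)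
      then show ?thesis using inS[OF M] by (simp add: \<tau>_def)
    qed
  qed
  then have "finite (\<tau> ` \<M>)"
    by (rule finite_subset) (intro finite_cartesian_product finite_matrix_entries S U)
  then obtain \<R> where \<R>: "finite \<R>" "\<R> \<subseteq> \<M>" "\<tau> ` \<M> = \<tau> ` \<R>"
    using finite_subset_image[of "\<tau> ` \<M>" \<tau> \<M>] by blast
  define K where "K = (\<Sum>M\<in>\<R>. \<Sum>i\<in>UNIV. \<Sum>j\<in>UNIV. cmod (matrix_inv (D ** M) $ i $ j))"
  have K: "cmod (matrix_inv (D ** M) $ i $ j) \<le> K" if M: "M \<in> \<R>" for M i j
  proof -
    have "cmod (matrix_inv (D ** M) $ i $ j) \<le> (\<Sum>j\<in>UNIV. cmod (matrix_inv (D ** M) $ i $ j))"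
      by (rule member_le_sum) auto
    also have "\<dots> \<le> (\<Sum>i\<in>UNIV. \<Sum>j\<in>UNIV. cmod (matrix_inv (D ** M) $ i $ j))"
      by (rule member_le_sum[where f = "\<lambda>i. \<Sum>j\<in>UNIV. cmod (matrix_inv (D ** M) $ i $ j)"]) (auto intro!: sum_nonneg)
    also have "\<dots> \<le> K"
      unfolding K_def using M \<R>(1)
      by (intro member_le_sum[where f = "\<lambda>M. \<Sum>i\<in>UNIV. \<Sum>j\<in>UNIV. cmod (matrix_inv (D ** M) $ i $ j)"]) (auto intro!: sum_nonneg)
    finally show ?thesis .
  qed
  define E where "E = max 1 (3 * C * K)"
  show ?thesis
  proof (intro exI conjI ballI)
    have "0 < 1 / E\<^sup>2" by (simp add: E_def)
    then show "sqrt (1 - 1 / E\<^sup>2) < 1" by simp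
    fix z assume "z \<in> CH2"
    then obtain B M where B: "B \<in> carrier SU21" "CH2_act B 0 = z" and M: "good B M" using ex by blast
    then have "M \<in> \<M>" by (auto simp: \<M>_def)
    then have "\<tau> M \<in> \<tau> ` \<R>" using \<R>(3) by blast
    then obtain M' where M': "M' \<in> \<R>" "\<tau> M = \<tau> M'" by auto
    have R: "Rmat M" "Rmat M'" "det M \<noteq> 0" "det M \<in> R"
      using M M' \<R>(2) by (auto simp: \<M>_def good_def)
    have eq: "gram M = gram M'" "det M = det M'" and qq: "\<And>i j. q (det M) (M$i$j) = q (det M) (M'$i$j)"
      using M'(2) by (auto simp: \<tau>_def vec_eq_iff)
    have cong: "\<exists>r\<in>R. M$i$j = M'$i$j + 4 * det M * r" for i j
    proof -
      have "M$i$j \<in> R" "M'$i$j \<in> R" using R by (auto simp: Rmat_def)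
      then obtain r r' where "r \<in> R" "r' \<in> R" "M$i$j = q (det M) (M$i$j) + 4 * det M * r"
        "M'$i$j = q (det M) (M'$i$j) + 4 * det M * r'"
        using q(2)[OF R(4,3)] by metis
      then have "M$i$j = M'$i$j + 4 * det M * (r - r')" using qq[of i j] by (simp add: algebra_simps)
      with \<open>r \<in> R\<close> \<open>r' \<in> R\<close> show ?thesis by blast
    qed
    obtain A where A: "A \<in> \<Gamma>" "A ** (D ** M') = D ** M"
      using same_type_equivalent[OF eq R(3,1,2) cong] by blast
    have AS: "A \<in> carrier SU21" using A by (simp add: \<Gamma>_def)
    have iA: "inv\<^bsub>SU21\<^esub> A \<in> \<Gamma>" using A subgroup.m_inv_closed[OF \<Gamma>_subgroup] by blast
    define W where "W = inv\<^bsub>SU21\<^esub> B ** A"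
    have "det (D ** M') \<noteq> 0"
    proof -
      have "det D \<noteq> 0" by (metis DD'(1) det_I det_mul mult_zero_left zero_neq_one)
      then show ?thesis using R eq by (simp add: det_mul)
    qed
    then have "(D ** M') ** matrix_inv (D ** M') = mat 1"
      using someI_ex[of "\<lambda>X. (D ** M') ** X = mat 1 \<and> X ** (D ** M') = mat 1"]
      by (auto simp: matrix_inv_def invertible_def simp flip: invertible_det_nz)
    then have "W = inv\<^bsub>SU21\<^esub> B ** (A ** (D ** M')) ** matrix_inv (D ** M')"
      unfolding W_def by (metis matrix_mul_assoc matrix_mul_rid)
    also have "\<dots> = (frame B ** M) ** matrix_inv (D ** M')"
      unfolding A(2) frame_def by (simp only: matrix_mul_assoc)
    finally have W: "W = (frame B ** M) ** matrix_inv (D ** M')" .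
    have "cmod (W$i$j) \<le> 3 * C * K" for i j
      unfolding W using M K[OF M'(1)] by (intro matrix_mult_entry_bound) (auto simp: good_def)
    then have "cmod ((inv\<^bsub>SU21\<^esub> W)$i$j) \<le> E" for i j
      using SU21_inv_entry[of W i j] AS B by (simp add: W_def E_def max.coboundedI2)
    moreover have "inv\<^bsub>SU21\<^esub> W = inv\<^bsub>SU21\<^esub> A ** B"
      using SU21.inv_mult_group[of "inv\<^bsub>SU21\<^esub> B" A] AS B by (simp add: W_def)
    ultimately have "norm (CH2_act (inv\<^bsub>SU21\<^esub> A ** B) 0) \<le> sqrt (1 - 1 / E\<^sup>2)"
      using AS B by (intro third_row_bound) (auto simp: E_def)
    then have "norm (CH2_act (inv\<^bsub>SU21\<^esub> A) z) \<le> sqrt (1 - 1 / E\<^sup>2)"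
      using AS B by (simp add: CH2_act_mult)
    then show "\<exists>A\<in>\<Gamma>. norm (CH2_act A z) \<le> sqrt (1 - 1 / E\<^sup>2)" using iA by blast
  qed
qed

lemma uniform_lattice: "uniform_lattice G \<Gamma>"
  by (rule uniform_lattice.intro[OF G_subgroup \<Gamma>_subgroup \<Gamma>_sub_G \<Gamma>_normal G_locally_finite
        \<Gamma>_cocompact \<Gamma>_torsion_free])

end

section \<open>Automorphisms of odd order\<close>

definition diag3 :: "complex \<Rightarrow> complex \<Rightarrow> complex \<Rightarrow> complex^3^3" where
  "diag3 x y z = (\<chi> i j. if i = j then (if i = 1 then x else if i = 2 then y else z) else 0)"

lemma diag3_mult: "diag3 x y z ** diag3 x' y' z' = diag3 (x * x') (y * y') (z * z')"
  by (simp add: diag3_def vec_eq_iff forall_3 matrix_matrix_mult_def sum_3)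

lemma diag3_one: "diag3 1 1 1 = mat 1"
  by (simp add: diag3_def vec_eq_iff forall_3 mat_def)

lemma diag3_power: "diag3 x y z [^]\<^bsub>SU21\<^esub> (k::nat) = diag3 (x ^ k) (y ^ k) (z ^ k)"
  by (induction k) (simp_all add: diag3_one diag3_mult mult.commute)

lemma diag3_SU21:
  assumes "cmod x = 1" "cmod y = 1" "cmod z = 1" "x * y * z = 1"
  shows "diag3 x y z \<in> carrier SU21"
proof -
  have unit: "w * cnj w = 1" if "cmod w = 1" for w
    using that complex_norm_square[of w] by simp
  have "herm (diag3 x y z *v v) (diag3 x y z *v w) =
      (x * cnj x) * (v$1 * cnj (w$1)) + (y * cnj y) * (v$2 * cnj (w$2)) - (z * cnj z) * (v$3 * cnj (w$3))" for v w
    by (simp add: herm_def diag3_def matrix_vector_mult_def sum_3 algebra_simps)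
  then have "herm (diag3 x y z *v v) (diag3 x y z *v w) = herm v w" for v w
    by (simp add: unit assms herm_def)
  moreover have "det (diag3 x y z) = 1" using assms(4) by (simp add: det_3 diag3_def)
  ultimately show ?thesis by (simp add: SU21_iff)
qed

lemma diag3_fixes_zero: "CH2_act (diag3 x y z) 0 = 0"
  by (simp add: CH2_act_zero diag3_def vec_eq_iff forall_2)

lemma fixed_point_eigenvector:
  assumes "h \<in> carrier SU21" "z \<in> CH2" "CH2_act h z = z"
  obtains l where "h *v CH2_lift z = l *s CH2_lift z"
  using CH2_lift_act[OF assms(1,2)] assms(3) by metis

lemma eigenvalue_power:
  assumes "h *v x = l *s x"
  shows "(h [^]\<^bsub>SU21\<^esub> (k::nat)) *v x = l ^ k *s x"
proof (induction k)
  case (Suc k)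
  then show ?case
    using assms by (simp add: matrix_vector_mul_assoc[symmetric] vector_scalar_commute vector_smult_assoc)
qed simp

lemma eigenvalue_root_of_unity:
  assumes "h *v CH2_lift z = l *s CH2_lift z" "h [^]\<^bsub>SU21\<^esub> (p::nat) = mat 1"
  shows "l ^ p = 1"
proof -
  have "CH2_lift z = l ^ p *s CH2_lift z"
    using eigenvalue_power[OF assms(1), of p] assms(2) by simp
  then have "(CH2_lift z)$3 = (l ^ p *s CH2_lift z)$3" by simp
  then show ?thesis by (simp add: CH2_lift_def)
qed

text \<open>Every row of \<open>K\<close> annihilates both vectors, so it is a multiple of their
  cross product.\<close>

lemma rank_one:
  fixes K :: "complex^3^3"
  assumes kill: "K *v x = 0" "K *v y = 0" and xy: "cross x y \<noteq> 0"
  obtains u w where "\<And>i k. K$i$k = u i * w k"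
proof -
  define w where "w = cross x y"
  obtain j where j: "w$j \<noteq> 0" using xy by (auto simp: w_def vec_eq_iff)
  have rows: "K$i$k * w$j = K$i$j * w$k" for i k
  proof -
    have "K$i$1 * x$1 + K$i$2 * x$2 + K$i$3 * x$3 = 0" "K$i$1 * y$1 + K$i$2 * y$2 + K$i$3 * y$3 = 0"
      using kill by (simp_all add: vec_eq_iff matrix_vector_mult_def sum_3)
    then have "K$i$1 * w$2 = K$i$2 * w$1" "K$i$1 * w$3 = K$i$3 * w$1" "K$i$2 * w$3 = K$i$3 * w$2"
      unfolding w_def cross_def by (simp_all, algebra+)
    then show ?thesis using exhaust_3[of j] exhaust_3[of k] by auto
  qed
  show thesis
    using that[of "\<lambda>i. K$i$j / w$j" "\<lambda>k. w$k"] rows j by (simp add: field_simps)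
qed

lemma eigenvector_kernel: "h *v x = l *s x \<Longrightarrow> (h - mat l) *v x = 0" for h :: "complex^3^3"
proof -
  assume "h *v x = l *s x"
  moreover have "mat l *v x = l *s x"
    by (simp add: vec_eq_iff matrix_vector_mult_def mat_def forall_3 sum_3)
  ultimately show ?thesis by (simp add: matrix_vector_mult_diff_rdistrib)
qed

text \<open>\<open>h - l\<close> is a rank one matrix \<open>K\<close> with some trace
  \<open>t\<close>; then \<open>K^2 = t K\<close> and \<open>det (l + K) = l^2 (l + t)\<close>, so
  \<open>m = l + t\<close>. The quadratic relation also covers the case
  \<open>m = l\<close>.\<close>

lemma double_eigenvalue:
  fixes h :: "complex^3^3"
  assumes x: "h *v x = l *s x" and y: "h *v y = l *s y" and xy: "cross x y \<noteq> 0" and det: "det h = 1"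
  obtains m where "l\<^sup>2 * m = 1" "(h - mat l) ** (h - mat m) = 0"
proof -
  define K where "K = h - mat l"
  obtain u w where K: "\<And>i k. K$i$k = u i * w k"
    using rank_one[OF eigenvector_kernel[OF x] eigenvector_kernel[OF y] xy] unfolding K_def by blast
  define t where "t = u 1 * w 1 + u 2 * w 2 + u 3 * w 3"
  have h: "h = mat l + K" by (simp add: K_def)
  have "det h = l\<^sup>2 * (l + t)"
    unfolding h by (simp add: det_3 mat_def K t_def) (simp add: power2_eq_square algebra_simps)
  then have "l\<^sup>2 * (l + t) = 1" using det by simp
  moreover have "(h - mat l) ** (h - mat (l + t)) = 0"
  proof -
    have e: "h - mat l = K" "h - mat (l + t) = K - mat t"
      by (simp_all add: K_def mat_def vec_eq_iff)
    have "(K ** (K - mat t))$i$k = 0" for i k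
      using exhaust_3[of k]
      by (auto simp: matrix_matrix_mult_def sum_3 K mat_def t_def algebra_simps)
    then show ?thesis unfolding e by (simp add: vec_eq_iff)
  qed
  ultimately show thesis using that by blast
qed

text \<open>Fixed points lift to eigenvectors, and the eigenvalues lie among the finitely many
  \<open>p\<close>-th roots of unity; so two distinct fixed points share one.\<close>

lemma infinite_fixed_points_eigenvectors:
  assumes h: "h \<in> carrier SU21" "h [^]\<^bsub>SU21\<^esub> p = mat 1" and p: "0 < (p::nat)"
    and inf: "infinite {z \<in> CH2. CH2_act h z = z}"
  obtains l z w where "l ^ p = 1" "z \<in> CH2" "h *v CH2_lift z = l *s CH2_lift z"
    "h *v CH2_lift w = l *s CH2_lift w" "cross (CH2_lift z) (CH2_lift w) \<noteq> 0"
proof -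
  let ?F = "{z \<in> CH2. CH2_act h z = z}"
  have ex: "\<exists>l. h *v CH2_lift z = l *s CH2_lift z" if "z \<in> ?F" for z
    using that fixed_point_eigenvector[OF h(1), of z] by blast
  define L where "L z = (SOME l. h *v CH2_lift z = l *s CH2_lift z)" for z
  have L: "h *v CH2_lift z = L z *s CH2_lift z" if "z \<in> ?F" for z
    unfolding L_def by (rule someI_ex[OF ex[OF that]])
  have Lp: "L z ^ p = 1" if "z \<in> ?F" for z
    using eigenvalue_root_of_unity[OF L[OF that] h(2)] .
  have "finite {l::complex. l ^ p = 1}" using p by (intro finite_roots_unity) simp
  then have "finite (L ` ?F)" using Lp by (rule_tac finite_subset) auto
  then have "\<not> inj_on L ?F" using inf finite_imageD by blast
  then obtain z w where zw: "z \<in> ?F" "w \<in> ?F" "z \<noteq> w" "L z = L w" unfolding inj_on_def by blast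
  have "cross (CH2_lift z) (CH2_lift w) \<noteq> 0"
  proof
    assume "cross (CH2_lift z) (CH2_lift w) = 0"
    then have "z$1 = w$1" "z$2 = w$2"
      by (simp_all add: cross_def CH2_lift_def vec_eq_iff forall_3)
    with zw(3) show False by (simp add: vec_eq_iff forall_2)
  qed
  moreover have "h *v CH2_lift w = L z *s CH2_lift w" using L[OF zw(2)] zw(4) by simp
  moreover have "z \<in> CH2" using zw(1) by simp
  ultimately show thesis using that L[OF zw(1)] Lp[OF zw(1)] by blast
qed

lemma infinite_fixed_points_double_eigenvalue:
  assumes h: "h \<in> carrier SU21" "h [^]\<^bsub>SU21\<^esub> p = mat 1" and p: "0 < (p::nat)"
    and inf: "infinite {z \<in> CH2. CH2_act h z = z}"
  obtains l m where "l ^ p = 1" "m ^ p = 1" "(h - mat l) ** (h - mat m) = 0"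
proof -
  obtain l z w where l: "l ^ p = 1" "h *v CH2_lift z = l *s CH2_lift z"
    "h *v CH2_lift w = l *s CH2_lift w" "cross (CH2_lift z) (CH2_lift w) \<noteq> 0"
    using infinite_fixed_points_eigenvectors[OF assms] by metis
  have "det h = 1" using h by (simp add: SU21_iff)
  then obtain m where m: "l\<^sup>2 * m = 1" "(h - mat l) ** (h - mat m) = 0"
    using double_eigenvalue[OF l(2-4)] by blast
  have "(l ^ p)\<^sup>2 * m ^ p = 1"
    using m(1) by (metis power_commutes power_mult power_mult_distrib power_one mult.commute)
  then have "m ^ p = 1" using l(1) by simp
  with l(1) m(2) show thesis using that by blast
qed

text \<open>For \<open>w^n = 1\<close> and \<open>w \<noteq> 1\<close> the right side is
  \<open>-n\<close>, so \<open>1 - w\<close> divides \<open>n\<close> with an explicit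
  cofactor.\<close>

lemma arith_geom_sum:
  "(1 - w) * (\<Sum>j<n. of_nat j * w ^ j) = (\<Sum>j<n. w ^ j) - of_nat n * w ^ n + w ^ n - (1 :: complex)"
  by (induction n) (simp_all add: algebra_simps)

lemma root_of_unity_power: "(z::complex) ^ p = 1 \<Longrightarrow> (z ^ k) ^ p = 1"
  by (metis mult.commute power_mult power_one)

lemma root_power_ne_1:
  fixes z :: complex
  assumes p: "prime p" and z: "z ^ p = 1" "z \<noteq> 1" and k: "0 < k" "k < p"
  shows "z ^ k \<noteq> 1"
proof
  assume zk: "z ^ k = 1"
  have "coprime k p" using p k by (metis coprime_commute nat_dvd_not_less prime_imp_coprime)
  then obtain u v where "k * u = 1 + p * v"
    using coprime_bezout_strong[of k p] p prime_gt_1_nat[OF p] k by (metis add.commute nat_neq_iff)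
  then have "z ^ (k * u) = z ^ (1 + p * v)" by simp
  then have "(z ^ k) ^ u = z * (z ^ p) ^ v" by (simp only: power_add power_mult power_one_right)
  then show False using zk z by simp
qed

text \<open>The first \<open>p\<close> powers of \<open>z\<close> are distinct, and there are at
  most \<open>p\<close> roots of unity of this order. In particular an order containing
  \<open>z\<close> contains all of them.\<close>

lemma primitive_root_powers:
  fixes z :: complex
  assumes p: "prime p" and z: "z ^ p = 1" "z \<noteq> 1" and l: "l ^ p = 1"
  obtains i where "i < p" "l = z ^ i"
proof -
  have p0: "0 < p" using p prime_gt_0_nat by blast
  have "z ^ k \<noteq> 1" if "0 < k" "k < p" for k
    by (rule root_power_ne_1[OF p z that])
  then have "inj_on (\<lambda>i. z ^ i) {..<p}"
  proof -
    assume *: "\<And>k. 0 < k \<Longrightarrow> k < p \<Longrightarrow> z ^ k \<noteq> 1"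
    have z0: "z \<noteq> 0" using z p0 by (auto simp: zero_power)
    show ?thesis
    proof (rule linorder_inj_onI)
      fix i j assume ij: "i < j" "i \<in> {..<p}" "j \<in> {..<p}"
      have "z ^ j = z ^ i * z ^ (j - i)" using ij by (simp flip: power_add)
      then show "z ^ i \<noteq> z ^ j" using *[of "j - i"] ij z0 by auto
    qed auto
  qed
  then have "card ((\<lambda>i. z ^ i) ` {..<p}) = p" by (simp add: card_image)
  moreover have "(\<lambda>i. z ^ i) ` {..<p} \<subseteq> {l. l ^ p = 1}"
    using z root_of_unity_power by auto
  moreover have "card {l::complex. l ^ p = 1} \<le> p" "finite {l::complex. l ^ p = 1}"
    using p0 by (auto intro: card_roots_unity finite_roots_unity)
  ultimately have "(\<lambda>i. z ^ i) ` {..<p} = {l. l ^ p = 1}"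
    by (metis card_seteq)
  then show thesis using l that by blast
qed

context cm_order
begin

lemma four_not_unit: "y \<in> R \<Longrightarrow> 4 * y \<noteq> 1"
proof
  assume y: "y \<in> R" "4 * y = 1"
  have "(1::complex) = 0"
  proof (rule infinitely_divisible)
    fix j :: nat
    have "(1::complex) = (4 * y) ^ j" using y by simp
    also have "4 * y = 2 * (2 * y)" by simp
    also have "(2 * (2 * y)) ^ j = 2 ^ j * (2 ^ j * y ^ j)" by (simp only: power_mult_distrib)
    finally show "\<exists>y\<in>R. 1 = 2 ^ j * y" using y by blast
  qed simp
  then show False by simp
qed

lemma cj_diag3: "cj (diag3 x y z) = diag3 x y z"
  by (simp add: vec_eq_iff forall_3 cj_entry diag3_def)

lemma one_minus_root_dvd:
  assumes p: "0 < p" and w: "w \<in> R" "w ^ p = 1" "w \<noteq> 1"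
  obtains s where "s \<in> R" "(1 - w) * s = of_nat p"
proof -
  have "(\<Sum>j<p. w ^ j) = 0" using w sum_gp_strict[of w p] by simp
  then have "(1 - w) * (- (\<Sum>j<p. of_nat j * w ^ j)) = of_nat p"
    using arith_geom_sum[of w p] w by simp
  moreover have "- (\<Sum>j<p. of_nat j * w ^ j) \<in> R" using w by (intro R_minus R_sum) auto
  ultimately show thesis using that by blast
qed

text \<open>Up to units, \<open>x - l\<close> and \<open>x - m\<close> have the form
  \<open>1 - w\<close> with \<open>w\<close> a nontrivial \<open>p\<close>-th root of unity, so each
  divides \<open>p\<close>. If 4 divided their product it would divide \<open>p^2\<close>, which is
  1 modulo 4.\<close>

lemma root_differences_mod_4:
  assumes p: "odd p" and roots: "x ^ p = 1" "l ^ p = 1" "m ^ p = 1" "x \<in> R" "l \<in> R" "m \<in> R"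
    and ne: "x \<noteq> l" "x \<noteq> m" and r: "r \<in> R" "(x - l) * (x - m) = 4 * r"
  shows False
proof -
  have p0: "0 < p" using p by (cases p) auto
  define y where "y = x ^ (p - 1)"
  have y: "y \<in> R" "y * x = 1" "y ^ p = 1"
  proof -
    show "y \<in> R" using roots by (simp add: y_def)
    show "y * x = 1" using roots p0 by (simp add: y_def flip: power_Suc2)
    have "y ^ p * x ^ p = 1" using \<open>y * x = 1\<close> by (simp flip: power_mult_distrib)
    then show "y ^ p = 1" using roots by simp
  qed
  have unit: "1 - y * t = y * (x - t)" for t using y(2) by (simp add: algebra_simps)
  have y0: "y \<noteq> 0" using y(2) by auto
  have y1: "y * l \<noteq> 1" "y * m \<noteq> 1" using unit[of l] unit[of m] ne y0 by auto
  obtain s1 where s1: "s1 \<in> R" "(1 - y * l) * s1 = of_nat p"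
    using one_minus_root_dvd[OF p0, of "y * l"] y roots y1 by (auto simp: power_mult_distrib)
  obtain s2 where s2: "s2 \<in> R" "(1 - y * m) * s2 = of_nat p"
    using one_minus_root_dvd[OF p0, of "y * m"] y roots y1 by (auto simp: power_mult_distrib)
  have "of_nat p * of_nat p = (y * (x - l) * s1) * (y * (x - m) * s2)"
    using s1 s2 by (simp add: unit)
  also have "\<dots> = ((x - l) * (x - m)) * (y * y * s1 * s2)" by (simp add: algebra_simps)
  also have "\<dots> = 4 * (r * (y * y * s1 * s2))" using r by simp
  finally have pp: "of_nat p * of_nat p = 4 * (r * (y * y * s1 * s2))" .
  obtain q where q: "p = 2 * q + 1" using p by (blast elim: oddE)
  have "of_nat p * of_nat p = 4 * (of_nat (q * q + q) :: complex) + 1"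
    by (simp add: q algebra_simps)
  then have "4 * (r * (y * y * s1 * s2) - of_nat (q * q + q)) = 1"
    using pp by (simp add: algebra_simps)
  moreover have "r * (y * y * s1 * s2) - of_nat (q * q + q) \<in> R"
    using r y s1 s2 by (intro R_intros R_of_nat)
  ultimately show False using four_not_unit by blast
qed

text \<open>A bad \<open>h\<close> in the coset of \<open>g^k\<close> satisfies
  \<open>(h - l) (h - m) = 0\<close>. Modulo 4, \<open>cj h\<close> is the diagonal matrix
  \<open>g^k\<close>, so \<open>(x - l) (x - m)\<close> is divisible by 4 for each of its entries
  \<open>x\<close>. The entries \<open>z^k\<close>, \<open>z^-k\<close>, 1 are distinct for odd
  \<open>p\<close>, so one differs from both \<open>l\<close> and \<open>m\<close>.\<close>

theorem odd_prime_action: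
  assumes p: "prime p" "odd p" and z: "z \<in> R" "z ^ p = 1" "z \<noteq> 1"
  shows "isolated_cyclic_action p"
proof -
  interpret uniform_lattice G \<Gamma> by (rule uniform_lattice)
  have p0: "0 < p" using p prime_gt_0_nat by blast
  have nz: "cmod z = 1" using z(2) p0 by (metis norm_one norm_power power_eq_1_iff norm_ge_zero neq0_conv)
  have zz: "z * cnj z = 1" using nz complex_norm_square[of z] by simp
  define g where "g = diag3 z (cnj z) 1"
  have cp: "cnj z ^ p = 1" using z(2) by (metis complex_cnj_one complex_cnj_power)
  have gS: "g \<in> carrier SU21" unfolding g_def using nz zz by (intro diag3_SU21) auto
  have "cj g = g" by (simp only: g_def cj_diag3)
  moreover have "Rmat g" using z(1) by (simp add: g_def Rmat_def diag3_def)
  ultimately have "Rmat (cj g)" by simp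
  with gS have g: "g \<in> G" unfolding G_def by blast
  have gp: "g [^]\<^bsub>SU21\<^esub> p = mat 1" by (simp add: g_def diag3_power z cp diag3_one)
  have root_R: "l \<in> R" if "l ^ p = 1" for l
    using primitive_root_powers[OF p(1) z(2,3) that] z(1) by (metis R_power)
  show ?thesis
  proof (rule cyclic_action[OF p(1) g gp])
    show "CH2_act g 0 = 0" by (simp add: g_def diag3_fixes_zero)
    fix k A assume k: "0 < k" "k < p" and A: "A \<in> \<Gamma>" and hp: "(A ** g [^]\<^bsub>SU21\<^esub> k) [^]\<^bsub>SU21\<^esub> p = mat 1"
    define h where "h = A ** g [^]\<^bsub>SU21\<^esub> k"
    have h: "h \<in> carrier SU21" using A gS by (simp add: h_def)
    show "finite {z \<in> CH2. CH2_act (A ** g [^]\<^bsub>SU21\<^esub> k) z = z}"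
    proof (rule ccontr)
      assume "infinite {z \<in> CH2. CH2_act (A ** g [^]\<^bsub>SU21\<^esub> k) z = z}"
      then obtain l m where lm: "l ^ p = 1" "m ^ p = 1" "(h - mat l) ** (h - mat m) = 0"
        using infinite_fixed_points_double_eigenvalue[OF h _ p0] hp unfolding h_def by blast
      have "cong4 (cj A)" using A unfolding \<Gamma>_def by blast
      then obtain X where X: "Rmat X" "cj A = mat 1 + 4 *\<^sub>R X" unfolding cong4_def by blast
      let ?g = "diag3 (z ^ k) (cnj z ^ k) 1"
      define Y where "Y = X ** ?g"
      have gk: "g [^]\<^bsub>SU21\<^esub> k = ?g" by (simp add: g_def diag3_power)
      have Rg: "Rmat ?g" using z by (simp add: Rmat_def diag3_def)
      have Y: "Rmat Y" unfolding Y_def by (intro Rmat_closed X Rg)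
      have cjh: "cj h = ?g + 4 *\<^sub>R Y"
        by (simp add: h_def cj_mult gk cj_diag3 X Y_def matrix_add_rdistrib matrix_scaleR_left)
      have cj_sub: "cj (h - mat t) = cj h - mat t" for t
        by (simp add: vec_eq_iff cj_entry mat_def diff_divide_distrib left_diff_distrib)
      have "cj ((h - mat l) ** (h - mat m)) = 0" using lm(3) by (simp add: cj_def)
      then have zero: "(cj h - mat l) ** (cj h - mat m) = 0" by (simp add: cj_mult cj_sub)
      have R: "l \<in> R" "m \<in> R" using lm root_R by auto
      have dvd: "\<exists>r\<in>R. (?g$i$i - l) * (?g$i$i - m) = 4 * r" for i
      proof -
        let ?P = "?g - mat l" and ?Q = "?g - mat m"
        have PQ: "Rmat ?P" "Rmat ?Q" using Rg R by (auto simp: Rmat_def mat_def)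
        define N where "N = Y ** ?Q + ?P ** Y + 4 *\<^sub>R (Y ** Y)"
        have "Rmat N" unfolding N_def by (intro Rmat_closed Rmat_scale_numeral Y PQ)
        have "(?P + 4 *\<^sub>R Y) ** (?Q + 4 *\<^sub>R Y) = ?P ** ?Q + 4 *\<^sub>R N"
          by (simp add: N_def matrix_add_ldistrib matrix_add_rdistrib matrix_scaleR_left matrix_scaleR_right scaleR_add_right)
        moreover have "?P + 4 *\<^sub>R Y = cj h - mat l" "?Q + 4 *\<^sub>R Y = cj h - mat m" by (simp_all add: cjh)
        ultimately have "?P ** ?Q = - (4 *\<^sub>R N)" using zero by (simp add: eq_neg_iff_add_eq_0)
        then have "(?P ** ?Q)$i$i = (- (4 *\<^sub>R N))$i$i" by simp
        also have "(- (4 *\<^sub>R N))$i$i = 4 * (- (N$i$i))"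
          unfolding vector_uminus_component vector_scaleR_component by (simp add: scaleR_conv_of_real)
        also have "(?P ** ?Q)$i$i = (?g$i$i - l) * (?g$i$i - m)"
          using exhaust_3[of i] by (auto simp: matrix_matrix_mult_def sum_3 diag3_def mat_def)
        finally show ?thesis using \<open>Rmat N\<close> by (intro bexI[of _ "- (N$i$i)"]) (auto simp: Rmat_def)
      qed
      have zpow: "z ^ k \<noteq> 1" by (rule root_power_ne_1[OF p(1) z(2,3) k])
      have inv: "z ^ k * cnj z ^ k = 1" using zz by (simp flip: power_mult_distrib)
      have zkp: "(z ^ k) ^ p = 1" "(cnj z ^ k) ^ p = 1"
        using z(2) cp by (simp_all add: root_of_unity_power)
      have c1: "cnj z ^ k \<noteq> 1" using zpow inv by auto
      have c2: "z ^ k \<noteq> cnj z ^ k"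
      proof
        assume "z ^ k = cnj z ^ k"
        then have sq: "(z ^ k)\<^sup>2 = 1" using inv by (simp add: power2_eq_square)
        obtain q where "p = 2 * q + 1" using p(2) by (blast elim: oddE)
        then have "(z ^ k) ^ p = ((z ^ k)\<^sup>2) ^ q * z ^ k" by (simp only: power_add power_mult power_one_right)
        then show False using zkp sq zpow by simp
      qed
      have gi: "(?g$i$i) ^ p = 1" "?g$i$i \<in> R" for i
        using zkp z by (auto simp: diag3_def)
      have "\<exists>i. ?g$i$i \<noteq> l \<and> ?g$i$i \<noteq> m"
      proof (rule ccontr)
        assume "\<not> ?thesis"
        then have "?g$1$1 \<in> {l, m}" "?g$2$2 \<in> {l, m}" "?g$3$3 \<in> {l, m}" by blast+
        then show False using c1 c2 zpow by (auto simp: diag3_def)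
      qed
      then obtain i where i: "?g$i$i \<noteq> l" "?g$i$i \<noteq> m" by blast
      obtain r where r: "r \<in> R" "(?g$i$i - l) * (?g$i$i - m) = 4 * r" using dvd by blast
      show False
        by (rule root_differences_mod_4[OF p(2) gi(1) lm(1,2) gi(2) R i r])
    qed
  qed
qed

end

section \<open>Cyclotomic integers\<close>

definition ieval :: "int poly \<Rightarrow> complex \<Rightarrow> complex" where
  "ieval f x = poly (map_poly of_int f) x"

lemma ieval_simps [simp]:
  "ieval 0 x = 0" "ieval (pCons c f) x = of_int c + x * ieval f x" "ieval 1 x = 1"
  "ieval (f + g) x = ieval f x + ieval g x" "ieval (f - g) x = ieval f x - ieval g x"
  "ieval (- f) x = - ieval f x"
  "ieval (f * g) x = ieval f x * ieval g x" "ieval (smult c f) x = of_int c * ieval f x"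
proof -
  have add: "map_poly complex_of_int (f + g) = map_poly of_int f + map_poly of_int g"
    and diff: "map_poly complex_of_int (f - g) = map_poly of_int f - map_poly of_int g"
    and uminus: "map_poly complex_of_int (- f) = - map_poly of_int f"
    and mult: "map_poly complex_of_int (f * g) = map_poly of_int f * map_poly of_int g"
    and smult: "map_poly complex_of_int (smult c f) = smult (of_int c) (map_poly of_int f)"
    by (simp_all add: poly_eq_iff coeff_map_poly coeff_mult)
  show "ieval 0 x = 0" "ieval (pCons c f) x = of_int c + x * ieval f x" "ieval 1 x = 1"
    by (simp_all add: ieval_def map_poly_pCons)
  show "ieval (f + g) x = ieval f x + ieval g x" "ieval (f - g) x = ieval f x - ieval g x"
    "ieval (- f) x = - ieval f x"
    "ieval (f * g) x = ieval f x * ieval g x" "ieval (smult c f) x = of_int c * ieval f x"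
    by (simp_all add: ieval_def add diff uminus mult smult)
qed

lemma ieval_sum: "ieval (sum f A) x = (\<Sum>i\<in>A. ieval (f i) x)"
  by (induction A rule: infinite_finite_induct) auto

lemma ieval_monom [simp]: "ieval (monom c i) x = of_int c * x ^ i"
  by (simp add: ieval_def map_poly_monom poly_monom)

lemma ieval_cnj: "cnj (ieval f x) = ieval f (cnj x)"
  by (induction f) auto

lemma ieval_altdef:
  assumes "\<And>i. m \<le> i \<Longrightarrow> coeff f i = 0"
  shows "ieval f x = (\<Sum>i<m. of_int (coeff f i) * x ^ i)"
proof -
  have "f = (\<Sum>i<m. monom (coeff f i) i)"
    using assms by (auto simp: poly_eq_iff coeff_sum not_less)
  then show ?thesis
    by (metis (no_types, lifting) ieval_monom ieval_sum sum.cong)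
qed

text \<open>Nakayama's lemma for a finitely generated group \<open>V\<close> of complex numbers with
  \<open>V = q V\<close>: an integer congruent to 1 modulo \<open>q\<close> kills it. The last
  generator is eliminated after multiplication by \<open>1 - q s\<close>.\<close>

lemma nakayama:
  fixes v :: "nat \<Rightarrow> complex" and q :: int
  assumes "\<And>i. i < m \<Longrightarrow> \<exists>c :: nat \<Rightarrow> int. v i = of_int q * (\<Sum>j<m. of_int (c j) * v j)"
  shows "\<exists>e. \<forall>i<m. of_int (1 + q * e) * v i = 0"
  using assms
proof (induction m)
  case (Suc m)
  obtain c where c: "\<And>i. i < Suc m \<Longrightarrow> v i = of_int q * (\<Sum>j<Suc m. of_int (c i j) * v j)"
    using Suc.prems by metis
  define s where "s = c m m"
  have last: "of_int (1 - q * s) * v m = of_int q * (\<Sum>j<m. of_int (c m j) * v j)"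
    using c[of m] by (simp add: s_def algebra_simps)
  have "\<exists>b :: nat \<Rightarrow> int. v i = of_int q * (\<Sum>j<m. of_int (b j) * v j)" if i: "i < m" for i
  proof -
    define T where "T b = (\<Sum>j<m. of_int (b j) * v j)" for b :: "nat \<Rightarrow> int"
    have vi: "v i = of_int q * (T (c i) + of_int (c i m) * v m)"
      using c[of i] i by (simp add: T_def)
    have vi': "v i = T (\<lambda>j. if j = i then 1 else 0)"
      using i by (simp add: T_def if_distrib[of of_int] if_distrib[of "\<lambda>x. x * _"] cong: if_cong)
    \<comment> \<open>This splitting avoids a division by \<open>1 - q s\<close>: in the first
      summand \<open>last\<close> replaces \<open>v m\<close>, and the second is a multiple of
      \<open>q\<close> already.\<close>
    have "v i = of_int (1 - q * s) * v i + of_int q * of_int s * v i"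
      by (simp add: algebra_simps)
    also have "of_int (1 - q * s) * v i =
        of_int q * (of_int (1 - q * s) * T (c i) + of_int (c i m) * (of_int (1 - q * s) * v m))"
      by (subst vi) (simp add: algebra_simps)
    also have "\<dots> = of_int q * (of_int (1 - q * s) * T (c i) + of_int (c i m) * (of_int q * T (c m)))"
      using last by (simp add: T_def)
    also have "of_int q * of_int s * v i = of_int q * (of_int s * T (\<lambda>j. if j = i then 1 else 0))"
      using vi' by simp
    also have "of_int q * (of_int (1 - q * s) * T (c i) + of_int (c i m) * (of_int q * T (c m)))
        + of_int q * (of_int s * T (\<lambda>j. if j = i then 1 else 0))
      = of_int q * T (\<lambda>j. (1 - q * s) * c i j + c i m * q * c m j + s * (if j = i then 1 else 0))"
      by (simp add: T_def sum_distrib_left sum.distrib distrib_left distrib_right mult.assoc)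
    finally show ?thesis
      unfolding T_def
      by (intro exI[of _ "\<lambda>j. (1 - q * s) * c i j + c i m * q * c m j + s * (if j = i then 1 else 0)"])
  qed
  then obtain e where e: "\<And>i. i < m \<Longrightarrow> of_int (1 + q * e) * v i = 0" using Suc.IH by blast
  have "of_int (1 + q * e) * (of_int (1 - q * s) * v m) = 0"
  proof -
    have "of_int (1 + q * e) * (of_int (1 - q * s) * v m) = of_int q * (\<Sum>j<m. of_int (c m j) * (of_int (1 + q * e) * v j))"
      unfolding last by (simp add: sum_distrib_left algebra_simps)
    moreover have "(\<Sum>j<m. of_int (c m j) * (of_int (1 + q * e) * v j)) = 0"
      using e by (intro sum.neutral ballI) (simp only: lessThan_iff mult_zero_right)
    ultimately show ?thesis by (simp only: mult_zero_right)
  qed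
  moreover have "(1 + q * e) * (1 - q * s) = 1 + q * (e - s - q * e * s)" by (simp add: algebra_simps)
  ultimately have vm: "of_int (1 + q * (e - s - q * e * s)) * v m = 0"
    by (metis mult.assoc of_int_mult)
  have "of_int (1 + q * (e - s - q * e * s)) * v i = 0" if "i < m" for i
    using e[OF that] \<open>(1 + q * e) * (1 - q * s) = _\<close>
    by (metis mult.assoc mult.commute mult_zero_right of_int_mult)
  with vm show ?case by (metis less_Suc_eq)
qed simp

section \<open>Ramification at \<open>p\<close> and independence of the powers of a root of
  unity\<close>

locale cyclotomic =
  fixes p :: nat
  assumes p: "prime p" "3 \<le> p"
begin

lemma p0: "0 < p" using p by simp

definition primitive :: "complex \<Rightarrow> bool" where
  "primitive w \<longleftrightarrow> w ^ p = 1 \<and> w \<noteq> 1"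

definition zspan :: "complex \<Rightarrow> complex set" where
  "zspan w = range (\<lambda>f. ieval f w)"

lemma zspan_closed:
  "x \<in> zspan w \<Longrightarrow> y \<in> zspan w \<Longrightarrow> x + y \<in> zspan w" "x \<in> zspan w \<Longrightarrow> y \<in> zspan w \<Longrightarrow> x - y \<in> zspan w"
  "x \<in> zspan w \<Longrightarrow> y \<in> zspan w \<Longrightarrow> x * y \<in> zspan w" "x \<in> zspan w \<Longrightarrow> - x \<in> zspan w"
  "1 \<in> zspan w" "0 \<in> zspan w" "w \<in> zspan w" "of_int c \<in> zspan w" "ieval f w \<in> zspan w"
proof -
  have *: "ieval f w \<in> zspan w" for f by (simp add: zspan_def)
  show "ieval f w \<in> zspan w" by (rule *)
  show "1 \<in> zspan w" "0 \<in> zspan w" "w \<in> zspan w" "of_int c \<in> zspan w"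
    using *[of 1] *[of 0] *[of "[:0, 1:]"] *[of "[:c:]"] by simp_all
  show "x \<in> zspan w \<Longrightarrow> y \<in> zspan w \<Longrightarrow> x + y \<in> zspan w" "x \<in> zspan w \<Longrightarrow> y \<in> zspan w \<Longrightarrow> x - y \<in> zspan w"
    "x \<in> zspan w \<Longrightarrow> y \<in> zspan w \<Longrightarrow> x * y \<in> zspan w" "x \<in> zspan w \<Longrightarrow> - x \<in> zspan w"
    unfolding zspan_def image_iff
    by (metis ieval_simps(4) rangeI image_iff, metis ieval_simps(5) rangeI image_iff,
        metis ieval_simps(7) rangeI image_iff, metis ieval_simps(6) rangeI image_iff)
qed

lemma zspan_power: "x \<in> zspan w \<Longrightarrow> x ^ k \<in> zspan w"
  by (induction k) (auto intro: zspan_closed)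

lemma zspan_of_nat: "of_nat k \<in> zspan w"
  using zspan_closed(8)[of "int k"] by simp

lemma zspan_sum: "(\<And>i. i \<in> A \<Longrightarrow> f i \<in> zspan w) \<Longrightarrow> sum f A \<in> zspan w"
  by (induction A rule: infinite_finite_induct) (auto intro: zspan_closed)

lemma root_sum: "primitive w \<Longrightarrow> (\<Sum>i<p. w ^ i) = 0"
  using sum_gp_strict[of w p] by (simp add: primitive_def)

text \<open>Division by \<open>1 + x + ... + x^(p-1)\<close>. One remainder serves all nontrivial
  roots at once, which is needed to pass from one root to another.\<close>

lemma reduce: "\<exists>r. (\<forall>i\<ge>p-1. coeff r i = 0) \<and> (\<forall>x. primitive x \<longrightarrow> ieval f x = ieval r x)"
proof (induction f)
  case 0
  show ?case by (intro exI[of _ 0]) simp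
next
  case (pCons c f)
  then obtain r where r: "\<And>i. p-1 \<le> i \<Longrightarrow> coeff r i = 0" "\<And>x. primitive x \<Longrightarrow> ieval f x = ieval r x" by blast
  define \<Phi> :: "int poly" where "\<Phi> = (\<Sum>i<p. monom 1 i)"
  have \<Phi>: "ieval \<Phi> x = 0" if "primitive x" for x
    using root_sum[OF that] by (simp add: \<Phi>_def ieval_sum)
  have c\<Phi>: "coeff \<Phi> i = (if i < p then 1 else 0)" for i
    by (simp add: \<Phi>_def coeff_sum)
  define r' where "r' = pCons c r - smult (coeff r (p - 2)) \<Phi>"
  have "coeff r' i = 0" if i: "p - 1 \<le> i" for i
  proof (cases "i = p - 1")
    case True
    then obtain j where "i = Suc j" "j = p - 2" using p by (cases i) auto
    then show ?thesis using p by (simp add: r'_def c\<Phi>)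
  next
    case False
    then obtain j where "i = Suc j" "p - 1 \<le> j" "p \<le> i" using i by (cases i) auto
    then show ?thesis using r(1) by (simp add: r'_def c\<Phi>)
  qed
  moreover have "ieval (pCons c f) x = ieval r' x" if "primitive x" for x
    using r(2) \<Phi> that by (simp add: r'_def)
  ultimately show ?case by blast
qed

lemma zspan_basis:
  assumes "primitive w" "x \<in> zspan w"
  obtains c :: "nat \<Rightarrow> int" where "x = (\<Sum>i<p-1. of_int (c i) * w ^ i)"
proof -
  obtain f where f: "x = ieval f w" using assms(2) by (auto simp: zspan_def)
  obtain r where r: "\<And>i. p-1 \<le> i \<Longrightarrow> coeff r i = 0" "\<And>x. primitive x \<Longrightarrow> ieval f x = ieval r x"
    using reduce[of f] by blast
  show thesis using that[of "coeff r"] ieval_altdef[OF r(1)] r(2)[OF assms(1)] f by simp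
qed

text \<open>If \<open>p\<close> were a unit of the ring, multiplication by \<open>p\<close> would be
  onto, and \<open>nakayama\<close> would yield an integer congruent to 1 modulo \<open>p\<close>
  that kills 1.\<close>

lemma inverse_p_notin_span:
  assumes w: "primitive w" and s: "s \<in> zspan w"
  shows "of_nat p * s \<noteq> 1"
proof
  assume one: "of_nat p * s = 1"
  have "\<exists>c :: nat \<Rightarrow> int. w ^ i = of_int (int p) * (\<Sum>j<p-1. of_int (c j) * w ^ j)" for i
  proof -
    have "s * w ^ i \<in> zspan w" by (intro zspan_closed(3) zspan_power s zspan_closed(7))
    then obtain c :: "nat \<Rightarrow> int" where "s * w ^ i = (\<Sum>j<p-1. of_int (c j) * w ^ j)"
      by (rule zspan_basis[OF w])
    moreover have "w ^ i = of_int (int p) * (s * w ^ i)" using one by (simp flip: mult.assoc)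
    ultimately show ?thesis by metis
  qed
  then obtain e where "\<forall>i<p-1. of_int (1 + int p * e) * w ^ i = 0"
    using nakayama[of "p-1" "\<lambda>i. w ^ i" "int p"] by blast
  then have "of_int (1 + int p * e) * w ^ 0 = 0" by (rule allE[of _ 0]) (use p in linarith)
  then have "(of_int (1 + int p * e) :: complex) = 0" by simp
  then have "1 + int p * e = 0" unfolding of_int_eq_0_iff .
  then have "int p dvd 1" by (metis add.commute add.inverse_unique dvd_minus_iff dvd_triv_left)
  then show False using p by simp
qed

text \<open>Expand \<open>((w - 1) + 1)^p = 1\<close> and divide by \<open>w - 1\<close>: the middle
  binomial coefficients are divisible by \<open>p\<close>. So \<open>p\<close> is
  \<open>(w - 1)^(p-1)\<close> up to a unit of the localization at \<open>w - 1\<close>.\<close>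

lemma ramified:
  assumes w: "primitive w"
  obtains t where "t \<in> zspan w" "(w - 1) ^ (p - 1) = - of_nat p * (1 + (w - 1) * t)"
proof -
  define Y where "Y = w - 1"
  have Y0: "Y \<noteq> 0" using w by (simp add: Y_def primitive_def)
  have YS: "Y \<in> zspan w" unfolding Y_def by (intro zspan_closed)
  define t where "t = (\<Sum>i\<in>{2..<p}. of_nat ((p choose i) div p) * Y ^ (i - 2))"
  have t: "t \<in> zspan w" unfolding t_def by (intro zspan_sum zspan_closed(3) zspan_of_nat zspan_power YS)
  have "(Y + 1) ^ p = (\<Sum>i\<le>p. of_nat (p choose i) * Y ^ i * 1 ^ (p - i))" by (rule binomial_ring)
  also have "\<dots> = (\<Sum>i\<in>insert 0 (insert 1 (insert p {2..<p})). of_nat (p choose i) * Y ^ i)"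
    using p by (intro sum.cong) auto
  also have "\<dots> = 1 + (of_nat p * Y + (Y ^ p + (\<Sum>i\<in>{2..<p}. of_nat (p choose i) * Y ^ i)))"
    using p by simp
  also have "(\<Sum>i\<in>{2..<p}. of_nat (p choose i) * Y ^ i) = of_nat p * Y * (Y * t)"
    unfolding t_def sum_distrib_left
  proof (rule sum.cong)
    fix i assume i: "i \<in> {2..<p}"
    then have "p dvd (p choose i)" using p by (intro dvd_choose_prime) auto
    then have "(of_nat (p choose i) :: complex) = of_nat p * of_nat ((p choose i) div p)"
      by (metis dvd_mult_div_cancel of_nat_mult)
    moreover have "Y ^ i = Y * Y * Y ^ (i - 2)"
    proof -
      obtain k where "i = 2 + k" using i le_Suc_ex[of 2 i] by auto
      then show ?thesis by (simp add: power_add power2_eq_square)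
    qed
    ultimately show "of_nat (p choose i) * Y ^ i = of_nat p * Y * (Y * (of_nat ((p choose i) div p) * Y ^ (i - 2)))"
      by simp
  qed simp
  finally have "0 = of_nat p * Y + (Y ^ p + of_nat p * Y * (Y * t))"
    using w by (simp add: Y_def primitive_def)
  also have "Y ^ p = Y * Y ^ (p - 1)" using p0 by (simp flip: power_Suc)
  finally have "Y * (of_nat p * (1 + Y * t) + Y ^ (p - 1)) = 0" by (simp add: algebra_simps)
  then have "Y ^ (p - 1) + of_nat p * (1 + Y * t) = 0" using Y0 by (simp add: add.commute)
  then have "Y ^ (p - 1) = - of_nat p * (1 + Y * t)" unfolding mult_minus_left by (simp only: eq_neg_iff_add_eq_0)
  with t show thesis using that by (simp add: Y_def)
qed

text \<open>The \<open>j\<close>-th power of the prime above \<open>p\<close>, localized at that prime.\<close>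

definition J :: "complex \<Rightarrow> nat \<Rightarrow> complex set" where
  "J w j = {x. \<exists>e\<in>zspan w. \<exists>s\<in>zspan w. (1 + (w - 1) * e) * x = (w - 1) ^ j * s}"

lemma J_I: "e \<in> zspan w \<Longrightarrow> s \<in> zspan w \<Longrightarrow> (1 + (w - 1) * e) * x = (w - 1) ^ j * s \<Longrightarrow> x \<in> J w j"
  by (auto simp: J_def)

lemma J_add:
  assumes "x \<in> J w j" "y \<in> J w j"
  shows "x + y \<in> J w j"
proof -
  let ?Y = "w - 1"
  obtain e s where e: "e \<in> zspan w" "s \<in> zspan w" "(1 + ?Y * e) * x = ?Y ^ j * s" using assms(1) by (auto simp: J_def)
  obtain e' s' where e': "e' \<in> zspan w" "s' \<in> zspan w" "(1 + ?Y * e') * y = ?Y ^ j * s'" using assms(2) by (auto simp: J_def)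
  have "(1 + ?Y * (e + e' + ?Y * e * e')) * (x + y) = (1 + ?Y * e') * ((1 + ?Y * e) * x) + (1 + ?Y * e) * ((1 + ?Y * e') * y)"
    by (simp add: algebra_simps)
  also have "\<dots> = ?Y ^ j * ((1 + ?Y * e') * s + (1 + ?Y * e) * s')"
    unfolding e e' by (simp add: algebra_simps)
  finally show ?thesis
    using e(1,2) e'(1,2) by (rule_tac J_I) (auto intro!: zspan_closed(1-5,7))
qed

lemma J_mult: "x \<in> J w j \<Longrightarrow> r \<in> zspan w \<Longrightarrow> r * x \<in> J w j"
proof -
  assume "x \<in> J w j" and r: "r \<in> zspan w"
  then obtain e s where e: "e \<in> zspan w" "s \<in> zspan w" "(1 + (w - 1) * e) * x = (w - 1) ^ j * s" by (auto simp: J_def)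
  have "(1 + (w - 1) * e) * (r * x) = (w - 1) ^ j * (r * s)" using e(3) by (metis mult.left_commute)
  with e r show ?thesis by (intro J_I[of e w "r * s"] zspan_closed(3))
qed

lemma J_mono: "i \<le> j \<Longrightarrow> x \<in> J w j \<Longrightarrow> x \<in> J w i"
proof -
  assume "i \<le> j" "x \<in> J w j"
  then obtain e s where e: "e \<in> zspan w" "s \<in> zspan w" "(1 + (w - 1) * e) * x = (w - 1) ^ j * s" by (auto simp: J_def)
  have "(w - 1) ^ j = (w - 1) ^ i * (w - 1) ^ (j - i)" using \<open>i \<le> j\<close> by (simp flip: power_add)
  then have "(1 + (w - 1) * e) * x = (w - 1) ^ i * ((w - 1) ^ (j - i) * s)" using e(3) by (simp add: mult.assoc)
  with e show ?thesis
    by (intro J_I[of e w "(w - 1) ^ (j - i) * s"] zspan_closed(2,3,5,7) zspan_power)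
qed

text \<open>Otherwise \<open>w - 1\<close> would be a unit of the ring, and by
  \<open>ramified\<close> so would \<open>p\<close>.\<close>

lemma one_notin_J:
  assumes w: "primitive w"
  shows "1 \<notin> J w 1"
proof
  assume "1 \<in> J w 1"
  then obtain e s where e: "e \<in> zspan w" "s \<in> zspan w" "1 + (w - 1) * e = (w - 1) * s" by (auto simp: J_def)
  define y where "y = s - e"
  have y: "y \<in> zspan w" "(w - 1) * y = 1"
    using e by (auto simp: y_def algebra_simps intro: zspan_closed)
  obtain t where t: "t \<in> zspan w" "(w - 1) ^ (p - 1) = - of_nat p * (1 + (w - 1) * t)"
    using ramified[OF w] .
  have "1 = ((w - 1) * y) ^ (p - 1)" using y by simp
  also have "\<dots> = of_nat p * (- (1 + (w - 1) * t) * y ^ (p - 1))"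
    unfolding power_mult_distrib t(2) by (simp add: algebra_simps)
  finally have "of_nat p * (- (1 + (w - 1) * t) * y ^ (p - 1)) = 1" ..
  moreover have "- (1 + (w - 1) * t) * y ^ (p - 1) \<in> zspan w"
    using t y by (intro zspan_closed zspan_power)
  ultimately show False using inverse_p_notin_span[OF w] by blast
qed

lemma p_in_J: "primitive w \<Longrightarrow> of_nat p \<in> J w (p - 1)"
proof -
  assume "primitive w"
  then obtain t where t: "t \<in> zspan w" "(w - 1) ^ (p - 1) = - of_nat p * (1 + (w - 1) * t)"
    using ramified by blast
  then have "(1 + (w - 1) * t) * of_nat p = (w - 1) ^ (p - 1) * (- 1)" by (simp add: mult.commute)
  then show ?thesis by (rule J_I[OF t(1) zspan_closed(4)[OF zspan_closed(5)]])
qed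

text \<open>Write \<open>f = (x - 1) g + b\<close>. Modulo \<open>w - 1\<close> only
  \<open>b\<close> survives, so \<open>p\<close> divides the integer \<open>b\<close>. As
  \<open>p\<close> lies in \<open>J w (p - 1)\<close>, \<open>b\<close> may be dropped without harm,
  and dividing by \<open>w - 1\<close> passes to \<open>g\<close> and \<open>j - 1\<close>.\<close>

lemma p_dvd_coeffs:
  assumes w: "primitive w"
  shows "degree f < j \<Longrightarrow> j \<le> p - 1 \<Longrightarrow> ieval f w \<in> J w j \<Longrightarrow> int p dvd coeff f i"
proof (induction j arbitrary: f i)
  case (Suc j)
  define b where "b = poly f 1"
  define g where "g = synthetic_div f 1"
  have f: "f = [:-1, 1:] * g + [:b:]"
    using synthetic_div_correct'[of 1 f] by (simp add: b_def g_def)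
  then have ev: "ieval f w = (w - 1) * ieval g w + of_int b"
  proof -
    have "ieval f w = ieval [:-1, 1:] w * ieval g w + ieval [:b:] w"
      by (subst f) (simp only: ieval_simps(4,7))
    then show ?thesis by simp
  qed
  have Yg: "(w - 1) * ieval g w \<in> J w 1"
    by (rule J_I[OF zspan_closed(6) zspan_closed(9)[of g]]) simp
  have "- 1 * ((w - 1) * ieval g w) \<in> J w 1" by (rule J_mult[OF Yg]) (intro zspan_closed)
  moreover have "ieval f w \<in> J w 1" using J_mono[of 1 "Suc j"] Suc.prems by simp
  ultimately have "ieval f w + - 1 * ((w - 1) * ieval g w) \<in> J w 1" by (rule J_add[rotated])
  then have b1: "of_int b \<in> J w 1" using ev by simp
  have pb: "int p dvd b"
  proof (rule ccontr)
    assume "\<not> int p dvd b"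
    then have "coprime (int p) b" using p by (intro prime_imp_coprime) auto
    then obtain u v where "u * int p + v * b = 1"
      using bezout_int[of "int p" b] by (metis coprime_imp_gcd_eq_1)
    then have "of_int u * of_nat p + of_int v * of_int b = (1 :: complex)"
      by (metis of_int_1 of_int_add of_int_mult of_int_of_nat_eq)
    moreover have "of_nat p \<in> J w 1"
      using J_mono[of 1 "p-1"] p_in_J[OF w] p by simp
    then have "of_int u * of_nat p + of_int v * of_int b \<in> J w 1"
      using b1 by (intro J_add J_mult zspan_closed)
    ultimately show False using one_notin_J[OF w] by simp
  qed
  then obtain c where c: "b = int p * c" by blast
  have "of_int c * of_nat p \<in> J w (p - 1)" by (intro J_mult p_in_J w zspan_closed)
  then have "of_int b \<in> J w (Suc j)" using J_mono[of "Suc j" "p-1"] Suc.prems by (simp add: c mult.commute)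
  then have "- 1 * of_int b \<in> J w (Suc j)" by (rule J_mult) (intro zspan_closed)
  with Suc.prems have "ieval f w + - 1 * of_int b \<in> J w (Suc j)" by (intro J_add) auto
  then have "(w - 1) * ieval g w \<in> J w (Suc j)" using ev by simp
  then have gj: "ieval g w \<in> J w j"
    using w by (auto simp: J_def primitive_def)
  have "int p dvd coeff g i" for i
  proof (cases "degree f = 0")
    case True
    then have "g = 0" by (simp add: g_def synthetic_div_eq_0_iff)
    then show ?thesis by simp
  next
    case False
    then have "degree g < j" using Suc.prems by (simp add: g_def degree_synthetic_div)
    then show ?thesis using Suc.IH[OF _ _ gj] Suc.prems by simp
  qed
  then have "int p dvd coeff ([:-1, 1:] * g) i" by (cases i) auto
  then show ?case using pb unfolding f by (cases i) auto
qed simp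

text \<open>Irreducibility of the cyclotomic polynomial in disguise. The value 0 lies in
  \<open>J w (p - 1)\<close>, so all coefficients of a relation are divisible by \<open>p\<close>;
  dividing them by \<open>p\<close> gives a relation again, and the descent never ends.\<close>

lemma independent:
  assumes w: "primitive w" and f: "\<And>i. p - 1 \<le> i \<Longrightarrow> coeff f i = 0" "ieval f w = 0"
  shows "f = 0"
proof -
  have main: "\<exists>g. f = smult (int p ^ k) g \<and> (\<forall>i\<ge>p-1. coeff g i = 0) \<and> ieval g w = 0" for k
  proof (induction k)
    case 0
    then show ?case using f by auto
  next
    case (Suc k)
    then obtain g where g: "f = smult (int p ^ k) g" "\<And>i. p - 1 \<le> i \<Longrightarrow> coeff g i = 0" "ieval g w = 0" by blast
    have "degree g < p - 1"
    proof (cases "g = 0")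
      case False
      then have "coeff g (degree g) \<noteq> 0" by simp
      then show ?thesis using g(2) not_le by blast
    qed (use p in simp)
    moreover have "(0::complex) \<in> J w (p - 1)"
      by (rule J_I[OF zspan_closed(6) zspan_closed(6)]) simp
    ultimately have dvd: "int p dvd coeff g i" for i
      using p_dvd_coeffs[OF w, of g "p-1" i] g(3) by simp
    define h where "h = map_poly (\<lambda>c. c div int p) g"
    have gh: "g = smult (int p) h"
      using dvd by (simp add: poly_eq_iff h_def coeff_map_poly)
    then have "f = smult (int p ^ Suc k) h" using g(1) by (simp add: mult.commute)
    moreover have "\<forall>i\<ge>p-1. coeff h i = 0" using g(2) by (simp add: h_def coeff_map_poly)
    moreover have "ieval h w = 0" using g(3) gh p0 by simp
    ultimately show ?case by blast
  qed
  show ?thesis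
  proof (rule ccontr)
    assume "f \<noteq> 0"
    then have nz: "coeff f (degree f) \<noteq> 0" by simp
    define c where "c = coeff f (degree f)"
    obtain g where "f = smult (int p ^ nat \<bar>c\<bar>) g" using main by blast
    then have "int p ^ nat \<bar>c\<bar> dvd c" unfolding c_def by (metis coeff_smult dvd_triv_left)
    then have "\<bar>int p ^ nat \<bar>c\<bar>\<bar> \<le> \<bar>c\<bar>" using nz by (intro dvd_imp_le_int) (simp add: c_def)
    then have "int p ^ nat \<bar>c\<bar> \<le> \<bar>c\<bar>" by simp
    moreover have "nat \<bar>c\<bar> < p ^ nat \<bar>c\<bar>" using p by (intro less_exp[THEN order.strict_trans2] power_mono) auto
    ultimately show False by (metis int_nat_eq linorder_not_le abs_ge_zero of_nat_less_iff of_nat_power)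
  qed
qed

text \<open>The reduced polynomial is zero, not only its value at \<open>w\<close>. This makes the
  conjugations well defined and injective.\<close>

lemma ieval_zero_conjugate:
  assumes "primitive w" "primitive x" "ieval f w = 0"
  shows "ieval f x = 0"
proof -
  obtain r where r: "\<And>i. p-1 \<le> i \<Longrightarrow> coeff r i = 0" "\<And>x. primitive x \<Longrightarrow> ieval f x = ieval r x"
    using reduce[of f] by blast
  then have "r = 0" using independent[OF assms(1)] assms(1,3) by simp
  then show ?thesis using r(2)[OF assms(2)] by simp
qed

end

section \<open>Conjugations of the cyclotomic ring and the choice of the form\<close>

context cyclotomic
begin

definition n :: nat where "n = (p - 1) div 2"

definition \<zeta> :: complex where "\<zeta> = cis (2 * pi / p)"

text \<open>The conjugation sending \<open>\<zeta>\<close> to \<open>\<zeta>^(k+1)\<close>, so index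
  0 is the identity, and the indices below \<open>n\<close> give one from each complex conjugate
  pair.\<close>

definition conj :: "nat \<Rightarrow> complex \<Rightarrow> complex" where
  "conj k x = ieval (SOME f. ieval f \<zeta> = x) (\<zeta> ^ Suc k)"

lemma p_eq: "p = 2 * n + 1"
proof -
  have "odd p" using p prime_odd_nat by auto
  then show ?thesis by (auto simp: n_def elim!: oddE)
qed

lemma \<zeta>_power: "\<zeta> ^ k = cis (2 * pi * k / p)"
proof -
  have "\<zeta> ^ k = cis (real k * (2 * pi / p))" unfolding \<zeta>_def by (rule Complex.DeMoivre)
  also have "real k * (2 * pi / p) = 2 * pi * k / p" by simp
  finally show ?thesis .
qed

lemma primitive_\<zeta>: "primitive \<zeta>"
proof -
  have "\<zeta> ^ p = 1" using p0 by (simp add: \<zeta>_power)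
  moreover have "\<zeta> \<noteq> 1"
  proof
    assume "\<zeta> = 1"
    then have "Im \<zeta> = 0" by simp
    moreover have "0 < sin (2 * pi / p)"
      using p by (intro sin_gt_zero) (auto simp: field_simps)
    ultimately show False by (simp add: \<zeta>_def)
  qed
  ultimately show ?thesis by (simp add: primitive_def)
qed

lemma primitive_power: "0 < k \<Longrightarrow> k < p \<Longrightarrow> primitive (\<zeta> ^ k)"
  using primitive_\<zeta> root_power_ne_1[OF p(1)] root_of_unity_power[of \<zeta> p k] by (simp add: primitive_def)

lemma conj_ieval: "k < n \<Longrightarrow> conj k (ieval f \<zeta>) = ieval f (\<zeta> ^ Suc k)"
proof -
  assume k: "k < n"
  let ?g = "SOME g. ieval g \<zeta> = ieval f \<zeta>"
  have "ieval ?g \<zeta> = ieval f \<zeta>" by (rule someI[of _ f]) simp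
  then have "ieval (?g - f) \<zeta> = 0" by simp
  moreover have "primitive (\<zeta> ^ Suc k)" using k p_eq by (intro primitive_power) auto
  ultimately have "ieval (?g - f) (\<zeta> ^ Suc k) = 0"
    using ieval_zero_conjugate[OF primitive_\<zeta>] by blast
  then show ?thesis by (simp add: conj_def)
qed

lemma primitive_cnj: "primitive w \<Longrightarrow> w * cnj w = 1"
proof -
  assume "primitive w"
  then have "cmod w ^ p = 1" by (metis norm_one norm_power primitive_def)
  then have "cmod w = 1" using p0 power_eq_1_iff[of "cmod w" p] by auto
  then show ?thesis using complex_norm_square[of w] by simp
qed

lemma cnj_unique: "primitive w \<Longrightarrow> w * x = 1 \<Longrightarrow> x = cnj w"
proof -
  assume w: "primitive w" "w * x = 1"
  have "x = (w * cnj w) * x" using primitive_cnj[OF w(1)] by simp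
  also have "\<dots> = cnj w" using w(2) by (simp add: mult.assoc mult.left_commute)
  finally show ?thesis .
qed

lemma zspan_cnj: "x \<in> zspan \<zeta> \<Longrightarrow> cnj x \<in> zspan \<zeta>"
proof -
  assume "x \<in> zspan \<zeta>"
  then obtain f where f: "x = ieval f \<zeta>" by (auto simp: zspan_def)
  have "\<zeta> * \<zeta> ^ (p - 1) = 1"
    using primitive_\<zeta> p0 by (simp add: primitive_def flip: power_Suc)
  then have "cnj \<zeta> = \<zeta> ^ (p - 1)"
    using cnj_unique[OF primitive_\<zeta>] by simp
  then have "cnj \<zeta> \<in> zspan \<zeta>" using zspan_power[OF zspan_closed(7)] by simp
  then have "ieval f (cnj \<zeta>) \<in> zspan \<zeta>" by (induction f) (auto intro: zspan_closed)
  then show ?thesis by (simp add: f ieval_cnj)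
qed

text \<open>Fourier inversion: \<open>(\<zeta>^-j - \<zeta>) / p\<close> is the trace dual of the
  basis \<open>1, ..., \<zeta>^(p-2)\<close>. Subtracting \<open>\<zeta>^k\<close> makes the term
  \<open>k = 0\<close> vanish, so only values at nontrivial roots enter; it adds nothing else, as
  the sums over \<open>k\<close> of \<open>\<zeta>^(k (i+1))\<close> are zero.\<close>

lemma coordinate_formula:
  assumes r: "\<And>i. p - 1 \<le> i \<Longrightarrow> coeff r i = 0" and j: "j < p - 1"
  shows "of_nat p * of_int (coeff r j) = (\<Sum>k<p. ieval r (\<zeta> ^ k) * (cnj (\<zeta> ^ k) ^ j - \<zeta> ^ k))"
proof -
  have cz: "\<zeta> * cnj \<zeta> = 1" by (rule primitive_cnj[OF primitive_\<zeta>])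
  have zp: "\<zeta> ^ p = 1" using primitive_\<zeta> by (simp add: primitive_def)
  have ne: "\<zeta> ^ i \<noteq> 1" if "0 < i" "i < p" for i
    using primitive_power[OF that] by (simp add: primitive_def)
  have zero: "(\<Sum>k<p. (\<zeta> ^ k) ^ i) = 0" if "0 < i" "i < p" for i
    using root_sum[OF primitive_power[OF that]] by (simp add: power_mult[symmetric] mult.commute)
  have orth: "(\<Sum>k<p. (\<zeta> ^ k) ^ i * cnj (\<zeta> ^ k) ^ j) = (if i = j then of_nat p else 0)" if i: "i < p - 1" for i
  proof -
    define w where "w = \<zeta> ^ i * cnj \<zeta> ^ j"
    have "(\<Sum>k<p. (\<zeta> ^ k) ^ i * cnj (\<zeta> ^ k) ^ j) = (\<Sum>k<p. w ^ k)"
      by (simp add: w_def power_mult_distrib power_mult[symmetric] mult.commute)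
    moreover have "w = 1" if "i = j" using that cz by (simp add: w_def flip: power_mult_distrib)
    moreover have "primitive w" if "i \<noteq> j"
    proof -
      have cp: "cnj \<zeta> ^ p = 1" using zp by (metis complex_cnj_one complex_cnj_power)
      have "w ^ p = 1"
        using zp cp by (simp add: w_def power_mult_distrib root_of_unity_power)
      moreover have "w \<noteq> 1"
      proof (cases "j < i")
        case True
        have "\<zeta> ^ i = \<zeta> ^ (i - j) * \<zeta> ^ j" using True by (simp flip: power_add)
        then have "w = \<zeta> ^ (i - j) * (\<zeta> * cnj \<zeta>) ^ j" by (simp add: w_def power_mult_distrib)
        then show ?thesis using ne[of "i - j"] True i cz by simp
      next
        case False
        have "cnj \<zeta> ^ j = cnj \<zeta> ^ i * cnj \<zeta> ^ (j - i)" using False by (simp flip: power_add)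
        then have "w = (\<zeta> * cnj \<zeta>) ^ i * cnj (\<zeta> ^ (j - i))" by (simp add: w_def power_mult_distrib mult.assoc)
        then have "w = cnj (\<zeta> ^ (j - i))" using cz by simp
        moreover have "\<zeta> ^ (j - i) \<noteq> 1" using ne[of "j - i"] False that j by simp
          ultimately show ?thesis by (metis complex_cnj_cnj complex_cnj_one)
      qed
      ultimately show ?thesis by (simp add: primitive_def)
    qed
    ultimately show ?thesis using root_sum[of w] by auto
  qed
  have "(\<Sum>k<p. ieval r (\<zeta> ^ k) * (cnj (\<zeta> ^ k) ^ j - \<zeta> ^ k))
      = (\<Sum>k<p. \<Sum>i<p-1. of_int (coeff r i) * ((\<zeta> ^ k) ^ i * cnj (\<zeta> ^ k) ^ j - (\<zeta> ^ k) ^ Suc i))"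
    by (subst ieval_altdef[OF r]) (simp_all add: sum_distrib_right sum_distrib_left algebra_simps)
  also have "\<dots> = (\<Sum>i<p-1. of_int (coeff r i) * (\<Sum>k<p. (\<zeta> ^ k) ^ i * cnj (\<zeta> ^ k) ^ j - (\<zeta> ^ k) ^ Suc i))"
    by (subst sum.swap) (simp add: sum_distrib_left)
  also have "\<dots> = (\<Sum>i<p-1. of_int (coeff r i) * (if i = j then of_nat p else 0))"
  proof (rule sum.cong)
    fix i assume "i \<in> {..<p-1}"
    then show "of_int (coeff r i) * (\<Sum>k<p. (\<zeta> ^ k) ^ i * cnj (\<zeta> ^ k) ^ j - (\<zeta> ^ k) ^ Suc i)
       = of_int (coeff r i) * (if i = j then of_nat p else 0)"
      using orth[of i] zero[of "Suc i"] by (simp add: sum_subtractf del: power_Suc)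
  qed simp
  also have "\<dots> = of_nat p * of_int (coeff r j)"
    using j by (simp add: if_distrib cong: if_cong)
  finally show ?thesis ..
qed

text \<open>In \<open>coordinate_formula\<close> each of the \<open>p\<close> terms has size at most
  \<open>2 C\<close>, so every integral coordinate is at most \<open>2 C\<close>.\<close>

lemma finite_bounded_conjugates: "finite {x \<in> zspan \<zeta>. \<forall>k<n. cmod (conj k x) \<le> C}"
proof -
  define B where "B = \<lceil>2 * C\<rceil>"
  have "{x \<in> zspan \<zeta>. \<forall>k<n. cmod (conj k x) \<le> C}
      \<subseteq> (\<lambda>c. \<Sum>i<p-1. of_int (c i) * \<zeta> ^ i) ` ({..<p-1} \<rightarrow>\<^sub>E {- B..B})"
  proof
    fix x assume "x \<in> {x \<in> zspan \<zeta>. \<forall>k<n. cmod (conj k x) \<le> C}"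
    then have x: "x \<in> zspan \<zeta>" "\<And>k. k < n \<Longrightarrow> cmod (conj k x) \<le> C" by auto
    obtain f where f: "x = ieval f \<zeta>" using x(1) by (auto simp: zspan_def)
    obtain r where r: "\<And>i. p-1 \<le> i \<Longrightarrow> coeff r i = 0" "\<And>x. primitive x \<Longrightarrow> ieval f x = ieval r x"
      using reduce[of f] by blast
    have xr: "x = ieval r \<zeta>" using f r(2)[OF primitive_\<zeta>] by simp
    have bound: "cmod (ieval r (\<zeta> ^ k)) \<le> C" if k: "0 < k" "k < p" for k
    proof (cases "k \<le> n")
      case True
      then show ?thesis using x(2)[of "k - 1"] k conj_ieval[of "k - 1" r] xr by simp
    next
      case False
      \<comment> \<open>Exponents above \<open>n\<close> are complex conjugate to those covered by
        the assumption.\<close>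
      have "\<zeta> ^ k * \<zeta> ^ (p - k) = 1" using k primitive_\<zeta> by (simp add: primitive_def flip: power_add)
      then have e: "\<zeta> ^ k = cnj (\<zeta> ^ (p - k))"
        using cnj_unique[OF primitive_power[of "p - k"]] k by (simp add: mult.commute)
      have "p - k - 1 < n" "Suc (p - k - 1) = p - k" using False k p_eq by auto
      then have "cmod (ieval r (\<zeta> ^ (p - k))) \<le> C"
        using x(2)[of "p - k - 1"] conj_ieval[of "p - k - 1" r] xr by simp
      then show ?thesis unfolding e ieval_cnj[symmetric] by simp
    qed
    have C0: "0 \<le> C" using order_trans[OF norm_ge_zero bound[of 1]] p by simp
    have coeff: "coeff r j \<in> {- B..B}" if j: "j < p - 1" for j
    proof -
      have "real p * \<bar>real_of_int (coeff r j)\<bar> = cmod (of_nat p * of_int (coeff r j))"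
        by (simp add: norm_mult)
      also have "\<dots> \<le> (\<Sum>k<p. cmod (ieval r (\<zeta> ^ k) * (cnj (\<zeta> ^ k) ^ j - \<zeta> ^ k)))"
        using coordinate_formula[OF r(1) j] by (simp only: norm_sum)
      also have "\<dots> \<le> (\<Sum>k<p. C * 2)"
      proof (rule sum_mono)
        fix k assume k: "k \<in> {..<p}"
        show "cmod (ieval r (\<zeta> ^ k) * (cnj (\<zeta> ^ k) ^ j - \<zeta> ^ k)) \<le> C * 2"
        proof (cases "k = 0")
          case True
          then show ?thesis using C0 by simp
        next
          case False
          have "cmod (cnj (\<zeta> ^ k) ^ j - \<zeta> ^ k) \<le> cmod (cnj (\<zeta> ^ k) ^ j) + cmod (\<zeta> ^ k)"
            by (rule norm_triangle_ineq4)
          also have "\<dots> = 2" by (simp add: norm_power \<zeta>_def)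
          finally show ?thesis
            unfolding norm_mult using bound[of k] False k C0 by (intro mult_mono) auto
        qed
      qed
      also have "\<dots> = real p * (2 * C)" by simp
      finally have "\<bar>real_of_int (coeff r j)\<bar> \<le> 2 * C" using p0 by simp
      then show ?thesis unfolding B_def by (simp add: abs_le_iff) linarith
    qed
    have "x = (\<Sum>i<p-1. of_int ((\<lambda>i\<in>{..<p-1}. coeff r i) i) * \<zeta> ^ i)"
      unfolding xr by (subst ieval_altdef[OF r(1)]) auto
    moreover have "(\<lambda>i\<in>{..<p-1}. coeff r i) \<in> ({..<p-1} \<rightarrow>\<^sub>E {- B..B})"
      using coeff by (intro restrict_PiE_iff[THEN iffD2] ballI) simp
    ultimately show "x \<in> (\<lambda>c. \<Sum>i<p-1. of_int (c i) * \<zeta> ^ i) ` ({..<p-1} \<rightarrow>\<^sub>E {- B..B})"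
      by (rule image_eqI)
  qed
  then show ?thesis by (rule finite_subset) (intro finite_imageI finite_PiE; simp)
qed

text \<open>Among the conjugates of \<open>\<zeta> + 1/\<zeta>\<close> the largest is
  \<open>2 cos (2 pi / p)\<close> and the next \<open>2 cos (4 pi / p)\<close>. A rational
  \<open>m / q\<close> strictly between them separates the identity place from all others.\<close>

lemma separating_rational:
  assumes "5 \<le> p"
  obtains m q :: int where "0 < of_int q * (2 * cos (2 * pi / p)) - real_of_int m"
    "\<And>k. 0 < k \<Longrightarrow> k < n \<Longrightarrow> of_int q * (2 * cos (2 * pi * Suc k / p)) - real_of_int m < 0"
proof -
  have mono: "cos (2 * pi * Suc k / p) \<le> cos (4 * pi / p)" if "0 < k" "k < n" for k
  proof (rule cos_monotone_0_pi_le)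
    have "2 * Suc k \<le> 2 * n" using that by simp
    also have "2 * n \<le> p" using eq_imp_le[OF p_eq[symmetric]] by simp
    finally have "2 * Suc k \<le> p" .
    then have "real (2 * Suc k) \<le> real p" by (simp only: of_nat_le_iff)
    then have "2 * real (Suc k) \<le> real p" by simp
    then have "pi * (2 * real (Suc k)) \<le> pi * real p" by (intro mult_left_mono) auto
    then show "2 * pi * real (Suc k) / p \<le> pi" using p0 by (simp add: field_simps)
    have "2 * 2 * pi \<le> 2 * pi * real (Suc k)" using that by simp
    then show "4 * pi / p \<le> 2 * pi * Suc k / p" by (intro divide_right_mono) auto
  qed simp
  have "cos (4 * pi / p) < cos (2 * pi / p)"
    using assms by (intro cos_monotone_0_pi) (auto simp: field_simps)
  then obtain r where r: "r \<in> \<rat>" "2 * cos (4 * pi / p) < r" "r < 2 * cos (2 * pi / p)"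
    using Rats_dense_in_real[of "2 * cos (4 * pi / p)" "2 * cos (2 * pi / p)"] by auto
  obtain m q :: int where mq: "0 < q" "r = of_int m / of_int q"
    using Rats_cases'[OF r(1)] by metis
  show thesis
  proof (rule that[of q m])
    show "0 < of_int q * (2 * cos (2 * pi / p)) - real_of_int m"
      using r(3) mq by (simp add: field_simps)
    fix k assume "0 < k" "k < n"
    from mono[OF this] have "2 * cos (2 * pi * Suc k / p) \<le> 2 * cos (4 * pi / p)"
      by (rule mult_left_mono) simp
    also have "\<dots> < real_of_int m / of_int q" using r(2) unfolding mq(2) .
    finally have "2 * cos (2 * pi * Suc k / p) < real_of_int m / of_int q" .
    then show "of_int q * (2 * cos (2 * pi * Suc k / p)) - real_of_int m < 0"
      using mq(1) by (simp add: field_simps)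
  qed
qed

lemma zspan_range: "zspan \<zeta> = range (\<lambda>c :: nat \<Rightarrow> int. \<Sum>i<2*n. of_int (c i) * \<zeta> ^ i)"
proof -
  have e: "2 * n = p - 1" using p_eq by simp
  have "(\<Sum>i<p-1. of_int (c i) * \<zeta> ^ i) \<in> zspan \<zeta>" for c :: "nat \<Rightarrow> int"
    by (intro zspan_sum zspan_closed(3) zspan_closed(8) zspan_power zspan_closed(7))
  then show ?thesis
    unfolding e using zspan_basis[OF primitive_\<zeta>] by blast
qed

theorem cyclotomic_action:
  assumes "5 \<le> p"
  shows "isolated_cyclic_action p"
proof -
  obtain m q :: int where mq: "0 < of_int q * (2 * cos (2 * pi / p)) - real_of_int m"
    "\<And>k. 0 < k \<Longrightarrow> k < n \<Longrightarrow> of_int q * (2 * cos (2 * pi * Suc k / p)) - real_of_int m < 0"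
    by (rule separating_rational[OF assms]) (rule that)
  define a' where "a' k = of_int q * (2 * cos (2 * pi * Suc k / p)) - real_of_int m" for k
  \<comment> \<open>On \<open>p\<close>-th roots of unity the exponent \<open>p - 1\<close> is
    inversion, so \<open>f\<close> represents \<open>q (x + 1/x) - m\<close> at every place.\<close>
  define f :: "int poly" where "f = [:- m:] + smult q (monom 1 1 + monom 1 (p - 1))"
  have f: "ieval f (\<zeta> ^ Suc k) = complex_of_real (a' k)" if "k < n" for k
  proof -
    let ?w = "\<zeta> ^ Suc k"
    have w: "primitive ?w" using that p_eq by (intro primitive_power) auto
    have "?w * ?w ^ (p - 1) = 1"
      using w p0 unfolding primitive_def by (metis Suc_diff_1 power_Suc)
    then have "?w ^ (p - 1) = cnj ?w"
      by (rule cnj_unique[OF w])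
    then have "ieval f ?w = of_int q * (?w + cnj ?w) - of_int m" by (simp add: f_def)
    also have "?w + cnj ?w = of_real (2 * cos (2 * pi * Suc k / p))"
      unfolding complex_add_cnj \<zeta>_power by simp
    finally show ?thesis by (simp add: a'_def)
  qed
  have n2: "2 \<le> n" using assms p_eq by linarith
  have f0: "ieval f \<zeta> = complex_of_real (a' 0)" using f[of 0] n2 by simp
  have obt: "\<exists>f. x = ieval f \<zeta>" if "x \<in> zspan \<zeta>" for x using that by (auto simp: zspan_def)
  interpret cm_order "zspan \<zeta>" n conj "\<lambda>i. \<zeta> ^ i" "a' 0" a'
  proof
    fix k x y assume k: "k < n" and x: "x \<in> zspan \<zeta>"
    obtain f where f: "x = ieval f \<zeta>" using obt[OF x] by blast
    show "conj k (cnj x) = cnj (conj k x)"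
    proof -
      \<comment> \<open>Conjugation of \<open>x\<close> becomes composition with \<open>g\<close>,
        and \<open>g\<close> inverts every conjugate root as well, since \<open>x g(x) = 1\<close>
        is a polynomial relation.\<close>
      obtain g where g: "cnj \<zeta> = ieval g \<zeta>" using obt[OF zspan_cnj[OF zspan_closed(7)]] by blast
      have prim: "primitive (\<zeta> ^ Suc k)" using k p_eq by (intro primitive_power) auto
      have "ieval ([:0, 1:] * g - 1) \<zeta> = 0" using primitive_cnj[OF primitive_\<zeta>] g by simp
      then have "ieval ([:0, 1:] * g - 1) (\<zeta> ^ Suc k) = 0"
        by (rule ieval_zero_conjugate[OF primitive_\<zeta> prim])
      then have "\<zeta> ^ Suc k * ieval g (\<zeta> ^ Suc k) = 1" by simp
      then have gk: "ieval g (\<zeta> ^ Suc k) = cnj (\<zeta> ^ Suc k)"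
        by (rule cnj_unique[OF prim])
      have pc: "ieval (pcompose f g) w = ieval f (ieval g w)" for w
        by (induction f) (auto simp: pcompose_pCons)
      have e: "cnj x = ieval (pcompose f g) \<zeta>" using g by (simp add: f pc ieval_cnj)
      have "conj k (ieval (pcompose f g) \<zeta>) = ieval (pcompose f g) (\<zeta> ^ Suc k)"
        by (rule conj_ieval[OF k])
      then have "conj k (cnj x) = ieval f (cnj (\<zeta> ^ Suc k))"
        using e by (simp only: pc gk)
      then show ?thesis unfolding f conj_ieval[OF k] ieval_cnj .
    qed
    show "x = 0" if "conj k x = 0"
    proof -
      have prim: "primitive (\<zeta> ^ Suc k)" using k p_eq by (intro primitive_power) auto
      show ?thesis using that k ieval_zero_conjugate[OF prim primitive_\<zeta>] by (simp only: f conj_ieval)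
    qed
    show "conj k (x + y) = conj k x + conj k y" "conj k (x * y) = conj k x * conj k y" if y: "y \<in> zspan \<zeta>"
    proof -
      obtain g where g: "y = ieval g \<zeta>" using obt[OF y] by blast
      show "conj k (x + y) = conj k x + conj k y"
        using conj_ieval[OF k, of "f + g"] conj_ieval[OF k] by (simp add: f g)
      show "conj k (x * y) = conj k x * conj k y"
        using conj_ieval[OF k, of "f * g"] conj_ieval[OF k] by (simp add: f g)
    qed
  next
    fix x assume "x \<in> zspan \<zeta>"
    then obtain f where "x = ieval f \<zeta>" using obt by blast
    then show "conj 0 x = x" using conj_ieval[of 0 f] n2 by simp
  next
    fix c :: "nat \<Rightarrow> int" and i assume c: "(\<Sum>i<2*n. of_int (c i) * \<zeta> ^ i) = 0" and i: "i < 2*n"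
    define f :: "int poly" where "f = (\<Sum>i<2*n. monom (c i) i)"
    have cf: "coeff f j = (if j < 2*n then c j else 0)" for j by (simp add: f_def coeff_sum)
    have "ieval f \<zeta> = 0" using c by (simp add: f_def ieval_sum)
    then have "f = 0" using p_eq by (intro independent[OF primitive_\<zeta>]) (auto simp: cf)
    then show "c i = 0" using cf[of i] i by simp
  next
    fix k assume "k < n"
    then show "conj k (complex_of_real (a' 0)) = complex_of_real (a' k)"
      unfolding f0[symmetric] by (simp only: conj_ieval f)
  next
    show "complex_of_real (a' 0) \<in> zspan \<zeta>" unfolding f0[symmetric] by (rule zspan_closed)
  next
    show "0 < a' 0" using mq(1) by (simp add: a'_def)
    show "a' k < 0" if "0 < k" "k < n" for k using mq(2)[OF that] unfolding a'_def .
  qed (rule n2 zspan_range finite_bounded_conjugates zspan_closed zspan_cnj; assumption)+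
  have "odd p" by (subst p_eq) simp
  then show ?thesis
    using odd_prime_action[OF p(1) _ zspan_closed(7)] primitive_\<zeta> by (simp add: primitive_def)
qed

end

section \<open>The twelfth cyclotomic field\<close>

definition \<omega> :: complex where "\<omega> = Complex (- 1/2) (sqrt 3 / 2)"

lemma \<omega>_sq: "\<omega> * \<omega> = - 1 - \<omega>"
  by (simp add: \<omega>_def complex_eq_iff)

text \<open>Coordinates in the twelfth cyclotomic ring with respect to the basis formed by 1,
  \<open>\<omega>\<close>, \<open>\<i>\<close> and \<open>\<i> * \<omega>\<close>.\<close>

definition q4 :: "int \<Rightarrow> int \<Rightarrow> int \<Rightarrow> int \<Rightarrow> complex" where
  "q4 a b c d = of_int a + of_int b * \<omega> + \<i> * (of_int c + of_int d * \<omega>)"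

lemma Re_q4: "Re (q4 a b c d) = of_int a - of_int b / 2 - of_int d * (sqrt 3 / 2)"
  and Im_q4: "Im (q4 a b c d) = of_int b * (sqrt 3 / 2) + of_int c - of_int d / 2"
  by (simp_all add: q4_def \<omega>_def)

lemma q4_add: "q4 a b c d + q4 a' b' c' d' = q4 (a + a') (b + b') (c + c') (d + d')"
  by (simp add: q4_def algebra_simps)

lemma q4_minus: "- q4 a b c d = q4 (- a) (- b) (- c) (- d)"
  by (simp add: q4_def algebra_simps)

lemma q4_cnj: "cnj (q4 a b c d) = q4 (a - b) (- b) (- c + d) d"
  by (simp add: complex_eq_iff Re_q4 Im_q4 algebra_simps)

lemma q4_mult: "q4 a b c d * q4 a' b' c' d' =
  q4 (a * a' - b * b' - (c * c' - d * d')) (a * b' + b * a' - b * b' - (c * d' + d * c' - d * d'))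
     (a * c' - b * d' + (c * a' - d * b')) (a * d' + b * c' - b * d' + (c * b' + d * a' - d * b'))"
proof -
  have e: "(x + y * \<omega> + \<i> * (z + w * \<omega>)) * (x' + y' * \<omega> + \<i> * (z' + w' * \<omega>)) =
     x * x' - z * z' + (x * y' + y * x' - z * w' - w * z') * \<omega> + (y * y' - w * w') * (\<omega> * \<omega>)
     + \<i> * (x * z' + z * x' + (x * w' + y * z' + z * y' + w * x') * \<omega> + (y * w' + w * y') * (\<omega> * \<omega>))"
    for x y z w x' y' z' w' :: complex
    by (simp add: algebra_simps)
  show ?thesis
    unfolding q4_def e \<omega>_sq by (simp add: algebra_simps)
qed

lemma int_sq_eq_3_sq: "(x::int)\<^sup>2 = 3 * y\<^sup>2 \<Longrightarrow> y = 0"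
proof (rule ccontr)
  assume e: "x\<^sup>2 = 3 * y\<^sup>2" and y: "y \<noteq> 0"
  then have x: "x \<noteq> 0" by auto
  have p: "prime_elem (3::int)" by simp
  have "multiplicity 3 (x\<^sup>2) = 2 * multiplicity 3 x"
    using p x by (simp add: prime_elem_multiplicity_power_distrib)
  moreover have "multiplicity 3 (3 * y\<^sup>2) = 1 + 2 * multiplicity 3 y"
    using p y by (simp add: prime_elem_multiplicity_mult_distrib prime_elem_multiplicity_power_distrib)
  ultimately have "2 * multiplicity 3 x = 1 + 2 * multiplicity 3 y" using e by simp
  then show False by presburger
qed

lemma sqrt_3_independent:
  fixes x y :: int
  assumes "of_int x + of_int y * sqrt 3 = 0"
  shows "x = 0" "y = 0"
proof -
  have "real_of_int x = - (of_int y * sqrt 3)" using assms by linarith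
  then have "(real_of_int x)\<^sup>2 = (of_int y * sqrt 3)\<^sup>2" by (simp only: power2_minus)
  then have "real_of_int (x\<^sup>2) = real_of_int (3 * y\<^sup>2)" by (simp add: power_mult_distrib)
  then have "x\<^sup>2 = 3 * y\<^sup>2" unfolding of_int_eq_iff .
  then show y: "y = 0" by (rule int_sq_eq_3_sq)
  then show "x = 0" using assms by simp
qed

lemma q4_eq_0: "q4 a b c d = 0 \<longleftrightarrow> a = 0 \<and> b = 0 \<and> c = 0 \<and> d = 0"
proof
  assume "q4 a b c d = 0"
  then have "Re (q4 a b c d) = 0" "Im (q4 a b c d) = 0" by simp_all
  then have "of_int (2 * a - b) + of_int (- d) * sqrt 3 = 0" "of_int (2 * c - d) + of_int b * sqrt 3 = 0"
    by (simp_all add: Re_q4 Im_q4 field_simps)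
  from sqrt_3_independent[OF this(1)] sqrt_3_independent[OF this(2)]
  show "a = 0 \<and> b = 0 \<and> c = 0 \<and> d = 0" by auto
qed (simp add: q4_def)

lemma q4_inj: "q4 a b c d = q4 a' b' c' d' \<longleftrightarrow> a = a' \<and> b = b' \<and> c = c' \<and> d = d'"
proof -
  have "q4 a b c d = q4 a' b' c' d' \<longleftrightarrow> q4 a b c d + - q4 a' b' c' d' = 0"
    unfolding add_uminus_conv_diff by (rule eq_iff_diff_eq_0)
  then show ?thesis unfolding q4_minus q4_add q4_eq_0 by auto
qed

definition Z12 :: "complex set" where
  "Z12 = {q4 a b c d | a b c d. True}"

lemma Z12_I [intro, simp]: "q4 a b c d \<in> Z12"
  by (auto simp: Z12_def)

lemma Z12_cases [elim?]:
  assumes "x \<in> Z12"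
  obtains a b c d where "x = q4 a b c d"
  using assms by (auto simp: Z12_def)

text \<open>The automorphism fixing \<open>\<omega>\<close> and negating \<open>\<i>\<close>. Since
  \<open>1 + 2 * \<omega> = \<i> * sqrt 3\<close>, it negates \<open>sqrt 3\<close> and represents
  the second complex place.\<close>

definition s12 :: "complex \<Rightarrow> complex" where
  "s12 x = (THE y. \<exists>a b c d. x = q4 a b c d \<and> y = q4 a b (- c) (- d))"

lemma s12_q4: "s12 (q4 a b c d) = q4 a b (- c) (- d)"
  unfolding s12_def by (rule the_equality) (auto simp: q4_inj)

definition conj12 :: "nat \<Rightarrow> complex \<Rightarrow> complex" where
  "conj12 k x = (if k = 0 then x else s12 x)"

definition basis12 :: "nat \<Rightarrow> complex" where
  "basis12 i = (if i = 0 then 1 else if i = 1 then \<omega> else if i = 2 then \<i> else \<i> * \<omega>)"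

lemma basis12_sum: "(\<Sum>i<2*2. of_int (c i) * basis12 i) = q4 (c 0) (c 1) (c 2) (c 3)"
  by (simp add: eval_nat_numeral basis12_def q4_def algebra_simps)

text \<open>Besides having the right signs, \<open>1 + sqrt 3\<close> has norm -2; this value drives
  the exclusion of reflections for p = 2.\<close>

definition a12 :: "nat \<Rightarrow> real" where
  "a12 k = (if k = 0 then 1 + sqrt 3 else 1 - sqrt 3)"

lemma a12_q4: "complex_of_real (a12 0) = q4 1 0 (- 1) (- 2)" "complex_of_real (a12 (Suc k)) = q4 1 0 1 2"
  by (simp_all add: complex_eq_iff Re_q4 Im_q4 a12_def)

lemma q4_bounded:
  assumes "cmod (q4 a b c d) \<le> C" "cmod (q4 a b (- c) (- d)) \<le> C"
  shows "real_of_int \<bar>a\<bar> \<le> 3 * C" "real_of_int \<bar>b\<bar> \<le> 3 * C" "real_of_int \<bar>c\<bar> \<le> 3 * C" "real_of_int \<bar>d\<bar> \<le> 3 * C"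
proof -
  have aux: "real_of_int \<bar>x\<bar> \<le> 3 * C \<and> real_of_int \<bar>y\<bar> \<le> 3 * C"
    if u: "\<bar>real_of_int x - real_of_int y / 2\<bar> \<le> C" "\<bar>real_of_int y * (sqrt 3 / 2)\<bar> \<le> C" for x y
  proof -
    have "\<bar>real_of_int y\<bar> * (1/2) \<le> \<bar>real_of_int y\<bar> * (sqrt 3 / 2)" by (intro mult_left_mono) auto
    also have "\<dots> \<le> C" using u(2) by (simp add: abs_mult)
    finally have "\<bar>real_of_int y\<bar> \<le> 2 * C" by simp
    with u(1) show ?thesis by linarith
  qed
  have le: "\<bar>Re (q4 a b c d)\<bar> \<le> C" "\<bar>Im (q4 a b c d)\<bar> \<le> C" "\<bar>Re (q4 a b (- c) (- d))\<bar> \<le> C" "\<bar>Im (q4 a b (- c) (- d))\<bar> \<le> C"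
    using assms abs_Re_le_cmod abs_Im_le_cmod order_trans by blast+
  have "\<bar>real_of_int a - real_of_int b / 2\<bar> \<le> C" "\<bar>real_of_int b * (sqrt 3 / 2)\<bar> \<le> C"
    "\<bar>real_of_int c - real_of_int d / 2\<bar> \<le> C" "\<bar>real_of_int d * (sqrt 3 / 2)\<bar> \<le> C"
    using le unfolding Re_q4 Im_q4 by (simp_all add: abs_le_iff; linarith)+
  then show "real_of_int \<bar>a\<bar> \<le> 3 * C" "real_of_int \<bar>b\<bar> \<le> 3 * C" "real_of_int \<bar>c\<bar> \<le> 3 * C" "real_of_int \<bar>d\<bar> \<le> 3 * C"
    using aux by blast+
qed

interpretation Z12: cm_order Z12 2 conj12 basis12 "a12 0" a12
proof
  show "1 \<in> Z12" using Z12_I[of 1 0 0 0] by (simp add: q4_def)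
  show "Z12 = range (\<lambda>c :: nat \<Rightarrow> int. \<Sum>i<2*2. of_int (c i) * basis12 i)"
  proof (intro equalityI subsetI)
    fix x assume "x \<in> Z12"
    then obtain a b c d where x: "x = q4 a b c d" by (rule Z12_cases)
    let ?c = "\<lambda>i::nat. if i = 0 then a else if i = 1 then b else if i = 2 then c else d"
    have "x = (\<Sum>i<2*2. of_int (?c i) * basis12 i)" unfolding basis12_sum x by simp
    then show "x \<in> range (\<lambda>c :: nat \<Rightarrow> int. \<Sum>i<2*2. of_int (c i) * basis12 i)"
      by (intro range_eqI[of _ _ ?c])
  next
    fix x assume "x \<in> range (\<lambda>c :: nat \<Rightarrow> int. \<Sum>i<2*2. of_int (c i) * basis12 i)"
    then obtain c :: "nat \<Rightarrow> int" where "x = (\<Sum>i<2*2. of_int (c i) * basis12 i)" by blast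
    then show "x \<in> Z12" unfolding basis12_sum by simp
  qed
next
  fix c :: "nat \<Rightarrow> int" and i :: nat assume "(\<Sum>i<2*2. of_int (c i) * basis12 i) = 0" "i < 2*2"
  then have "c 0 = 0" "c 1 = 0" "c 2 = 0" "c 3 = 0" "i < 4" unfolding basis12_sum q4_eq_0 by auto
  moreover from this(5) have "i = 0 \<or> i = 1 \<or> i = 2 \<or> i = 3" by linarith
  ultimately show "c i = 0" by auto
next
  fix C :: real
  define B where "B = \<lceil>3 * C\<rceil>"
  have "{x \<in> Z12. \<forall>k<2. cmod (conj12 k x) \<le> C} \<subseteq>
      (\<lambda>(a, b, c, d). q4 a b c d) ` ({- B..B} \<times> {- B..B} \<times> {- B..B} \<times> {- B..B})"
  proof
    fix x assume "x \<in> {x \<in> Z12. \<forall>k<2. cmod (conj12 k x) \<le> C}"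
    then have x: "x \<in> Z12" "cmod (conj12 0 x) \<le> C" "cmod (conj12 1 x) \<le> C" by auto
    from x(1) obtain a b c d where q: "x = q4 a b c d" by (rule Z12_cases)
    have "cmod (q4 a b c d) \<le> C" "cmod (q4 a b (- c) (- d)) \<le> C"
      using x q by (simp_all add: conj12_def s12_q4)
    note bd = q4_bounded[OF this]
    have "t \<in> {- B..B}" if "real_of_int \<bar>t\<bar> \<le> 3 * C" for t
      using that unfolding B_def by simp linarith
    with bd have "(a, b, c, d) \<in> {- B..B} \<times> {- B..B} \<times> {- B..B} \<times> {- B..B}" by blast
    then show "x \<in> (\<lambda>(a, b, c, d). q4 a b c d) ` ({- B..B} \<times> {- B..B} \<times> {- B..B} \<times> {- B..B})"
      unfolding q by (rule rev_image_eqI) simp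
  qed
  then show "finite {x \<in> Z12. \<forall>k<2. cmod (conj12 k x) \<le> C}"
    by (rule finite_subset) simp
next
  fix k :: nat assume "0 < k"
  then show "a12 k < 0" by (simp add: a12_def)
next
  fix x y assume "x \<in> Z12" "y \<in> Z12"
  then obtain a b c d a' b' c' d' where xy: "x = q4 a b c d" "y = q4 a' b' c' d'" by (auto simp: Z12_def)
  show "x + y \<in> Z12" "x * y \<in> Z12" unfolding xy q4_add q4_mult by simp_all
  show "conj12 k (x + y) = conj12 k x + conj12 k y" "conj12 k (x * y) = conj12 k x * conj12 k y" for k
    unfolding xy by (simp_all add: conj12_def q4_add q4_mult s12_q4 q4_inj algebra_simps)
next
  fix x assume "x \<in> Z12"
  then obtain a b c d where x: "x = q4 a b c d" by (rule Z12_cases)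
  show "- x \<in> Z12" "cnj x \<in> Z12" unfolding x q4_minus q4_cnj by simp_all
  show "conj12 k (cnj x) = cnj (conj12 k x)" for k
    unfolding x by (simp add: conj12_def s12_q4 q4_cnj q4_inj)
  show "x = 0" if "conj12 k x = 0" for k
    using that unfolding x by (auto simp: conj12_def s12_q4 q4_eq_0 split: if_splits)
next
  fix k :: nat
  show "conj12 k (complex_of_real (a12 0)) = complex_of_real (a12 k)"
    by (cases k) (simp_all add: conj12_def a12_q4 s12_q4)
next
  show "complex_of_real (a12 0) \<in> Z12" by (simp add: a12_q4)
  show "0 < a12 0" by (simp add: a12_def add_pos_pos)
qed (simp_all add: conj12_def)

lemma Z12_real:
  assumes "x \<in> Z12" "cnj x = x"
  obtains a c :: int where "x = of_int a + of_int c * of_real (sqrt 3)" "s12 x = of_int a - of_int c * of_real (sqrt 3)"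
proof -
  obtain a b c d where x: "x = q4 a b c d" using assms(1) by (rule Z12_cases)
  have "q4 (a - b) (- b) (- c + d) d = q4 a b c d" using assms(2) by (simp add: x q4_cnj)
  then have bd: "b = 0" "d = 2 * c" by (auto simp: q4_inj)
  show thesis
  \<comment> \<open>The minus sign comes from
    \<open>\<i> * (1 + 2 * \<omega>) = - sqrt 3\<close>.\<close>
  proof (rule that[of a "- c"])
    show "x = of_int a + of_int (- c) * of_real (sqrt 3)"
      by (simp add: x bd complex_eq_iff Re_q4 Im_q4)
    show "s12 x = of_int a - of_int (- c) * of_real (sqrt 3)"
      by (simp add: x bd s12_q4 complex_eq_iff Re_q4 Im_q4)
  qed
qed

text \<open>The twelfth cyclotomic ring contains the cube root of unity \<open>\<omega>\<close> and,
  unlike the ring generated by \<open>\<omega>\<close> alone, has a second complex place.\<close>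

theorem order_three_action:
  "isolated_cyclic_action 3"
proof (rule Z12.odd_prime_action)
  show "\<omega> \<in> Z12" using Z12_I[of 0 1 0 0] by (simp add: q4_def)
  show "\<omega> ^ 3 = 1"
  proof -
    have "\<omega> ^ 3 = \<omega> * (\<omega> * \<omega>)" by (simp add: power3_eq_cube)
    also have "\<dots> = - \<omega> - \<omega> * \<omega>" by (simp add: \<omega>_sq algebra_simps)
    also have "\<dots> = 1" by (simp add: \<omega>_sq)
    finally show ?thesis .
  qed
  show "\<omega> \<noteq> 1" by (simp add: \<omega>_def complex_eq_iff)
qed simp_all

lemma of_real_cmod_sq: "w * cnj w = complex_of_real ((cmod w)\<^sup>2)"
  using complex_norm_square[of w] by simp

lemma herm_add_left: "herm (x + y) z = herm x z + herm y z"
  and herm_add_right: "herm z (x + y) = herm z x + herm z y"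
  by (simp_all add: herm_def algebra_simps)

text \<open>Signature (2,1): orthogonality expresses \<open>y$3\<close> by the other entries, and
  Lagrange's identity gives the Cauchy-Schwarz bound
  \<open>|y3|^2 \<le> (|y1|^2 + |y2|^2) |z|^2\<close> with \<open>|z| < 1\<close>.\<close>

lemma orthogonal_to_negative_positive:
  assumes z: "z \<in> CH2" and y: "y \<noteq> 0" "herm y (CH2_lift z) = 0"
  shows "0 < Re (herm y y)"
proof -
  let ?p = "(cmod (y$1))\<^sup>2 + (cmod (y$2))\<^sup>2"
  have y3: "y$3 = y$1 * cnj (z$1) + y$2 * cnj (z$2)"
    using y(2) by (simp add: herm_def CH2_lift_def)
  have nz: "(norm z)\<^sup>2 < 1" using z by (simp add: CH2_def abs_square_less_1)
  have "?p \<noteq> 0"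
  proof
    assume "?p = 0"
    then have "y$1 = 0" "y$2 = 0" by (simp_all add: sum_power2_eq_zero_iff)
    with y3 y(1) show False by (simp add: vec_eq_iff forall_3)
  qed
  then have p: "0 < ?p" by (simp add: order.not_eq_order_implies_strict)
  have "complex_of_real (?p * (norm z)\<^sup>2) =
      complex_of_real ((cmod (y$3))\<^sup>2 + (cmod (y$1 * z$2 - y$2 * z$1))\<^sup>2)"
    unfolding norm_CH2 of_real_mult of_real_add of_real_cmod_sq[symmetric] y3
    by (simp add: algebra_simps)
  then have "?p * (norm z)\<^sup>2 = (cmod (y$3))\<^sup>2 + (cmod (y$1 * z$2 - y$2 * z$1))\<^sup>2"
    unfolding of_real_eq_iff .
  then have "(cmod (y$3))\<^sup>2 \<le> ?p * (norm z)\<^sup>2"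
    using zero_le_power2[of "cmod (y$1 * z$2 - y$2 * z$1)"] by linarith
  also have "\<dots> < ?p * 1" using p nz by (rule mult_strict_left_mono[rotated])
  finally show ?thesis by (simp add: herm_self)
qed

text \<open>For an isometry the adjoint is the inverse, and here the inverse is \<open>A\<close>
  itself.\<close>

lemma (in cm_order) involution_selfadjoint:
  assumes A: "A \<in> carrier SU21" "A ** A = mat 1"
  shows "complex_of_real (h' 0 i) * (cj A)$i$j = complex_of_real (h' 0 j) * cnj ((cj A)$j$i)"
proof -
  define s :: "3 \<Rightarrow> complex" where "s i = (if i = 3 then -1 else 1)" for i
  have e: "herm v (axis i 1) = s i * v$i" "herm (axis i 1) v = s i * cnj (v$i)" for v i
    using exhaust_3[of i] by (auto simp: herm_def s_def axis_def)
  have "herm (A *v axis j 1) (axis i 1) = herm (A *v axis j 1) (A *v (A *v axis i 1))"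
    using A(2) by (simp add: matrix_vector_mul_assoc)
  also have "\<dots> = herm (axis j 1) (A *v axis i 1)" using A(1) by (simp add: SU21_iff)
  finally have sA: "s i * A$i$j = s j * cnj (A$j$i)" unfolding e matrix_vector_axis .
  have "complex_of_real (sqrt a) * complex_of_real (sqrt a) = complex_of_real a"
    using a_pos by (simp flip: of_real_mult)
  then have h: "complex_of_real (h' 0 i) = s i * d i * d i" for i
    by (simp add: h'_def a'_0 s_def d_def)
  have cd: "cnj (d i) = d i" for i by (simp add: d_def)
  have "complex_of_real (h' 0 i) * (cj A)$i$j = (s i * A$i$j) * (d i * d j)"
    unfolding h by (simp add: cj_entry)
  also have "\<dots> = complex_of_real (h' 0 j) * cnj ((cj A)$j$i)"
    unfolding h sA by (simp add: cj_entry cd)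
  finally show ?thesis .
qed

section \<open>Involutions\<close>

text \<open>Rounding the imaginary part to a row of the hexagonal lattice and then the real part
  within that row costs at most \<open>3/16 + 1/4\<close>.\<close>

lemma eisenstein_round:
  obtains b c :: int where "(cmod (z - (of_int b + of_int c * \<omega>)))\<^sup>2 \<le> 7/16"
proof -
  define c where "c = round (Im z * 2 / sqrt 3)"
  define b where "b = round (Re z + of_int c / 2)"
  have "\<bar>Im z * 2 / sqrt 3 - of_int c\<bar> \<le> 1/2"
    unfolding c_def using of_int_round_abs_le[of "Im z * 2 / sqrt 3"] by linarith
  then have "\<bar>Im z * 2 / sqrt 3 - of_int c\<bar> * (sqrt 3 / 2) \<le> 1/2 * (sqrt 3 / 2)"
    by (intro mult_right_mono) auto
  moreover have "(Im z * 2 / sqrt 3 - of_int c) * (sqrt 3 / 2) = Im z - of_int c * (sqrt 3 / 2)"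
    by (simp add: left_diff_distrib)
  then have "\<bar>Im z * 2 / sqrt 3 - of_int c\<bar> * (sqrt 3 / 2) = \<bar>Im z - of_int c * (sqrt 3 / 2)\<bar>"
    by (metis abs_mult abs_of_nonneg real_sqrt_ge_zero divide_nonneg_nonneg zero_le_numeral)
  ultimately have "\<bar>Im z - of_int c * (sqrt 3 / 2)\<bar> \<le> \<bar>sqrt 3 / 4\<bar>" by linarith
  then have "(Im z - of_int c * (sqrt 3 / 2))\<^sup>2 \<le> (sqrt 3 / 4)\<^sup>2" by (simp only: abs_le_square_iff)
  then have im: "(Im z - of_int c * (sqrt 3 / 2))\<^sup>2 \<le> 3/16" by (simp add: power_divide)
  have "\<bar>Re z + of_int c / 2 - of_int b\<bar> \<le> 1/2"
    unfolding b_def using of_int_round_abs_le[of "Re z + of_int c / 2"] by linarith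
  then have "(Re z + of_int c / 2 - of_int b)\<^sup>2 \<le> (1/2)\<^sup>2"
    by (rule power2_le_iff_abs_le[THEN iffD2, rotated]) simp
  then have re: "(Re z + of_int c / 2 - of_int b)\<^sup>2 \<le> 1/4" by (simp add: power_divide)
  have "(cmod (z - (of_int b + of_int c * \<omega>)))\<^sup>2 = (Re z + of_int c / 2 - of_int b)\<^sup>2 + (Im z - of_int c * (sqrt 3 / 2))\<^sup>2"
    by (simp add: cmod_power2 \<omega>_def algebra_simps)
  with re im have "(cmod (z - (of_int b + of_int c * \<omega>)))\<^sup>2 \<le> 7/16" by linarith
  then show thesis using that by blast
qed

text \<open>Division with remainder; \<open>x\<close> and \<open>y\<close> stand for a quotient at
  the two places. Write \<open>x = U + \<i> * V\<close>, \<open>y = U - \<i> * V\<close> and round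
  \<open>U\<close> and \<open>V\<close> to Eisenstein integers. By the parallelogram law the two
  squared errors add up to at most \<open>7/4\<close>, so their product is at most
  \<open>(7/8)^2\<close>.\<close>

lemma Z12_round:
  obtains q where "q \<in> Z12" "(cmod (x - q))\<^sup>2 * (cmod (y - s12 q))\<^sup>2 < 1"
proof -
  define U where "U = (x + y) / 2"
  define V where "V = (x - y) / (2 * \<i>)"
  obtain a b :: int where ab: "(cmod (U - (of_int a + of_int b * \<omega>)))\<^sup>2 \<le> 7/16" by (rule eisenstein_round)
  obtain c d :: int where cd: "(cmod (V - (of_int c + of_int d * \<omega>)))\<^sup>2 \<le> 7/16" by (rule eisenstein_round)
  define e where "e = U - (of_int a + of_int b * \<omega>)"
  define f where "f = \<i> * (V - (of_int c + of_int d * \<omega>))"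
  have ef: "x - q4 a b c d = e + f" "y - s12 (q4 a b c d) = e - f"
    unfolding s12_q4 by (simp_all add: e_def f_def U_def V_def q4_def field_simps)
  have f: "cmod f = cmod (V - (of_int c + of_int d * \<omega>))" by (simp add: f_def norm_mult)
  have par: "(cmod (e + f))\<^sup>2 + (cmod (e - f))\<^sup>2 = 2 * ((cmod e)\<^sup>2 + (cmod f)\<^sup>2)"
    unfolding cmod_power2 by (simp add: power2_eq_square algebra_simps)
  have sum: "(cmod (e + f))\<^sup>2 + (cmod (e - f))\<^sup>2 \<le> 7/4"
    unfolding par using ab cd unfolding e_def[symmetric] f[symmetric] by simp
  have amgm: "s * t < 1" if "s + t \<le> 7/4" "0 \<le> s" "0 \<le> t" for s t :: real
  proof -
    have "4 * (s * t) \<le> (s + t)\<^sup>2" using zero_le_power2[of "s - t"] by (simp add: power2_eq_square algebra_simps)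
    also have "\<dots> \<le> (7/4)\<^sup>2" using that by (intro power_mono) auto
    finally show ?thesis by (simp add: power2_eq_square)
  qed
  have "(cmod (e + f))\<^sup>2 * (cmod (e - f))\<^sup>2 < 1" by (rule amgm[OF sum]) simp_all
  then show thesis using that[of "q4 a b c d"] unfolding ef by simp
qed

text \<open>The absolute norm: each complex place contributes a squared modulus.\<close>

definition nrm :: "complex \<Rightarrow> real" where
  "nrm x = (cmod x)\<^sup>2 * (cmod (s12 x))\<^sup>2"

text \<open>The norm to \<open>\<int>[\<i>]\<close> shows that the absolute norm is a sum of two squares.\<close>

lemma nrm_sum_squares:
  assumes "x \<in> Z12"
  obtains S t :: int where "nrm x = of_int (S\<^sup>2 + t\<^sup>2)"
proof -
  obtain a b c d where x: "x = q4 a b c d" using assms by (rule Z12_cases)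
  \<comment> \<open>The conjugate of \<open>x\<close> over the Gaussian numbers: \<open>\<i>\<close>
    is fixed and \<open>\<omega>\<close> goes to its square.\<close>
  define y where "y = q4 (a - b) (- b) (c - d) (- d)"
  have y: "y = cnj (s12 x)" by (simp add: x y_def s12_q4 q4_cnj q4_inj)
  define S where "S = a * (a - b) + b * b - (c * (c - d) + d * d)"
  define t where "t = a * (c - d) + b * d + (c * (a - b) + d * b)"
  have "x * y = q4 S 0 t 0"
    unfolding x y_def q4_mult q4_inj S_def t_def by (simp add: algebra_simps)
  then have xy: "x * y = of_int S + \<i> * of_int t" by (simp add: q4_def)
  have "nrm x = (cmod (x * y))\<^sup>2" by (simp add: nrm_def y norm_mult power_mult_distrib)
  also have "\<dots> = of_int (S\<^sup>2 + t\<^sup>2)" unfolding xy by (simp add: cmod_power2)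
  finally show thesis using that by blast
qed

lemma s12_hom:
  assumes "x \<in> Z12" "y \<in> Z12"
  shows "s12 (x + y) = s12 x + s12 y" "s12 (x - y) = s12 x - s12 y" "s12 (x * y) = s12 x * s12 y"
    "s12 (cnj x) = cnj (s12 x)" "s12 x = 0 \<Longrightarrow> x = 0"
  using Z12.\<sigma>_add[of 1 x y] Z12.\<sigma>_diff[of 1 x y] Z12.\<sigma>_mult[of 1 x y] Z12.\<sigma>_cnj[of 1 x] Z12.\<sigma>_inj[of 1 x] assms
  by (simp_all add: conj12_def)

text \<open>A nonzero element \<open>c\<close> of least norm in the ideal generated by the entries
  divides all of them, by \<open>Z12_round\<close>. Dividing the vector by \<open>c\<close> leaves
  one whose entries generate the unit ideal.\<close>

lemma Z12_bezout:
  fixes v :: "3 \<Rightarrow> complex"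
  assumes v: "\<And>i. v i \<in> Z12" and nz: "v k \<noteq> 0"
  obtains c w r where "c \<in> Z12" "\<And>i. v i = c * w i" "\<And>i. w i \<in> Z12" "\<And>i. r i \<in> Z12"
    "(\<Sum>i\<in>UNIV. r i * w i) = 1"
proof -
  define I where "I = {(\<Sum>i\<in>UNIV. r i * v i) | r. \<forall>i. r i \<in> Z12}"
  have I: "(\<Sum>i\<in>UNIV. r i * v i) \<in> I" if "\<And>i. r i \<in> Z12" for r using that by (auto simp: I_def)
  have vI: "v i \<in> I" for i
    using I[of "\<lambda>j. if j = i then 1 else 0"] Z12.R_zero Z12.R_one by (simp add: if_distrib[of "\<lambda>x. x * _"] cong: if_cong)
  have nat_nrm: "real (nat \<lfloor>nrm x\<rfloor>) = nrm x" if x: "x \<in> Z12" for x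
  proof -
    obtain S t :: int where "nrm x = of_int (S\<^sup>2 + t\<^sup>2)" using x by (rule nrm_sum_squares)
    moreover have "0 \<le> S\<^sup>2 + t\<^sup>2" by simp
    ultimately show ?thesis by (metis floor_of_int of_nat_nat of_int_of_nat_eq)
  qed
  have "v k \<in> I \<and> v k \<noteq> 0" using vI nz by simp
  then obtain c where c: "c \<in> I" "c \<noteq> 0" "\<And>y. y \<in> I \<Longrightarrow> y \<noteq> 0 \<Longrightarrow> nat \<lfloor>nrm c\<rfloor> \<le> nat \<lfloor>nrm y\<rfloor>"
    using ex_has_least_nat[of "\<lambda>x. x \<in> I \<and> x \<noteq> 0" "v k" "\<lambda>x. nat \<lfloor>nrm x\<rfloor>"] by blast
  have IZ: "y \<in> Z12" if "y \<in> I" for y using that v by (auto simp: I_def intro!: Z12.R_sum)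
  obtain r where r: "\<And>i. r i \<in> Z12" "c = (\<Sum>i\<in>UNIV. r i * v i)" using c(1) by (auto simp: I_def)
  have c0: "s12 c \<noteq> 0" using s12_hom(5)[OF IZ[OF c(1)] IZ[OF c(1)]] c(2) by blast
  have "\<exists>q\<in>Z12. v i = c * q" for i
  proof -
    obtain q where q: "q \<in> Z12" "(cmod (v i / c - q))\<^sup>2 * (cmod (s12 (v i) / s12 c - s12 q))\<^sup>2 < 1"
      by (rule Z12_round)
    define y where "y = v i - q * c"
    have "y = (\<Sum>j\<in>UNIV. ((if j = i then 1 else 0) - q * r j) * v j)"
      unfolding y_def r(2) by (simp add: left_diff_distrib sum_subtractf sum_distrib_left mult.assoc if_distrib[of "\<lambda>x. x * _"] cong: if_cong)
    then have yI: "y \<in> I" using I[of "\<lambda>j. (if j = i then 1 else 0) - q * r j"] r(1) q(1) by auto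
    have "s12 y = s12 (v i) - s12 q * s12 c"
      unfolding y_def using s12_hom v q(1) IZ[OF c(1)] by simp
    moreover have "v i - q * c = c * (v i / c - q)" "s12 (v i) - s12 q * s12 c = s12 c * (s12 (v i) / s12 c - s12 q)"
      using c(2) c0 by (simp_all add: field_simps)
    ultimately have "nrm y = nrm c * ((cmod (v i / c - q))\<^sup>2 * (cmod (s12 (v i) / s12 c - s12 q))\<^sup>2)"
      by (simp add: nrm_def y_def norm_mult power_mult_distrib)
    also have "\<dots> < nrm c * 1" using q(2) c(2) c0 by (intro mult_strict_left_mono) (auto simp: nrm_def)
    finally have "nrm y < nrm c" by simp
    then have "y = 0"
      using c(3)[OF yI] nat_nrm[OF IZ[OF yI]] nat_nrm[OF IZ[OF c(1)]] by (metis not_le of_nat_le_iff)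
    then show ?thesis using q(1) by (auto simp: y_def mult.commute)
  qed
  then obtain w where w: "\<And>i. w i \<in> Z12" "\<And>i. v i = c * w i" by metis
  have "c * 1 = c * (\<Sum>i\<in>UNIV. r i * w i)"
    using r(2) unfolding w(2) by (simp add: sum_distrib_left mult.left_commute)
  then have "(\<Sum>i\<in>UNIV. r i * w i) = 1" using c(2) by simp
  then show thesis using that[of c w r] w r(1) IZ[OF c(1)] by blast
qed

lemma int_square_mod_4: "\<exists>k::int. S\<^sup>2 = 4 * k \<or> S\<^sup>2 = 4 * k + (1::int)"
proof (cases "even S")
  case True
  then obtain u where "S = 2 * u" by blast
  then have "S\<^sup>2 = 4 * u\<^sup>2" by (simp add: power2_eq_square)
  then show ?thesis by blast
next
  case False
  then obtain u where "S = 2 * u + 1" by (blast elim: oddE)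
  then have "S\<^sup>2 = 4 * (u\<^sup>2 + u) + 1" by (simp add: power2_eq_square algebra_simps)
  then show ?thesis by blast
qed

text \<open>The second factor on the left is 1 modulo 4. For \<open>nu = 1\<close> the two sides
  differ in parity; for \<open>nu = 2\<close> a sum of two squares would be 3 modulo 4.\<close>

lemma norm_equation_unsolvable:
  fixes nu a c S t :: int
  assumes "nu * ((1 + 2 * a)\<^sup>2 - 12 * c\<^sup>2) = - 2 * (S\<^sup>2 + t\<^sup>2)" "nu = 1 \<or> nu = 2"
  shows False
proof -
  have e: "(1 + 2 * a)\<^sup>2 - 12 * c\<^sup>2 = 4 * (a\<^sup>2 + a - 3 * c\<^sup>2) + 1"
    by (simp add: power2_eq_square algebra_simps)
  obtain k l :: int where kl: "S\<^sup>2 = 4 * k \<or> S\<^sup>2 = 4 * k + 1" "t\<^sup>2 = 4 * l \<or> t\<^sup>2 = 4 * l + 1"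
    using int_square_mod_4 by metis
  define m where "m = a\<^sup>2 + a - 3 * c\<^sup>2"
  have "nu * (4 * m + 1) = - 2 * (S\<^sup>2 + t\<^sup>2)" using assms(1) e by (simp add: m_def)
  with assms(2) kl show False by presburger
qed

text \<open>
  \<open>Q\<close> would be the projection \<open>w w^* H / N\<close> to a line that is positive at the first place, with \<open>w\<close> primitive and
  \<open>N = H(w,w)\<close> totally positive. Then \<open>N\<close> divides \<open>1 + sqrt 3\<close>, so its norm is 1 or 2, and the norm of the entry
  \<open>- (1 + sqrt 3) |w_3|^2 / N\<close> is minus a sum of two squares up to a factor 2. But this entry is 1 modulo 2.
\<close>

lemma no_positive_projection:
  fixes Q :: "complex^3^3"
  assumes QR: "\<And>i j. Q$i$j \<in> Z12" and rank: "\<And>i j. Q$i$j = U i * W j" and idem: "Q ** Q = Q"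
    and adj: "\<And>i j. complex_of_real (Z12.h' 0 i) * Q$i$j = complex_of_real (Z12.h' 0 j) * cnj (Q$j$i)"
    and Q33: "Q$3$3 = 1 + 2 * y" "y \<in> Z12" "Re (Q$3$3) < 0"
  shows False
proof -
  define \<alpha> where "\<alpha> = complex_of_real (a12 0)"
  define \<eta> :: "3 \<Rightarrow> complex" where "\<eta> i = (if i = 3 then - \<alpha> else 1)" for i
  have h': "complex_of_real (Z12.h' 0 i) = \<eta> i" for i
    by (simp add: Z12.h'_def \<eta>_def \<alpha>_def)
  have \<alpha>R: "\<alpha> \<in> Z12" using Z12.a_R by (simp add: \<alpha>_def)
  have \<alpha>0: "\<alpha> \<noteq> 0" using Z12.a_pos by (simp add: \<alpha>_def)
  have nz: "Q$3$3 \<noteq> 0" using Q33(3) by auto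
  obtain c w r where cwr: "c \<in> Z12" "\<And>i. Q$i$3 = c * w i" "\<And>i. w i \<in> Z12" "\<And>i. r i \<in> Z12"
    "(\<Sum>i\<in>UNIV. r i * w i) = 1"
    by (rule Z12_bezout[of "\<lambda>i. Q$i$3" 3, OF QR nz]) (rule that)
  have W3: "W 3 \<noteq> 0" using nz rank[of 3 3] by auto
  \<comment> \<open>The Bezout coefficients recover the row factor from the integral matrix
    \<open>Q\<close>, so \<open>Q = w l\<close> holds over the ring; idempotence then normalizes
    \<open>l\<close> to take the value 1 on \<open>w\<close>.\<close>
  define l where "l j = (\<Sum>i\<in>UNIV. r i * Q$i$j)" for j
  have lR: "l j \<in> Z12" for j unfolding l_def using cwr(4) QR by (intro Z12.R_sum Z12.R_mult)
  have Q: "Q$i$j = w i * l j" for i j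
  proof -
    have U: "U i = c * w i / W 3" for i using cwr(2)[of i] rank[of i 3] W3 by (simp add: field_simps)
    define q where "q = c * W j / W 3"
    have Qw: "Q$i$j = w i * q" for i unfolding rank U q_def by simp
    have "l j = (\<Sum>i\<in>UNIV. r i * w i) * q"
      unfolding l_def Qw by (simp add: sum_distrib_right mult.assoc)
    then show ?thesis using Qw cwr(5) by simp
  qed
  have lw: "(\<Sum>k\<in>UNIV. l k * w k) = 1"
  proof -
    have "(Q ** Q)$3$3 = (w 3 * l 3) * (\<Sum>k\<in>UNIV. l k * w k)"
      by (simp add: matrix_matrix_mult_def Q sum_distrib_left algebra_simps)
    then show ?thesis using idem nz by (simp add: Q)
  qed
  define N where "N = (\<Sum>i\<in>UNIV. \<eta> i * (w i * cnj (w i)))"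
  have \<eta>R: "\<eta> i \<in> Z12" for i using \<alpha>R by (simp add: \<eta>_def)
  have NR: "N \<in> Z12" unfolding N_def using cwr(3) \<eta>R by (intro Z12.R_sum Z12.R_mult Z12.R_cnj)
  have Nl: "N * l j = \<eta> j * cnj (w j)" for j
  proof -
    have "N * l j = (\<Sum>i\<in>UNIV. cnj (w i) * (\<eta> i * Q$i$j))"
      unfolding N_def Q by (simp add: sum_3 algebra_simps)
    also have "\<dots> = (\<Sum>i\<in>UNIV. \<eta> j * cnj (w j) * cnj (l i * w i))"
      using adj by (simp add: h' Q algebra_simps)
    also have "\<dots> = \<eta> j * cnj (w j) * cnj (\<Sum>i\<in>UNIV. l i * w i)"
      by (simp add: sum_distrib_left)
    finally show ?thesis using lw by simp
  qed
  \<comment> \<open>Built so that \<open>Nl\<close> turns \<open>N * s\<close> into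
    \<open>\<alpha>\<close> times the conjugate Bezout relation; the weights even out the
    coefficients 1, 1, \<open>- \<alpha>\<close> of the form. Hence \<open>N\<close> divides
    \<open>\<alpha>\<close>.\<close>
  define s where "s = \<alpha> * cnj (r 1) * l 1 + \<alpha> * cnj (r 2) * l 2 - cnj (r 3) * l 3"
  have sR: "s \<in> Z12" unfolding s_def using \<alpha>R cwr(4) lR by simp
  have Ns: "N * s = \<alpha>"
  proof -
    have "N * s = \<alpha> * cnj (r 1) * (N * l 1) + \<alpha> * cnj (r 2) * (N * l 2) - cnj (r 3) * (N * l 3)"
      by (simp add: s_def algebra_simps)
    also have "\<dots> = \<alpha> * cnj (\<Sum>i\<in>UNIV. r i * w i)"
      unfolding Nl by (simp add: sum_3 \<eta>_def algebra_simps)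
    finally show ?thesis using cwr(5) by simp
  qed
  have N_real: "cnj N = N" unfolding N_def by (simp add: sum_3 \<eta>_def \<alpha>_def mult.commute)
  have s_real: "cnj s = s"
  proof -
    have "N * cnj s = cnj (N * s)" using N_real by simp
    also have "\<dots> = N * s" unfolding Ns by (simp add: \<alpha>_def)
    finally show ?thesis using Ns \<alpha>0 by auto
  qed
  have x_real: "cnj (Q$3$3) = Q$3$3" using adj[of 3 3] \<alpha>0 by (simp add: h' \<eta>_def)
  then have y_real: "cnj y = y" using Q33(1) by simp
  let ?r = "complex_of_real (sqrt 3)"
  have rr: "?r * ?r = 3" by (simp flip: of_real_mult)
  obtain n1 n2 where n: "N = of_int n1 + of_int n2 * ?r" "s12 N = of_int n1 - of_int n2 * ?r"
    using NR N_real by (rule Z12_real)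
  obtain s1 s2 where s: "s = of_int s1 + of_int s2 * ?r" "s12 s = of_int s1 - of_int s2 * ?r"
    using sR s_real by (rule Z12_real)
  obtain y1 y2 where y: "y = of_int y1 + of_int y2 * ?r" "s12 y = of_int y1 - of_int y2 * ?r"
    using Q33(2) y_real by (rule Z12_real)
  have s\<alpha>: "s12 \<alpha> = complex_of_real (1 - sqrt 3)"
    using Z12.\<sigma>_a[of 1] by (simp add: conj12_def \<alpha>_def a12_def)
  have \<alpha>norm: "\<alpha> * s12 \<alpha> = - 2"
  proof -
    have "\<alpha> * s12 \<alpha> = complex_of_real ((1 + sqrt 3) * (1 - sqrt 3))"
      unfolding s\<alpha> of_real_mult by (simp add: \<alpha>_def a12_def)
    also have "(1 + sqrt 3) * (1 - sqrt 3) = - 2" by (simp add: algebra_simps)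
    finally show ?thesis by simp
  qed
  define \<nu> where "\<nu> = n1\<^sup>2 - 3 * n2\<^sup>2"
  have conj_prod: "(of_int u + of_int v * ?r) * (of_int u - of_int v * ?r) = of_int (u\<^sup>2 - 3 * v\<^sup>2)" for u v :: int
  proof -
    have "(of_int u + of_int v * ?r) * (of_int u - of_int v * ?r) = of_int u * of_int u - of_int v * of_int v * (?r * ?r)"
      by (simp add: algebra_simps)
    then show ?thesis unfolding rr by (simp add: power2_eq_square)
  qed
  have \<nu>: "N * s12 N = of_int \<nu>" by (subst n(2), subst n(1), simp only: \<nu>_def conj_prod)
  have "of_int (\<nu> * (s1\<^sup>2 - 3 * s2\<^sup>2)) = (N * s12 N) * (s * s12 s)"
    by (subst s(2), subst s(1), simp only: \<nu> conj_prod of_int_mult)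
  also have "\<dots> = (N * s) * s12 (N * s)" using s12_hom(3)[OF NR sR] by simp
  also have "\<dots> = of_int (- 2)" unfolding Ns using \<alpha>norm by simp
  finally have "\<nu> * (s1\<^sup>2 - 3 * s2\<^sup>2) = - 2" unfolding of_int_eq_iff .
  then have "\<nu> dvd 2" by (metis dvd_minus_iff dvd_triv_left)
  define x where "x = Q$3$3"
  have Nx: "N * x = - \<alpha> * (w 3 * cnj (w 3))"
  proof -
    have "N * x = w 3 * (N * l 3)" by (simp add: x_def Q)
    then show ?thesis unfolding Nl by (simp add: \<eta>_def)
  qed
  have w3: "w 3 \<noteq> 0" using nz by (auto simp: Q)
  \<comment> \<open>At the first place \<open>N\<close> times the negative number \<open>x\<close>
    is \<open>- \<alpha> |w_3|^2\<close>, so \<open>N\<close> is positive; at the second place the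
    form is positive definite.\<close>
  have "0 < \<nu>"
  proof -
    define Nr where "Nr = real_of_int n1 + of_int n2 * sqrt 3"
    define Nr' where "Nr' = real_of_int n1 - of_int n2 * sqrt 3"
    have Nr: "N = of_real Nr" "s12 N = of_real Nr'" using n by (simp_all add: Nr_def Nr'_def)
    have "x = of_real (Re x)" using x_real by (simp add: x_def complex_eq_iff)
    then have "complex_of_real (Nr * Re x) = of_real (- (a12 0) * (cmod (w 3))\<^sup>2)"
      using Nx unfolding Nr of_real_cmod_sq \<alpha>_def by (metis of_real_minus of_real_mult)
    then have "Nr * Re x = - (a12 0) * (cmod (w 3))\<^sup>2" unfolding of_real_eq_iff .
    moreover have "0 < a12 0 * (cmod (w 3))\<^sup>2" using Z12.a_pos w3 by simp
    ultimately have "Nr * Re x < 0" by linarith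
    then have pos: "0 < Nr" using Q33(3) by (simp add: x_def mult_less_0_iff)
    have "s12 N = s12 (w 1 * cnj (w 1) + w 2 * cnj (w 2) - \<alpha> * (w 3 * cnj (w 3)))"
      by (simp add: N_def sum_3 \<eta>_def)
    also have "\<dots> = s12 (w 1) * cnj (s12 (w 1)) + s12 (w 2) * cnj (s12 (w 2)) - s12 \<alpha> * (s12 (w 3) * cnj (s12 (w 3)))"
      using cwr(3) \<alpha>R by (simp add: s12_hom)
    also have "\<dots> = of_real ((cmod (s12 (w 1)))\<^sup>2 + (cmod (s12 (w 2)))\<^sup>2 + (sqrt 3 - 1) * (cmod (s12 (w 3)))\<^sup>2)"
      unfolding of_real_cmod_sq s\<alpha> by (simp add: algebra_simps)
    finally have "Nr' = (cmod (s12 (w 1)))\<^sup>2 + (cmod (s12 (w 2)))\<^sup>2 + (sqrt 3 - 1) * (cmod (s12 (w 3)))\<^sup>2"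
      unfolding Nr(2) of_real_eq_iff .
    moreover have "s12 (w 3) \<noteq> 0" using s12_hom(5)[OF cwr(3) cwr(3)] w3 by blast
    then have "0 < (sqrt 3 - 1) * (cmod (s12 (w 3)))\<^sup>2" by simp
    ultimately have "0 < Nr'"
      using zero_le_power2[of "cmod (s12 (w 1))"] zero_le_power2[of "cmod (s12 (w 2))"] by linarith
    with pos have "0 < Nr * Nr'" by simp
    also have "Nr * Nr' = real_of_int \<nu>"
    proof -
      have "complex_of_real (Nr * Nr') = of_real (real_of_int \<nu>)" using \<nu> unfolding Nr(2) unfolding Nr(1) by simp
      then show ?thesis unfolding of_real_eq_iff .
    qed
    finally show ?thesis by simp
  qed
  with \<open>\<nu> dvd 2\<close> have \<nu>12: "\<nu> = 1 \<or> \<nu> = 2" by (auto dest!: zdvd_imp_le)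
  obtain S t :: int where St: "nrm (w 3) = of_int (S\<^sup>2 + t\<^sup>2)" using cwr(3) by (rule nrm_sum_squares)
  have xx: "x * s12 x = of_int ((1 + 2 * y1)\<^sup>2 - 12 * y2\<^sup>2)"
  proof -
    have two: "(2::complex) \<in> Z12" "s12 1 = 1" "s12 2 = 2"
      using Z12.\<sigma>_of_nat[of 1 1] Z12.\<sigma>_of_nat[of 1 2] by (simp_all add: conj12_def)
    have "s12 x = 1 + 2 * s12 y" unfolding x_def Q33(1) using Q33(2) two by (simp add: s12_hom)
    then have "s12 x = of_int (1 + 2 * y1) - of_int (2 * y2) * ?r" unfolding y(2) by (simp add: algebra_simps)
    moreover have "x = of_int (1 + 2 * y1) + of_int (2 * y2) * ?r" unfolding x_def Q33(1) y(1) by (simp add: algebra_simps)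
    ultimately have "x * s12 x = of_int ((1 + 2 * y1)\<^sup>2 - 3 * (2 * y2)\<^sup>2)" by (simp only: conj_prod)
    then show ?thesis by (simp add: power_mult_distrib)
  qed
  have xR: "x \<in> Z12" using QR by (simp add: x_def)
  \<comment> \<open>Norms of both sides of \<open>Nx\<close>, down from the field of
    \<open>sqrt 3\<close>: \<open>\<alpha>\<close> contributes -2 and \<open>w 3 * cnj (w 3)\<close>
    the absolute norm of \<open>w 3\<close>.\<close>
  have "of_int (\<nu> * ((1 + 2 * y1)\<^sup>2 - 12 * y2\<^sup>2)) = (N * s12 N) * (x * s12 x)" unfolding \<nu> xx by simp
  also have "\<dots> = (N * x) * s12 (N * x)" using s12_hom(3)[OF NR xR] by simp
  also have "s12 (N * x) = - s12 \<alpha> * (s12 (w 3) * cnj (s12 (w 3)))"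
  proof -
    have "s12 (N * x) = s12 (0 - \<alpha> * (w 3 * cnj (w 3)))" unfolding Nx by simp
    also have "\<dots> = s12 0 - s12 (\<alpha> * (w 3 * cnj (w 3)))"
      using \<alpha>R cwr(3) by (intro s12_hom(2)) auto
    also have "s12 (\<alpha> * (w 3 * cnj (w 3))) = s12 \<alpha> * (s12 (w 3) * cnj (s12 (w 3)))"
      using \<alpha>R cwr(3) by (simp add: s12_hom)
    also have "s12 0 = 0" using Z12.\<sigma>_zero[of 1] by (simp add: conj12_def)
    finally show ?thesis by simp
  qed
  also have "(N * x) * (- s12 \<alpha> * (s12 (w 3) * cnj (s12 (w 3)))) =
      (\<alpha> * s12 \<alpha>) * (w 3 * cnj (w 3) * (s12 (w 3) * cnj (s12 (w 3))))"
    unfolding Nx by (simp add: algebra_simps)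
  also have "\<dots> = - 2 * of_real (nrm (w 3))"
    unfolding \<alpha>norm of_real_cmod_sq nrm_def by simp
  also have "\<dots> = of_int (- 2 * (S\<^sup>2 + t\<^sup>2))" unfolding St by simp
  finally have "\<nu> * ((1 + 2 * y1)\<^sup>2 - 12 * y2\<^sup>2) = - 2 * (S\<^sup>2 + t\<^sup>2)" unfolding of_int_eq_iff .
  then show False using \<nu>12 by (rule norm_equation_unsolvable)
qed

text \<open>Infinitely many fixed points give \<open>h\<close> a double eigenvalue with a negative
  eigenvector. If it is 1, then \<open>h = 1\<close>, against \<open>h\<close> being diag(-1, -1, 1)
  modulo 4. If it is -1, then \<open>(h + 1)/2\<close> is a rank one projection to a line orthogonal
  to a negative vector, hence positive; level 4 makes it integral and equal to diag(0, 0, 1) modulo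
  2.\<close>

lemma involution_coset_isolated:
  assumes A: "A \<in> Z12.\<Gamma>" and h: "h = A ** diag3 (-1) (-1) 1" and hh: "h [^]\<^bsub>SU21\<^esub> (2::nat) = mat 1"
  shows "finite {z \<in> CH2. CH2_act h z = z}"
proof (rule ccontr)
  assume inf: "infinite {z \<in> CH2. CH2_act h z = z}"
  let ?g = "diag3 (-1) (-1) 1"
  have AS: "A \<in> carrier SU21" "Z12.cong4 (Z12.cj A)" using A by (auto simp: Z12.\<Gamma>_def)
  have hS: "h \<in> carrier SU21" unfolding h using AS diag3_SU21[of "-1" "-1" 1] by auto
  have h2: "h ** h = mat 1" using hh hS by (simp add: numeral_2_eq_2)
  obtain X where X: "Z12.Rmat X" "Z12.cj A = mat 1 + 4 *\<^sub>R X" using AS(2) by (auto simp: Z12.cong4_def)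
  define Y where "Y = X ** ?g"
  have Rg: "Z12.Rmat ?g" by (simp add: Z12.Rmat_def diag3_def)
  have Y: "Z12.Rmat Y" unfolding Y_def by (intro Z12.Rmat_closed X Rg)
  have M: "Z12.cj h = ?g + 4 *\<^sub>R Y"
    by (simp add: h Z12.cj_mult Z12.cj_diag3 X Y_def matrix_add_rdistrib matrix_scaleR_left)
  have M_entry: "(Z12.cj h)$i$j = ?g$i$j + 4 * Y$i$j" for i j
    unfolding M by (simp only: vector_add_component vector_scaleR_component) (simp add: scaleR_conv_of_real)
  have YR: "Y$i$j \<in> Z12" for i j using Y by (simp add: Z12.Rmat_def)
  obtain e z w where e: "e ^ 2 = 1" "z \<in> CH2" "h *v CH2_lift z = e *s CH2_lift z"
    "h *v CH2_lift w = e *s CH2_lift w" "cross (CH2_lift z) (CH2_lift w) \<noteq> 0"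
    using infinite_fixed_points_eigenvectors[OF hS hh _ inf] by auto
  have "e = 1 \<or> e = - 1" using e(1) by (simp add: power2_eq_1_iff)
  then show False
  proof
    assume e1: "e = 1"
    have "det h = 1" using hS by (simp add: SU21_iff)
    from double_eigenvalue[OF e(3-5) this] obtain m where m: "e\<^sup>2 * m = 1" "(h - mat e) ** (h - mat m) = 0" .
    have "m = 1" using m(1) e1 by simp
    then have "(h + - mat 1) ** (h + - mat 1) = 0" using m(2) e1 by simp
    moreover have neg: "(- mat 1 :: complex^3^3) = (-1) *\<^sub>R mat 1" by simp
    ultimately have "mat 1 + (-1) *\<^sub>R h + ((-1) *\<^sub>R h + mat 1) = 0"
      unfolding neg matrix_add_ldistrib matrix_add_rdistrib matrix_scaleR_left matrix_scaleR_right
      using h2 by simp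
    then have "2 *\<^sub>R h = 2 *\<^sub>R mat 1" by (simp add: scaleR_2 algebra_simps)
    then have "Z12.cj h = mat 1" by simp
    then have "(Z12.cj h)$1$1 = 1" by (simp add: mat_def)
    then have "2 * Y$1$1 = 1" unfolding M_entry by (simp add: diag3_def)
    then have "(2 * Y$1$1) * (2 * Y$1$1) = 1" by simp
    then have "4 * (Y$1$1 * Y$1$1) = 1" by (simp add: mult_ac)
    then show False using Z12.four_not_unit[of "Y$1$1 * Y$1$1"] YR by blast
  next
    assume e1: "e = - 1"
    define K where "K = h - mat e"
    have K_entry: "K$i$j = h$i$j + (if i = j then 1 else 0)" for i j by (simp add: K_def e1 mat_def)
    obtain u t where ut: "\<And>i k. K$i$k = u i * t k"
      using rank_one[OF eigenvector_kernel[OF e(3)] eigenvector_kernel[OF e(4)] e(5)] unfolding K_def by blast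
    \<comment> \<open>This is half of \<open>cj h + 1\<close>, in a form that shows its
      integrality.\<close>
    define Q where "Q = diag3 0 0 1 + 2 *\<^sub>R Y"
    have Q_entry: "Q$i$j = diag3 0 0 1 $i$j + 2 * Y$i$j" for i j
      unfolding Q_def by (simp only: vector_add_component vector_scaleR_component) (simp add: scaleR_conv_of_real)
    have QM: "2 * Q$i$j = (Z12.cj h)$i$j + (if i = j then 1 else 0)" for i j
      unfolding Q_entry M_entry using exhaust_3[of i] exhaust_3[of j] by (auto simp: diag3_def algebra_simps)
    have QK: "2 * Q$i$j = K$i$j * Z12.d j / Z12.d i" for i j
      unfolding QM Z12.cj_entry K_entry by (simp add: field_simps)
    show False
    proof (rule no_positive_projection)
      show "Q$i$j \<in> Z12" for i j using YR unfolding Q_entry by (simp add: diag3_def)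
      show "Q$i$j = (u i / (2 * Z12.d i)) * (t j * Z12.d j)" for i j
        using QK[of i j] unfolding ut by (simp add: field_simps)
      show "Q ** Q = Q"
      proof -
        have M2: "Z12.cj h ** Z12.cj h = mat 1" using h2 by (simp flip: Z12.cj_mult)
        have Mh: "(Z12.cj h)$i$j = 2 * Q$i$j - (if i = j then 1 else 0)" for i j
          using QM[of i j] by (simp add: algebra_simps)
        have "(Q ** Q)$i$j = Q$i$j" for i j
        proof -
          have "(\<Sum>k\<in>UNIV. (2 * Q$i$k - (if i = k then 1 else 0)) * (2 * Q$k$j - (if k = j then 1 else 0))) = (mat 1 :: complex^3^3)$i$j"
            using M2 by (simp add: matrix_matrix_mult_def vec_eq_iff Mh)
          then have "4 * (\<Sum>k\<in>UNIV. Q$i$k * Q$k$j) = 4 * Q$i$j"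
            using exhaust_3[of i] exhaust_3[of j] by (auto simp: sum_3 mat_def algebra_simps)
          then show ?thesis by (simp add: matrix_matrix_mult_def)
        qed
        then show ?thesis by (simp add: vec_eq_iff)
      qed
      show "complex_of_real (Z12.h' 0 i) * Q$i$j = complex_of_real (Z12.h' 0 j) * cnj (Q$j$i)" for i j
      proof -
        have "complex_of_real (Z12.h' 0 i) * (2 * Q$i$j) = complex_of_real (Z12.h' 0 j) * cnj (2 * Q$j$i)"
          unfolding QM using Z12.involution_selfadjoint[OF hS h2, of i j] by (simp add: distrib_left)
        then show ?thesis by simp
      qed
      show "Q$3$3 = 1 + 2 * Y$3$3" by (simp add: Q_entry diag3_def)
      show "Y$3$3 \<in> Z12" by (rule YR)
      show "Re (Q$3$3) < 0"
      proof -
        let ?Z = "CH2_lift z"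
        \<comment> \<open>\<open>y\<close> lies in the image of \<open>h + 1\<close>, which is
          orthogonal to the negative eigenvector, so \<open>herm y y\<close> is positive; on the
          other hand it equals minus twice the real part of
          \<open>K$3$3 = 2 * Q$3$3\<close>.\<close>
        define y where "y = h *v axis 3 1 + axis 3 1"
        have K33: "K$3$3 = 2 * Q$3$3" using QK[of 3 3] by simp
        have "1 + 2 * Y$3$3 \<noteq> 0"
        proof
          assume "1 + 2 * Y$3$3 = 0"
          then have "Y$3$3 = - 1/2" by (simp add: add_eq_0_iff field_simps)
          then have "4 * (Y$3$3 * Y$3$3) = 1" by simp
          then show False using Z12.four_not_unit[of "Y$3$3 * Y$3$3"] YR by blast
        qed
        then have "Q$3$3 \<noteq> 0" by (simp add: Q_entry diag3_def)
        then have "K$3$3 \<noteq> 0" using K33 by simp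
        have y3: "y$3 = K$3$3" by (simp add: y_def K_entry matrix_vector_axis)
        then have "y \<noteq> 0" using \<open>K$3$3 \<noteq> 0\<close> by auto
        moreover have "herm y ?Z = 0"
        proof -
          have "herm (axis 3 1) ?Z = herm (h *v axis 3 1) (h *v ?Z)" using hS by (simp add: SU21_iff)
          also have "\<dots> = - herm (h *v axis 3 1) ?Z" unfolding e(3) e1 by (simp add: herm_def algebra_simps)
          finally show ?thesis unfolding y_def herm_add_left by simp
        qed
        ultimately have "0 < Re (herm y y)" using orthogonal_to_negative_positive[OF e(2)] by blast
        moreover have "herm y y = - (K$3$3 + cnj (K$3$3))"
        proof -
          have "herm (h *v axis 3 1) (h *v axis 3 1) = herm (axis 3 1) (axis 3 1)" using hS by (simp add: SU21_iff)
          also have "\<dots> = - 1" by (simp add: herm_def axis_def)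
          finally have "herm y y = - 1 + herm (h *v axis 3 1) (axis 3 1) + (herm (axis 3 1) (h *v axis 3 1) - 1)"
            unfolding y_def herm_add_left herm_add_right by (simp add: herm_def axis_def)
          also have "herm (h *v axis 3 1) (axis 3 1) = - h$3$3"
            unfolding herm_def matrix_vector_axis by (simp add: axis_def)
          also have "herm (axis 3 1) (h *v axis 3 1) = - cnj (h$3$3)"
            unfolding herm_def matrix_vector_axis by (simp add: axis_def)
          finally show ?thesis by (simp add: K_entry)
        qed
        ultimately show ?thesis unfolding K33 by simp
      qed
    qed
  qed
qed

theorem involution_action:
  "isolated_cyclic_action 2"
proof -
  let ?g = "diag3 (-1) (-1) 1"
  have gS: "?g \<in> carrier SU21" by (rule diag3_SU21) auto
  have "Z12.cj ?g = ?g" by (rule Z12.cj_diag3)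
  moreover have "Z12.Rmat ?g" by (simp add: Z12.Rmat_def diag3_def)
  ultimately have "Z12.Rmat (Z12.cj ?g)" by simp
  with gS have g: "?g \<in> Z12.G" unfolding Z12.G_def by blast
  show ?thesis
  proof (rule uniform_lattice.cyclic_action[OF Z12.uniform_lattice _ g])
    show "?g [^]\<^bsub>SU21\<^esub> (2::nat) = mat 1" by (simp add: diag3_power diag3_one)
    show "CH2_act ?g 0 = 0" by (rule diag3_fixes_zero)
    fix k A assume "0 < k" "k < (2::nat)" and A: "A \<in> Z12.\<Gamma>"
      and hh: "(A ** ?g [^]\<^bsub>SU21\<^esub> k) [^]\<^bsub>SU21\<^esub> (2::nat) = mat 1"
    then have "k = 1" by simp
    then have "?g [^]\<^bsub>SU21\<^esub> k = ?g" by (simp add: diag3_power)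
    then show "finite {z \<in> CH2. CH2_act (A ** ?g [^]\<^bsub>SU21\<^esub> k) z = z}"
      using involution_coset_isolated[OF A refl] hh by simp
  qed simp
qed

theorem theorem1p1:
  fixes p :: nat
  assumes "prime p"
  shows "\<exists>X \<phi>. complex_hyperbolic_surface X \<and>
           isometric_action (integer_mod_group p) X surface_dist \<phi> \<and>
           \<not> free_action (integer_mod_group p) X \<phi> \<and>
           only_isolated_fixed_points (integer_mod_group p) X surface_dist \<phi>"
proof -
  have "\<not> prime (4::nat)" by (auto simp: prime_nat_iff intro!: exI[of _ 2])
  with assms have "p \<noteq> 0" "p \<noteq> 1" "p \<noteq> 4" by auto
  then consider "p = 2" | "p = 3" | "5 \<le> p" by linarith
  then show ?thesis
  proof cases
    case 3
    then interpret cyclotomic p using assms by unfold_locales auto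
    show ?thesis using 3 by (rule cyclotomic_action)
  qed (use involution_action order_three_action in simp_all)
qed

end
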